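(* Let $A=\Bbbk Q/I$ be a string algebra over a field $\Bbbk$ and let $\phi\in \operatorname{Aut}_0(A)\cap H_A$. Then there exist $y\in A_+$, $\rho\in D(A)$, and a derivation $\delta$ of type II such that $\phi=\exp(\delta)\circ\rho\circ\Delta_{1+y}$.
   Context: Quivers $Q=(Q_0,Q_1,s,t)$ are finite, connected, with at least one arrow. A path of length $\ell(p)=n\ge 1$ is $p=\alpha_1\cdots\alpha_n$ with $\alpha_i\in Q_1$, $t(\alpha_i)=s(\alpha_{i+1})$; its first arrow is $F(p)=\alpha_1$, its last arrow $L(p)=\alpha_n$, $s(p)=s(\alpha_1)$, $t(p)=t(\alpha_n)$. For each vertex $v$ there is a stationary path $\epsilon_v$ of length $0$ with $s(\epsilon_v)=t(\epsilon_v)=v$, $F(\epsilon_v)=L(\epsilon_v)=\epsilon_v$. Two paths are parallel if they have the same source and the same target. $\Bbbk Q$ is the path algebra (product = concatenation). $A=\Bbbk Q/I$ is a string algebra if: (i) every vertex has in-degree $\le 2$ and out-degree $\le 2$; (ii) whenever $s(\alpha)=t(\beta)=t(\beta')$ with $\beta\ne\beta'$ arrows, at least one of $\beta\alpha,\beta'\alpha$ is in $I$; (iii) whenever $t(\alpha)=s(\beta)=s(\beta')$ with $\beta\neq\beta'$, at least one of $\alpha\beta,\alpha\beta'$ is in $I$; (iv) $I$ is generated by paths; (v) $A$ is finite-dimensional, i.e. $I$ is admissible. $\mathcal B$ is the basis of $A$ of paths not in $I$; $A_n$ is the span of paths in $\mathcal B$ of length $n$; $A_{>n}=\bigoplus_{m>n}A_m$,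 $A_+=A_{>0}$. A path $p\in\mathcal B$ is left maximal if $\alpha p=0$ in $A$ for all $\alpha\in Q_1$, right maximal if $p\alpha=0$ in $A$ for all $\alpha\in Q_1$. $H_A$ is the group of algebra automorphisms of $A$ fixing every $\epsilon_v$. $\operatorname{Aut}_0(A)$ is the group of automorphisms $f$ such that for every $n$ and $x\in A_n$ the degree $n$ component of $f(x)$ is $x$. For a unit $u$, $\Delta_u(z)=u^{-1}zu$. $D(A)$ is the set of $\phi\in H_A\cap\operatorname{Aut}_0(A)$ such that for each $w\in\mathcal B$, $\phi(w)$ lies in the $\Bbbk$-span of $\{w'\in\mathcal B: F(w')=F(w),\ L(w')=L(w)\}$. For $a\in Q_1$ and $p\in\mathcal B$ such that (1) $p$ is parallel to $a$, (2) $p$ is left maximal or $F(p)=a$, (3) $p$ is right maximal or $L(p)=a$, $\delta_{(a,p)}$ is the derivation of $A$ sending $a$ to $p$ and every other arrow and every stationary path to $0$; one extends linearly: $\delta_{(a,\sum\lambda_ip_i)}=\sum\lambda_i\delta_{(a,p_i)}$. A derivation is of type II if it equals $\sum_{a\in Q_1}\delta_{(a,y_a)}$ where each $y_a\in A_{>1}$ is a linear combination of left maximal paths satisfying (1)-(3) with respect to $a$. For a locally nilpotent derivation $\delta$, $\exp(\delta)(x)=\sum_{n}\frac1{n!}\delta^n(x)$, the sum being over those $n\ge 0$ with $\delta^n(x)\ne0$. *)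

theory Defs
  imports
    "HOL-Algebra.QuotRing"
    "HOL-Algebra.Module"
    "HOL-Algebra.Ideal_Product"
    "HOL-Library.Poly_Mapping"
    "Graph_Theory.Digraph_Component"
begin

section \<open>Quivers and paths\<close>

text \<open>
  Finite digraphs in the sense of \<^locale>\<open>fin_digraph\<close> may have loops and multiple arrows;
  connectedness is that of the underlying undirected graph.
\<close>

locale quiver = fin_digraph Q for Q :: "('v, 'e) pre_digraph" (structure) +
  assumes connected_quiver: "Digraph_Component.connected Q"
    and has_arrow: "arcs Q \<noteq> {}"

text \<open>
  A path is its source together with its list of arrows, read from left to right, so that
  \<open>(v, [])\<close> is the stationary path at \<open>v\<close>.
\<close>

type_synonym ('v, 'e) qpath = "'v \<times> 'e list"

definition paths :: "('v, 'e) pre_digraph \<Rightarrow> ('v, 'e) qpath set" where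
  "paths Q = {(u, es). \<exists>v. pre_digraph.awalk Q u es v}"

definition psource :: "('v, 'e) qpath \<Rightarrow> 'v" where
  "psource p = fst p"

definition ptarget :: "('v, 'e) pre_digraph \<Rightarrow> ('v, 'e) qpath \<Rightarrow> 'v" where
  "ptarget Q p = pre_digraph.awlast Q (fst p) (snd p)"

definition plength :: "('v, 'e) qpath \<Rightarrow> nat" where
  "plength p = length (snd p)"

definition stat :: "'v \<Rightarrow> ('v, 'e) qpath" where
  "stat v = (v, [])"

definition arrow :: "('v, 'e) pre_digraph \<Rightarrow> 'e \<Rightarrow> ('v, 'e) qpath" where
  "arrow Q a = (tail Q a, [a])"

definition first_arrow :: "('v, 'e) pre_digraph \<Rightarrow> ('v, 'e) qpath \<Rightarrow> ('v, 'e) qpath" where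
  "first_arrow Q p = (if snd p = [] then p else arrow Q (hd (snd p)))"

definition last_arrow :: "('v, 'e) pre_digraph \<Rightarrow> ('v, 'e) qpath \<Rightarrow> ('v, 'e) qpath" where
  "last_arrow Q p = (if snd p = [] then p else arrow Q (last (snd p)))"

definition parallel :: "('v, 'e) pre_digraph \<Rightarrow> ('v, 'e) qpath \<Rightarrow> ('v, 'e) qpath \<Rightarrow> bool" where
  "parallel Q p q \<longleftrightarrow> psource p = psource q \<and> ptarget Q p = ptarget Q q"

definition pconcat :: "('v, 'e) qpath \<Rightarrow> ('v, 'e) qpath \<Rightarrow> ('v, 'e) qpath" where
  "pconcat p q = (fst p, snd p @ snd q)"


section \<open>The path algebra and its quotients\<close>

text \<open>
  The library's algebra locale covers commutative algebras only, but its record type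
  (a ring with a scalar multiplication) serves for noncommutative ones as well.
\<close>

definition path_mult ::
    "('v, 'e) pre_digraph \<Rightarrow> (('v, 'e) qpath \<Rightarrow>\<^sub>0 'k::field) \<Rightarrow> (('v, 'e) qpath \<Rightarrow>\<^sub>0 'k)
      \<Rightarrow> (('v, 'e) qpath \<Rightarrow>\<^sub>0 'k)" where
  "path_mult Q f g =
    (\<Sum>p\<in>Poly_Mapping.keys f. \<Sum>q\<in>Poly_Mapping.keys g.
       if ptarget Q p = psource q
       then Poly_Mapping.single (pconcat p q) (Poly_Mapping.lookup f p * Poly_Mapping.lookup g q)
       else 0)"

definition path_algebra ::
    "('v, 'e) pre_digraph \<Rightarrow> ('k::field, ('v, 'e) qpath \<Rightarrow>\<^sub>0 'k) module" where
  "path_algebra Q =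
    \<lparr> carrier = {f. Poly_Mapping.keys f \<subseteq> paths Q},
      monoid.mult = path_mult Q,
      one = (\<Sum>v\<in>verts Q. Poly_Mapping.single (stat v) 1),
      zero = 0,
      add = (+),
      smult = (\<lambda>c. Poly_Mapping.map ((*) c)) \<rparr>"

definition path_elt :: "('v, 'e) qpath \<Rightarrow> (('v, 'e) qpath \<Rightarrow>\<^sub>0 'k::field)" where
  "path_elt p = Poly_Mapping.single p 1"

text \<open>
  The ring quotient, with the scalar multiplication induced on cosets; the latter is written
  like the library's product of cosets.
\<close>

definition quotient_algebra ::
    "('v, 'e) pre_digraph \<Rightarrow> (('v, 'e) qpath \<Rightarrow>\<^sub>0 'k::field) set
      \<Rightarrow> ('k, (('v, 'e) qpath \<Rightarrow>\<^sub>0 'k) set) module" where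
  "quotient_algebra Q I =
    ring.extend (path_algebra Q Quot I)
      (module.fields (\<lambda>c X. \<Union>x\<in>X. I +>\<^bsub>path_algebra Q\<^esub> (c \<odot>\<^bsub>path_algebra Q\<^esub> x)))"

definition path_class ::
    "('v, 'e) pre_digraph \<Rightarrow> (('v, 'e) qpath \<Rightarrow>\<^sub>0 'k::field) set \<Rightarrow> ('v, 'e) qpath
      \<Rightarrow> (('v, 'e) qpath \<Rightarrow>\<^sub>0 'k) set" where
  "path_class Q I p = I +>\<^bsub>path_algebra Q\<^esub> path_elt p"


section \<open>String algebras\<close>

definition arrow_ideal ::
    "('v, 'e) pre_digraph \<Rightarrow> (('v, 'e) qpath \<Rightarrow>\<^sub>0 'k::field) set" where
  "arrow_ideal Q = Idl\<^bsub>path_algebra Q\<^esub> ((\<lambda>a. path_elt (arrow Q a)) ` arcs Q)"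

definition admissible ::
    "('v, 'e) pre_digraph \<Rightarrow> (('v, 'e) qpath \<Rightarrow>\<^sub>0 'k::field) set \<Rightarrow> bool" where
  "admissible Q I \<longleftrightarrow>
    ideal I (path_algebra Q) \<and>
    (\<exists>m::nat\<ge>2. arrow_ideal Q [^]\<^bsub>ideals_set (path_algebra Q)\<^esub> m \<subseteq> I) \<and>
    I \<subseteq> arrow_ideal Q [^]\<^bsub>ideals_set (path_algebra Q)\<^esub> (2::nat)"

locale string_algebra = quiver Q
  for Q :: "('v, 'e) pre_digraph" (structure)
    and I :: "(('v, 'e) qpath \<Rightarrow>\<^sub>0 'k::field) set" +
  assumes degrees: "v \<in> verts Q \<Longrightarrow> in_degree Q v \<le> 2 \<and> out_degree Q v \<le> 2"
    and unique_pred: "\<lbrakk> a \<in> arcs Q; b \<in> arcs Q; b' \<in> arcs Q; b \<noteq> b';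
          tail Q a = head Q b; tail Q a = head Q b' \<rbrakk>
        \<Longrightarrow> path_elt (pconcat (arrow Q b) (arrow Q a)) \<in> I \<or>
            path_elt (pconcat (arrow Q b') (arrow Q a)) \<in> I"
    and unique_succ: "\<lbrakk> a \<in> arcs Q; b \<in> arcs Q; b' \<in> arcs Q; b \<noteq> b';
          head Q a = tail Q b; head Q a = tail Q b' \<rbrakk>
        \<Longrightarrow> path_elt (pconcat (arrow Q a) (arrow Q b)) \<in> I \<or>
            path_elt (pconcat (arrow Q a) (arrow Q b')) \<in> I"
    and generated_by_paths: "\<exists>S \<subseteq> paths Q. I = Idl\<^bsub>path_algebra Q\<^esub> (path_elt ` S)"
    and admissible: "admissible Q I"


section \<open>The path basis and the grading\<close>

inductive_set lin_span :: "('k, 'a) module \<Rightarrow> 'a set \<Rightarrow> 'a set"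
  for A :: "('k, 'a) module" and X :: "'a set" where
  zero: "\<zero>\<^bsub>A\<^esub> \<in> lin_span A X"
| add_smult: "\<lbrakk> z \<in> lin_span A X; x \<in> X \<rbrakk> \<Longrightarrow> z \<oplus>\<^bsub>A\<^esub> c \<odot>\<^bsub>A\<^esub> x \<in> lin_span A X"

context
  fixes Q :: "('v, 'e) pre_digraph" and I :: "(('v, 'e) qpath \<Rightarrow>\<^sub>0 'k::field) set"
begin

definition basis_paths :: "('v, 'e) qpath set" where
  "basis_paths = {p \<in> paths Q. path_elt p \<notin> I}"

definition span_paths :: "('v, 'e) qpath set \<Rightarrow> (('v, 'e) qpath \<Rightarrow>\<^sub>0 'k) set set" where
  "span_paths P = lin_span (quotient_algebra Q I) (path_class Q I ` P)"

definition degree_part :: "nat \<Rightarrow> (('v, 'e) qpath \<Rightarrow>\<^sub>0 'k) set set" where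
  "degree_part n = span_paths {p \<in> basis_paths. plength p = n}"

definition degree_above :: "nat \<Rightarrow> (('v, 'e) qpath \<Rightarrow>\<^sub>0 'k) set set" where
  "degree_above n = span_paths {p \<in> basis_paths. plength p > n}"

text \<open>The projection onto the \<open>n\<close>-th summand of the direct sum decomposition by degree.\<close>

definition degree_component ::
    "nat \<Rightarrow> (('v, 'e) qpath \<Rightarrow>\<^sub>0 'k) set \<Rightarrow> (('v, 'e) qpath \<Rightarrow>\<^sub>0 'k) set" where
  "degree_component n z =
    (THE x. x \<in> degree_part n \<and>
       (\<exists>y \<in> span_paths {p \<in> basis_paths. plength p \<noteq> n}. z = x \<oplus>\<^bsub>quotient_algebra Q I\<^esub> y))"

definition left_maximal :: "('v, 'e) qpath \<Rightarrow> bool" where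
  "left_maximal p \<longleftrightarrow> (\<forall>a\<in>arcs Q.
     path_class Q I (arrow Q a) \<otimes>\<^bsub>quotient_algebra Q I\<^esub> path_class Q I p
       = \<zero>\<^bsub>quotient_algebra Q I\<^esub>)"

definition right_maximal :: "('v, 'e) qpath \<Rightarrow> bool" where
  "right_maximal p \<longleftrightarrow> (\<forall>a\<in>arcs Q.
     path_class Q I p \<otimes>\<^bsub>quotient_algebra Q I\<^esub> path_class Q I (arrow Q a)
       = \<zero>\<^bsub>quotient_algebra Q I\<^esub>)"

end


section \<open>Automorphisms\<close>

definition algebra_aut :: "('k, 'a) module \<Rightarrow> ('a \<Rightarrow> 'a) set" where
  "algebra_aut A =
    {f \<in> ring_iso A A. \<forall>c. \<forall>x\<in>carrier A. f (c \<odot>\<^bsub>A\<^esub> x) = c \<odot>\<^bsub>A\<^esub> f x}"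

definition inner_aut :: "('k, 'a) module \<Rightarrow> 'a \<Rightarrow> 'a \<Rightarrow> 'a" where
  "inner_aut A u z = inv\<^bsub>A\<^esub> u \<otimes>\<^bsub>A\<^esub> z \<otimes>\<^bsub>A\<^esub> u"

context
  fixes Q :: "('v, 'e) pre_digraph" and I :: "(('v, 'e) qpath \<Rightarrow>\<^sub>0 'k::field) set"
begin

definition vertex_fixing_aut ::
    "((('v, 'e) qpath \<Rightarrow>\<^sub>0 'k) set \<Rightarrow> (('v, 'e) qpath \<Rightarrow>\<^sub>0 'k) set) set" where
  "vertex_fixing_aut =
    {f \<in> algebra_aut (quotient_algebra Q I).
       \<forall>v\<in>verts Q. f (path_class Q I (stat v)) = path_class Q I (stat v)}"

definition graded_unipotent_aut ::
    "((('v, 'e) qpath \<Rightarrow>\<^sub>0 'k) set \<Rightarrow> (('v, 'e) qpath \<Rightarrow>\<^sub>0 'k) set) set" where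
  "graded_unipotent_aut =
    {f \<in> algebra_aut (quotient_algebra Q I).
       \<forall>n. \<forall>x\<in>degree_part Q I n. degree_component Q I n (f x) = x}"

definition diagonal_aut ::
    "((('v, 'e) qpath \<Rightarrow>\<^sub>0 'k) set \<Rightarrow> (('v, 'e) qpath \<Rightarrow>\<^sub>0 'k) set) set" where
  "diagonal_aut =
    {f \<in> vertex_fixing_aut \<inter> graded_unipotent_aut.
       \<forall>w\<in>basis_paths Q I.
         f (path_class Q I w) \<in> span_paths Q I
           {w' \<in> basis_paths Q I. first_arrow Q w' = first_arrow Q w \<and>
                                  last_arrow Q w' = last_arrow Q w}}"

end


section \<open>Derivations\<close>

definition derivation :: "('k, 'a) module \<Rightarrow> ('a \<Rightarrow> 'a) \<Rightarrow> bool" where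
  "derivation A d \<longleftrightarrow>
    d \<in> carrier A \<rightarrow> carrier A \<and>
    (\<forall>x\<in>carrier A. \<forall>y\<in>carrier A. d (x \<oplus>\<^bsub>A\<^esub> y) = d x \<oplus>\<^bsub>A\<^esub> d y) \<and>
    (\<forall>c. \<forall>x\<in>carrier A. d (c \<odot>\<^bsub>A\<^esub> x) = c \<odot>\<^bsub>A\<^esub> d x) \<and>
    (\<forall>x\<in>carrier A. \<forall>y\<in>carrier A.
       d (x \<otimes>\<^bsub>A\<^esub> y) = (d x \<otimes>\<^bsub>A\<^esub> y) \<oplus>\<^bsub>A\<^esub> (x \<otimes>\<^bsub>A\<^esub> d y))"

text \<open>
  Defined for locally nilpotent \<open>d\<close>, where only finitely many summands are nonzero and hence
  the finite sum below is the exponential series.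
\<close>

definition exp_derivation :: "('k::field, 'a) module \<Rightarrow> ('a \<Rightarrow> 'a) \<Rightarrow> 'a \<Rightarrow> 'a" where
  "exp_derivation A d x =
    (\<Oplus>\<^bsub>A\<^esub>n\<in>{n. (d ^^ n) x \<noteq> \<zero>\<^bsub>A\<^esub>}. inverse (of_nat (fact n)) \<odot>\<^bsub>A\<^esub> (d ^^ n) x)"

context
  fixes Q :: "('v, 'e) pre_digraph" and I :: "(('v, 'e) qpath \<Rightarrow>\<^sub>0 'k::field) set"
begin

definition delta_pair :: "'e \<Rightarrow> ('v, 'e) qpath \<Rightarrow> bool" where
  "delta_pair a p \<longleftrightarrow>
    a \<in> arcs Q \<and> p \<in> basis_paths Q I \<and>
    parallel Q p (arrow Q a) \<and>
    (left_maximal Q I p \<or> first_arrow Q p = arrow Q a) \<and>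
    (right_maximal Q I p \<or> last_arrow Q p = arrow Q a)"

text \<open>
  Requiring extensionality (a fixed value outside the carrier) is what makes the derivation
  unique as a HOL function.
\<close>

definition delta_path ::
    "'e \<Rightarrow> ('v, 'e) qpath \<Rightarrow> (('v, 'e) qpath \<Rightarrow>\<^sub>0 'k) set \<Rightarrow> (('v, 'e) qpath \<Rightarrow>\<^sub>0 'k) set" where
  "delta_path a p =
    (THE d. d \<in> extensional (carrier (quotient_algebra Q I)) \<and>
       derivation (quotient_algebra Q I) d \<and>
       d (path_class Q I (arrow Q a)) = path_class Q I p \<and>
       (\<forall>b\<in>arcs Q - {a}. d (path_class Q I (arrow Q b)) = \<zero>\<^bsub>quotient_algebra Q I\<^esub>) \<and>
       (\<forall>v\<in>verts Q. d (path_class Q I (stat v)) = \<zero>\<^bsub>quotient_algebra Q I\<^esub>))"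

text \<open>
  The linear extension of \<^const>\<open>delta_path\<close> in the second argument. A linear combination of
  basis paths is given by its finitely supported family of coefficients.
\<close>

definition delta ::
    "'e \<Rightarrow> (('v, 'e) qpath \<Rightarrow>\<^sub>0 'k) \<Rightarrow> (('v, 'e) qpath \<Rightarrow>\<^sub>0 'k) set
      \<Rightarrow> (('v, 'e) qpath \<Rightarrow>\<^sub>0 'k) set" where
  "delta a y x =
    (\<Oplus>\<^bsub>quotient_algebra Q I\<^esub>p\<in>Poly_Mapping.keys y.
       Poly_Mapping.lookup y p \<odot>\<^bsub>quotient_algebra Q I\<^esub> delta_path a p x)"

definition type_II :: "((('v, 'e) qpath \<Rightarrow>\<^sub>0 'k) set \<Rightarrow> (('v, 'e) qpath \<Rightarrow>\<^sub>0 'k) set) \<Rightarrow> bool" where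
  "type_II d \<longleftrightarrow>
    derivation (quotient_algebra Q I) d \<and>
    (\<exists>y :: 'e \<Rightarrow> (('v, 'e) qpath \<Rightarrow>\<^sub>0 'k).
       (\<forall>a\<in>arcs Q. \<forall>p\<in>Poly_Mapping.keys (y a).
          delta_pair a p \<and> left_maximal Q I p \<and> plength p > 1) \<and>
       (\<forall>x\<in>carrier (quotient_algebra Q I).
          d x = (\<Oplus>\<^bsub>quotient_algebra Q I\<^esub>a\<in>arcs Q. delta a (y a) x)))"

end

end

theory Submission
  imports Defs "HOL-Library.Function_Algebras"
begin

text \<open>
  Let \<open>T\<close> be an automorphism of \<open>A\<close> that fixes the vertices and sends every basis path
  \<open>w\<close> to \<open>w\<close> plus longer paths. It is determined by the images of the arrows, so
  everything depends on which paths \<open>p\<close> occur in \<open>T(a)\<close>. The restrictions come from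
  the relations of length two: if \<open>ca = 0\<close> then \<open>T(c)T(a) = 0\<close>, and the coefficient of
  each path in this product vanishes. In a string algebra there are many such relations, because an arrow can be
  continued by at most one arrow on either side: if \<open>c\<close> can be continued by an arrow other than
  \<open>a\<close>, then \<open>ca = 0\<close>.

  An inner automorphism given by \<open>1 + q\<close>, with \<open>q\<close> a cycle, changes the coefficients
  of \<open>aq\<close> in the image of \<open>a\<close> and of \<open>qb\<close> in the image of
  \<open>b\<close>, where \<open>a\<close> and \<open>b\<close> are the only arrows by which \<open>q\<close>
  can be continued. Thus each cycle is a parameter that can be used to remove one coefficient. Call
  \<open>aq\<close> bad for \<open>a\<close> if \<open>q\<close> does not end in \<open>a\<close> and
  \<open>aq\<close> is not both left and right maximal. By induction on the length, conjugation by a unit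
  \<open>1 + y\<close> removes all bad coefficients (\<open>eliminate\<close>). The companion coefficient of
  \<open>qb\<close> then vanishes as well if \<open>aqb\<close> is nonzero, and comparing coefficients shows
  that every longer path in \<open>T(a)\<close> starts and ends in \<open>a\<close>, or is left maximal and
  moreover right maximal or ending in \<open>a\<close> (\<open>support_shape\<close>).

  For the automorphism \<open>T\<close> so normalized, let \<open>\<rho>(w)\<close> be the part of
  \<open>T(w)\<close> supported on paths with the same first and last arrow as \<open>w\<close>. The remainder
  \<open>T(w) - \<rho>(w)\<close> consists of left maximal paths, which every element of
  \<open>A\<^sub>+\<close> annihilates from the left, so that \<open>T(u)T(w)\<close> is
  \<open>\<rho>(u)\<rho>(w)\<close> plus terms with wrong ends; hence \<open>\<rho>\<close> is multiplicative
  (\<open>product_splits\<close>) and lies in \<open>D(A)\<close>. Finally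
  \<open>\<delta> = T\<rho>\<^sup>-\<^sup>1 - 1\<close> takes values in the span of the left maximal paths of
  length at least two. Products of two such values vanish, so that \<open>\<delta>\<close> is a derivation; it
  also satisfies \<open>\<delta>\<^sup>2 = 0\<close>, and therefore
  \<open>exp(\<delta>) = 1 + \<delta> = T\<rho>\<^sup>-\<^sup>1\<close> in every characteristic
  (\<open>exponential_factor\<close>).

  The computations take place in coordinates: an element of \<open>A\<close> is the function of its coefficients
  on the finite basis of paths outside \<open>I\<close>, and the product is a convolution over the ways to cut a
  path in two. The coordinates exist because an ideal generated by paths is spanned by the paths that it
  contains (\<open>I_iff\<close>).
\<close>

section \<open>Coefficients of words\<close>

text \<open>
  The combinatorial core, separated from the algebra. \<open>W es\<close> stands for: the word \<open>es\<close> is a path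
  outside the ideal; and \<open>G a es\<close> for its coefficient in the image \<open>T(a)\<close>. The assumption
  \<open>zero_relation\<close> is the coefficient of \<open>es\<close> in \<open>T(c)T(a) = T(ca) = 0\<close>, and \<open>no_bad\<close> is the
  normalization that inner automorphisms achieve.
\<close>

locale word_coefficients =
  fixes W :: "'e list \<Rightarrow> bool" and G :: "'e \<Rightarrow> 'e list \<Rightarrow> 'k::field"
  assumes factor: "W (xs @ ys @ zs) \<Longrightarrow> ys \<noteq> [] \<Longrightarrow> W ys"
    and succ: "W [c, b] \<Longrightarrow> W [c, b'] \<Longrightarrow> b = b'"
    and pred: "W [b, c] \<Longrightarrow> W [b', c] \<Longrightarrow> b = b'"
    and G_Nil: "G a [] = 0"
    and G_single: "W [a] \<Longrightarrow> G a [b] = (if b = a then 1 else 0)"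
    and G_supp: "G a es \<noteq> 0 \<Longrightarrow> W es \<and> W [a]"
    and zero_relation: "W [c] \<Longrightarrow> W [a] \<Longrightarrow> \<not> W [c, a] \<Longrightarrow> W es \<Longrightarrow>
          (\<Sum>i\<le>length es. G c (take i es) * G a (drop i es)) = 0"
    and no_bad: "q \<noteq> [] \<Longrightarrow> last q \<noteq> a \<Longrightarrow> (\<exists>c. W (a # q @ [c])) \<or> (\<exists>c. W (c # a # q)) \<Longrightarrow>
          G a (a # q) = 0"
begin

lemma factor_hd: "W (xs @ ys) \<Longrightarrow> xs \<noteq> [] \<Longrightarrow> W xs"
  using factor[of "[]" xs ys] by simp

lemma factor_tl: "W (xs @ ys) \<Longrightarrow> ys \<noteq> [] \<Longrightarrow> W ys"
  using factor[of xs ys "[]"] by simp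

lemma factor_junction: "W (xs @ ys) \<Longrightarrow> xs \<noteq> [] \<Longrightarrow> ys \<noteq> [] \<Longrightarrow> W [last xs, hd ys]"
  using factor[of "butlast xs" "[last xs, hd ys]" "tl ys"]
  by (metis append_Cons append_Nil append_assoc append_butlast_last_id list.collapse list.discI)

lemma factor_Cons_hd: "W (c # ys) \<Longrightarrow> ys \<noteq> [] \<Longrightarrow> W [c, hd ys]"
  using factor_junction[of "[c]" ys] by simp

lemma coefficient_eq_zero:
  assumes "W [c]" "W [a]" "\<not> W [c, a]" "W es" "k \<le> length es"
    and "\<And>i. i \<le> length es \<Longrightarrow> i \<noteq> k \<Longrightarrow> G c (take i es) * G a (drop i es) = 0"
  shows "G c (take k es) * G a (drop k es) = 0"
proof -
  have "(\<Sum>i\<le>length es. G c (take i es) * G a (drop i es)) = G c (take k es) * G a (drop k es)"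
    using assms(5,6) by (subst sum.remove[of _ k]) (force intro!: sum.neutral)+
  thus ?thesis using zero_relation[OF assms(1-4)] by simp
qed

text \<open>
  If \<open>aqb\<close> is nonzero and \<open>q\<close> does not start with \<open>b\<close>, then \<open>ab = 0\<close>, and the coefficient of \<open>aqb\<close> in
  \<open>T(a)T(b)\<close> relates the coefficients of \<open>aq\<close> and \<open>qb\<close>. The former is zero by normalization,
  and all other ways to cut \<open>aqb\<close> involve a bad path or, by induction, a shorter instance.
\<close>

lemma ends_left_maximal:
  "q \<noteq> [] \<Longrightarrow> hd q \<noteq> b \<Longrightarrow> W [b] \<Longrightarrow> W (a # q @ [b]) \<Longrightarrow> G b (q @ [b]) = 0"
proof (induction "length q" arbitrary: q rule: less_induct)
  case less
  let ?es = "a # q @ [b]"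
  have aq: "W [a, hd q]"
    using factor_Cons_hd[OF less.prems(4)] less.prems(1) by simp
  have nab: "\<not> W [a, b]"
    using succ[OF aq] less.prems(2) by blast
  have Wa: "W [a]"
    using factor_hd[of "[a]"] less.prems(4) by simp
  \<comment> \<open>The cut after the first letter gives \<open>G b (q @ [b])\<close>; every other cut contributes zero.\<close>
  have "G a (take 1 ?es) * G b (drop 1 ?es) = 0"
  proof (rule coefficient_eq_zero[OF Wa less.prems(3) nab less.prems(4)])
    fix i assume i: "i \<le> length ?es" "i \<noteq> 1"
    consider "i = 0" | "i = length ?es" | j where "i = Suc j" "0 < j" "j < length q" | "i = Suc (length q)"
      using i by (cases i) (auto simp: less_Suc_eq_le le_less)
    thus "G a (take i ?es) * G b (drop i ?es) = 0"
    proof cases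
      case 4
      have "last q \<noteq> a"
        using factor_junction[of "a # q" "[b]"] less.prems nab by auto
      hence "G a (a # q) = 0"
        using no_bad[of q a] less.prems by auto
      thus ?thesis using 4 by simp
    next
      case 3
      define q1 q2 where "q1 = take j q" and "q2 = drop j q"
      have q: "q = q1 @ q2" "q1 \<noteq> []" "q2 \<noteq> []"
        using 3 less.prems(1) by (auto simp: q1_def q2_def)
      have ti: "take i ?es = a # q1" "drop i ?es = q2 @ [b]"
        using 3 by (simp_all add: q1_def q2_def)
      show ?thesis
      proof (cases "last q1 = a")
        case True
        have "W ([a] @ q2 @ [b])"
          using factor[of "a # butlast q1" "[a] @ q2 @ [b]" "[]"] less.prems(4) q True
          by (metis append_Cons append_Nil2 append_assoc append_butlast_last_id list.discI append_is_Nil_conv)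
        moreover from this have "hd q2 \<noteq> b"
          using factor_Cons_hd[of a "q2 @ [b]"] q nab by auto
        ultimately have "G b (q2 @ [b]) = 0"
          using less.hyps[of q2] q less.prems(3) by simp
        thus ?thesis using ti by simp
      next
        case False
        have "W (a # q1 @ [hd q2])"
          using factor_hd[of "a # q1 @ [hd q2]" "tl q2 @ [b]"] less.prems(4) q
          by (cases q2) auto
        hence "G a (a # q1) = 0"
          using no_bad[of q1 a] q False by blast
        thus ?thesis using ti by simp
      qed
    qed (simp_all add: G_Nil)
  qed simp
  thus ?case using G_single[OF Wa] by simp
qed

text \<open>
  A path \<open>es\<close> that neither starts nor ends in \<open>a\<close> but can be continued to \<open>c es\<close> forces
  \<open>ca = 0\<close>; the coefficient of \<open>c es\<close> in \<open>T(c)T(a)\<close> reduces to that of \<open>es\<close> in \<open>T(a)\<close>.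
\<close>

lemma foreign_left_maximal:
  "es \<noteq> [] \<Longrightarrow> hd es \<noteq> a \<Longrightarrow> last es \<noteq> a \<Longrightarrow> W [a] \<Longrightarrow> W (c # es) \<Longrightarrow> G a es = 0"
proof (induction "length es" arbitrary: es rule: less_induct)
  case less
  let ?es = "c # es"
  have nca: "\<not> W [c, a]"
    using succ factor_Cons_hd[OF less.prems(5,1)] less.prems(2) by blast
  have Wc: "W [c]"
    using factor_hd[of "[c]"] less.prems(5) by simp
  have "G c (take 1 ?es) * G a (drop 1 ?es) = 0"
  proof (rule coefficient_eq_zero[OF Wc less.prems(4) nca less.prems(5)])
    fix i assume i: "i \<le> length ?es" "i \<noteq> 1"
    consider "i = 0" | "i = length ?es" | j where "i = Suc j" "0 < j" "j < length es"
      using i by (cases i) (auto simp: less_Suc_eq_le le_less)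
    thus "G c (take i ?es) * G a (drop i ?es) = 0"
    proof cases
      case 3
      define r s where "r = take j es" and "s = drop j es"
      have rs: "es = r @ s" "r \<noteq> []" "s \<noteq> []"
        using 3 by (auto simp: r_def s_def)
      have ti: "take i ?es = c # r" "drop i ?es = s"
        using 3 by (simp_all add: r_def s_def)
      show ?thesis
      proof (cases "last r = c")
        case True
        have "W (c # s)"
          using factor[of "c # butlast r" "c # s" "[]"] less.prems(5) rs True
          by (metis append_Cons append_Nil append_Nil2 append_assoc append_butlast_last_id list.discI)
        moreover from this have "hd s \<noteq> a"
          using factor_Cons_hd[of c s] rs nca by auto
        ultimately have "G a s = 0"
          using less.hyps[of s] rs less.prems by simp
        thus ?thesis using ti by simp
      next
        case False
        have "W (c # r @ [hd s])"
          using factor_hd[of "c # r @ [hd s]" "tl s"] less.prems(5) rs by (cases s) auto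
        hence "G c (c # r) = 0"
          using no_bad[of r c] rs False by blast
        thus ?thesis using ti by simp
      qed
    qed (simp_all add: G_Nil)
  qed simp
  thus ?case using G_single[OF Wc] by simp
qed

text \<open>
  The mirror image; as the normalization is not symmetric, the factors on the right are
  now handled by the lemma on paths \<open>q b\<close> instead of by the normalization.
\<close>

lemma foreign_right_maximal:
  "es \<noteq> [] \<Longrightarrow> hd es \<noteq> a \<Longrightarrow> last es \<noteq> a \<Longrightarrow> W [a] \<Longrightarrow> W (es @ [c]) \<Longrightarrow> G a es = 0"
proof (induction "length es" arbitrary: es rule: less_induct)
  case less
  let ?es = "es @ [c]" and ?n = "length es"
  have nac: "\<not> W [a, c]"
    using pred factor_junction[OF less.prems(5,1)] less.prems(3) by auto
  have Wc: "W [c]"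
    using factor_tl[of es "[c]"] less.prems(5) by simp
  have "G a (take ?n ?es) * G c (drop ?n ?es) = 0"
  proof (rule coefficient_eq_zero[OF less.prems(4) Wc nac less.prems(5)])
    fix i assume i: "i \<le> length ?es" "i \<noteq> ?n"
    consider "i = 0" | "i = length ?es" | "0 < i" "i < ?n"
      using i by force
    thus "G a (take i ?es) * G c (drop i ?es) = 0"
    proof cases
      case 3
      define r s where "r = take i es" and "s = drop i es"
      have rs: "es = r @ s" "r \<noteq> []" "s \<noteq> []"
        using 3 by (auto simp: r_def s_def)
      have ti: "take i ?es = r" "drop i ?es = s @ [c]"
        using 3 by (simp_all add: r_def s_def)
      show ?thesis
      proof (cases "hd s = c")
        case True
        have "W (r @ [c])"
          using factor_hd[of "r @ [c]" "tl s @ [c]"] less.prems(5) rs True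
          by (metis append_Cons append_Nil append_assoc list.collapse append_is_Nil_conv list.discI)
        moreover from this have "last r \<noteq> a"
          using factor_junction[of r "[c]"] rs nac by auto
        ultimately have "G a r = 0"
          using less.hyps[of r] rs less.prems by simp
        thus ?thesis using ti by simp
      next
        case False
        have "W (last r # s @ [c])"
          using factor[of "butlast r" "last r # s @ [c]" "[]"] less.prems(5) rs
          by (metis append.assoc append_Cons append_Nil append_Nil2 append_butlast_last_id list.discI)
        hence "G c (s @ [c]) = 0"
          using ends_left_maximal[of s c "last r"] rs False Wc by blast
        thus ?thesis using ti by simp
      qed
    qed (simp_all add: G_Nil)
  qed simp
  thus ?case using G_single[OF Wc] by simp
qed

theorem support_shape:
  assumes "G a es \<noteq> 0" "2 \<le> length es"
  shows "hd es = a \<and> last es = a \<or>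
    (\<forall>c. \<not> W (c # es)) \<and> (last es = a \<or> (\<forall>c. \<not> W (es @ [c])))"
proof -
  have ne: "es \<noteq> []" and Wa: "W [a]"
    using assms G_supp by auto
  consider "hd es = a" "last es = a" | "hd es = a" "last es \<noteq> a" | "hd es \<noteq> a" "last es = a"
    | "hd es \<noteq> a" "last es \<noteq> a" by blast
  thus ?thesis
  proof cases
    case 2
    define q where "q = tl es"
    have q: "es = a # q" "q \<noteq> []"
      using 2 ne assms(2) by (cases es; auto simp: q_def)+
    show ?thesis
      using no_bad[of q a] assms(1) 2 q by auto
  next
    case 3
    define q where "q = butlast es"
    have q: "es = q @ [a]"
      using 3 ne by (auto simp: q_def)
    have "q \<noteq> []"
      using q assms(2) by auto
    moreover from this have "hd q \<noteq> a"
      using 3 q by simp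
    ultimately have "\<not> W (c # es)" for c
      using ends_left_maximal[of q a c] q Wa assms(1) by auto
    thus ?thesis using 3 by blast
  next
    case 4
    thus ?thesis
      using foreign_left_maximal[OF ne _ _ Wa] foreign_right_maximal[OF ne _ _ Wa] assms(1) by blast
  qed blast
qed

end

section \<open>Splitting paths\<close>

definition path_take :: "nat \<Rightarrow> ('v, 'e) qpath \<Rightarrow> ('v, 'e) qpath" where
  "path_take i p = (fst p, take i (snd p))"

text \<open>
  The source of the remaining path is recomputed as the end of the removed part: the list of
  arrows alone does not determine it when nothing remains.
\<close>

definition path_drop :: "('v, 'e) pre_digraph \<Rightarrow> nat \<Rightarrow> ('v, 'e) qpath \<Rightarrow> ('v, 'e) qpath" where
  "path_drop Q i p = (ptarget Q (path_take i p), drop i (snd p))"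

lemma fst_path_take [simp]: "fst (path_take i p) = fst p"
  and snd_path_take [simp]: "snd (path_take i p) = take i (snd p)"
  and snd_path_drop [simp]: "snd (path_drop Q i p) = drop i (snd p)"
  by (simp_all add: path_take_def path_drop_def)

lemma stat_simps [simp]: "fst (stat v) = v" "snd (stat v) = []" "psource (stat v) = v"
    "ptarget Q (stat v) = v" "plength (stat v) = 0"
  by (simp_all add: stat_def psource_def ptarget_def plength_def pre_digraph.awalk_verts.simps)

lemma stat_inject [simp]: "stat u = stat v \<longleftrightarrow> u = v"
  by (simp add: stat_def)

lemma arrow_simps [simp]: "fst (arrow Q a) = tail Q a" "snd (arrow Q a) = [a]"
    "psource (arrow Q a) = tail Q a" "ptarget Q (arrow Q a) = head Q a" "plength (arrow Q a) = 1"
  by (simp_all add: arrow_def psource_def ptarget_def plength_def pre_digraph.awalk_verts.simps)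

lemma pconcat_simps [simp]: "fst (pconcat p q) = fst p" "snd (pconcat p q) = snd p @ snd q"
    "psource (pconcat p q) = psource p" "plength (pconcat p q) = plength p + plength q"
  by (simp_all add: pconcat_def psource_def plength_def)

lemma ptarget_conv: "ptarget Q p = (if snd p = [] then fst p else head Q (last (snd p)))"
  by (simp add: ptarget_def pre_digraph.awalk_verts_conv)

lemma ptarget_pconcat: "ptarget Q p = psource q \<Longrightarrow> ptarget Q (pconcat p q) = ptarget Q q"
  by (auto simp: ptarget_conv psource_def)

lemma plength_path_take: "i \<le> plength p \<Longrightarrow> plength (path_take i p) = i"
  and plength_path_drop: "plength (path_drop Q i p) = plength p - i"
  by (simp_all add: plength_def)

lemma pconcat_take_drop: "pconcat (path_take i p) (path_drop Q i p) = p"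
  by (simp add: pconcat_def prod_eq_iff)

lemma psource_take [simp]: "psource (path_take i p) = psource p"
  and ptarget_take: "ptarget Q (path_take i p) = psource (path_drop Q i p)"
  by (simp_all add: psource_def path_drop_def)

lemma ptarget_drop [simp]: "ptarget Q (path_drop Q i p) = ptarget Q p"
  using ptarget_pconcat[OF ptarget_take] pconcat_take_drop by metis

lemma take_pconcat: "path_take (plength p) (pconcat p q) = p"
  by (simp add: prod_eq_iff plength_def)

lemma drop_pconcat: "ptarget Q p = psource q \<Longrightarrow> path_drop Q (plength p) (pconcat p q) = q"
  by (simp add: prod_eq_iff path_drop_def take_pconcat psource_def) (simp add: plength_def)

lemma path_take_take: "i \<le> j \<Longrightarrow> path_take i (path_take j p) = path_take i p"
  by (simp add: path_take_def min_def)

lemma path_drop_take: "path_drop Q i (path_take (i + j) p) = path_take j (path_drop Q i p)"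
  by (simp add: path_take_def path_drop_def take_drop add.commute min_def)

lemma path_drop_drop: "path_drop Q j (path_drop Q i p) = path_drop Q (i + j) p"
proof -
  have "ptarget Q (path_take j (path_drop Q i p)) = ptarget Q (path_take (i + j) p)"
    by (metis path_drop_take ptarget_drop)
  thus ?thesis by (simp add: path_drop_def[of Q j] path_drop_def[of Q "i + j"] add.commute)
qed

lemma path_take_0 [simp]: "path_take 0 p = stat (psource p)"
  and path_drop_0 [simp]: "path_drop Q 0 p = p"
  by (simp_all add: path_take_def path_drop_def stat_def psource_def ptarget_conv)

lemma path_take_all: "plength p \<le> i \<Longrightarrow> path_take i p = p"
  by (simp add: path_take_def plength_def)

lemma drop_plength: "path_drop Q (plength p) p = stat (ptarget Q p)"
  by (simp add: path_drop_def path_take_all) (simp add: plength_def stat_def)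

lemma pconcat_stat_left: "psource p = v \<Longrightarrow> pconcat (stat v) p = p"
  and pconcat_stat_right: "pconcat p (stat v) = p"
  by (simp_all add: prod_eq_iff psource_def)

lemma pconcat_length_0: "plength v = 0 \<Longrightarrow> pconcat u v = u"
  by (simp add: pconcat_def plength_def)

lemma pconcat_assoc: "pconcat (pconcat u v) w = pconcat u (pconcat v w)"
  by (simp add: pconcat_def)

lemma plength_0_iff: "plength p = 0 \<longleftrightarrow> p = stat (psource p)"
  by (cases p) (auto simp: plength_def stat_def psource_def)

context wf_digraph
begin

lemma paths_iff: "p \<in> paths G \<longleftrightarrow> awalk (fst p) (snd p) (ptarget G p)"
  by (auto simp: paths_def ptarget_def split: prod.splits)

lemma stat_paths: "v \<in> verts G \<Longrightarrow> stat v \<in> paths G"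
  by (simp add: paths_iff awalk_Nil_iff)

lemma arrow_paths: "a \<in> arcs G \<Longrightarrow> arrow G a \<in> paths G"
  by (simp add: paths_iff awalk_def)

lemma paths_verts: "p \<in> paths G \<Longrightarrow> psource p \<in> verts G" "p \<in> paths G \<Longrightarrow> ptarget G p \<in> verts G"
  by (auto simp: paths_iff psource_def)

lemma paths_arcs: "p \<in> paths G \<Longrightarrow> set (snd p) \<subseteq> arcs G"
  by (auto simp: paths_iff)

lemma paths_source: "p \<in> paths G \<Longrightarrow> snd p \<noteq> [] \<Longrightarrow> fst p = tail G (hd (snd p))"
  by (cases "snd p") (auto simp: paths_iff awalk_def)

lemma pconcat_paths_iff:
  "pconcat p q \<in> paths G \<and> ptarget G p = psource q \<longleftrightarrow>
    p \<in> paths G \<and> q \<in> paths G \<and> ptarget G p = psource q"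
proof (cases "ptarget G p = psource q")
  case True
  thus ?thesis
    by (auto simp: paths_iff ptarget_pconcat awalk_append_iff psource_def simp flip: ptarget_def)
qed simp

lemma path_take_paths: "p \<in> paths G \<Longrightarrow> path_take i p \<in> paths G"
  and path_drop_paths: "p \<in> paths G \<Longrightarrow> path_drop G i p \<in> paths G"
  using pconcat_paths_iff[of "path_take i p" "path_drop G i p"]
  by (simp_all add: pconcat_take_drop ptarget_take)

lemma paths_Cons: "p \<in> paths G \<Longrightarrow> snd p = a # es \<Longrightarrow>
    a \<in> arcs G \<and> p = pconcat (arrow G a) (head G a, es) \<and> (head G a, es) \<in> paths G"
  by (auto simp: paths_iff awalk_def prod_eq_iff ptarget_conv)

end

section \<open>The model\<close>

text \<open>
  The product of \<open>A\<close> in coordinates, where \<open>B\<close> is the set of paths outside the ideal. Setting the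
  value to zero outside \<open>B\<close> is reduction modulo the ideal.
\<close>

definition conv_on_basis ::
    "('v, 'e) pre_digraph \<Rightarrow> ('v, 'e) qpath set \<Rightarrow> (('v, 'e) qpath \<Rightarrow> 'k::field) \<Rightarrow>
      (('v, 'e) qpath \<Rightarrow> 'k) \<Rightarrow> ('v, 'e) qpath \<Rightarrow> 'k" where
  "conv_on_basis Q B f g p =
    (if p \<in> B then \<Sum>i\<le>plength p. f (path_take i p) * g (path_drop Q i p) else 0)"

definition scal :: "'k::field \<Rightarrow> ('a \<Rightarrow> 'k) \<Rightarrow> 'a \<Rightarrow> 'k" where
  "scal c f = (\<lambda>x. c * f x)"

definition ind :: "'a \<Rightarrow> 'a \<Rightarrow> 'k::field" where
  "ind w = (\<lambda>x. if x = w then 1 else 0)"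

lemma scal_apply [simp]: "scal c f x = c * f x"
  by (simp add: scal_def)

lemma ind_apply: "ind w x = (if x = w then 1 else 0)"
  by (simp add: ind_def)

lemma ind_self [simp]: "ind w w = 1"
  by (simp add: ind_def)

lemma scal_simps [simp]: "scal 0 f = 0" "scal c 0 = 0" "scal 1 f = f"
  "scal c (scal d f) = scal (c * d) f"
  by (simp_all add: fun_eq_iff)

lemma scal_add: "scal c (f + g) = scal c f + scal c g"
  and scal_diff: "scal c (f - g) = scal c f - scal c g"
  by (simp_all add: fun_eq_iff algebra_simps)

lemma fun_sum_apply: "(\<Sum>i\<in>S. F i) x = (\<Sum>i\<in>S. (F i x :: 'k::field))"
  by (induction S rule: infinite_finite_induct) auto

text \<open>
  Since \<open>B\<close> contains the pieces of its members, its complement is closed under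
  concatenation with arbitrary paths, as for a monomial ideal; this makes the truncated convolution associative.
\<close>

locale path_basis = fin_digraph Q for Q :: "('v, 'e) pre_digraph" (structure) +
  fixes B :: "('v, 'e) qpath set"
  assumes B_paths: "p \<in> B \<Longrightarrow> p \<in> paths Q"
    and B_finite: "finite B"
    and B_take: "p \<in> B \<Longrightarrow> path_take i p \<in> B"
    and B_drop: "p \<in> B \<Longrightarrow> path_drop Q i p \<in> B"
    and B_stat: "v \<in> verts Q \<Longrightarrow> stat v \<in> B"
    and B_arrow: "a \<in> arcs Q \<Longrightarrow> arrow Q a \<in> B"
begin

abbreviation conv (infixl "\<star>" 70) where "f \<star> g \<equiv> conv_on_basis Q B f g"

definition spanned :: "(('v, 'e) qpath \<Rightarrow> bool) \<Rightarrow> (('v, 'e) qpath \<Rightarrow> 'k::field) set" where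
  "spanned P = {f. \<forall>p. f p \<noteq> 0 \<longrightarrow> p \<in> B \<and> P p}"

abbreviation V :: "(('v, 'e) qpath \<Rightarrow> 'k::field) set" where
  "V \<equiv> spanned (\<lambda>_. True)"

definition unit :: "('v, 'e) qpath \<Rightarrow> 'k::field" where
  "unit p = (if p \<in> B \<and> plength p = 0 then 1 else 0)"

lemma spannedI: "(\<And>p. f p \<noteq> 0 \<Longrightarrow> p \<in> B \<and> P p) \<Longrightarrow> f \<in> spanned P"
  by (simp add: spanned_def)

lemma spannedD: "f \<in> spanned P \<Longrightarrow> f p \<noteq> 0 \<Longrightarrow> p \<in> B \<and> P p"
  unfolding spanned_def by blast

lemma spanned_zero_at: "f \<in> spanned P \<Longrightarrow> \<not> P p \<Longrightarrow> f p = 0"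
  using spannedD by blast

lemma spanned_outside: "f \<in> spanned P \<Longrightarrow> p \<notin> B \<Longrightarrow> f p = 0"
  unfolding spanned_def by blast

lemma spanned_mono: "f \<in> spanned P \<Longrightarrow> (\<And>p. p \<in> B \<Longrightarrow> P p \<Longrightarrow> R p) \<Longrightarrow> f \<in> spanned R"
  by (auto simp: spanned_def)

lemma spanned_V: "f \<in> spanned P \<Longrightarrow> f \<in> V"
  by (auto simp: spanned_def)

lemma spanned_zero [simp]: "0 \<in> spanned P"
  and spanned_add: "f \<in> spanned P \<Longrightarrow> g \<in> spanned P \<Longrightarrow> f + g \<in> spanned P"
  and spanned_diff: "f \<in> spanned P \<Longrightarrow> g \<in> spanned P \<Longrightarrow> f - g \<in> spanned P"
  and spanned_uminus: "f \<in> spanned P \<Longrightarrow> - f \<in> spanned P"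
  and spanned_scal: "f \<in> spanned P \<Longrightarrow> scal c f \<in> spanned P"
  by (auto simp: spanned_def) (metis add.right_neutral add_cancel_right_left diff_zero)+

lemma spanned_sum: "(\<And>i. i \<in> S \<Longrightarrow> F i \<in> spanned P) \<Longrightarrow> (\<Sum>i\<in>S. F i) \<in> spanned P"
  by (induction S rule: infinite_finite_induct) (auto intro: spanned_add)

lemma spanned_conj: "f \<in> spanned P \<Longrightarrow> f \<in> spanned R \<Longrightarrow> f \<in> spanned (\<lambda>p. P p \<and> R p)"
  by (auto simp: spanned_def)

lemma spanned_False: "f \<in> spanned P \<Longrightarrow> (\<And>p. p \<in> B \<Longrightarrow> \<not> P p) \<Longrightarrow> f = 0"
  by (auto simp: spanned_def fun_eq_iff)

lemma spanned_disjoint: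
  assumes "f \<in> spanned P" "g \<in> spanned R" "f + g = 0" "\<And>p. p \<in> B \<Longrightarrow> P p \<Longrightarrow> \<not> R p"
  shows "f = 0" "g = 0"
proof -
  have "f p = 0 \<and> g p = 0" for p
  proof -
    have "f p + g p = 0"
      using assms(3) by (metis plus_fun_apply zero_fun_apply)
    thus ?thesis
      using spannedD[OF assms(1), of p] spannedD[OF assms(2), of p] assms(4) by fastforce
  qed
  thus "f = 0" "g = 0" by (simp_all add: fun_eq_iff)
qed

lemma ind_spanned: "w \<in> B \<Longrightarrow> P w \<Longrightarrow> ind w \<in> spanned P"
  by (simp add: spanned_def ind_def)

lemma ind_V: "w \<in> B \<Longrightarrow> ind w \<in> V"
  by (simp add: ind_spanned)

lemma unit_spanned: "unit \<in> spanned (\<lambda>p. plength p = 0)"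
  by (simp add: spanned_def unit_def)

lemma unit_V: "unit \<in> V"
  using unit_spanned by (rule spanned_V)

lemma basis_expansion: "f \<in> spanned P \<Longrightarrow> f = (\<Sum>w\<in>{w\<in>B. P w}. scal (f w) (ind w))"
  by (auto simp: fun_eq_iff fun_sum_apply ind_def B_finite spanned_def if_distrib sum.delta cong: if_cong)

lemma spanned_induct [consumes 1, case_names zero add]:
  assumes "f \<in> spanned P" "Pr 0"
    and "\<And>g c w. g \<in> spanned P \<Longrightarrow> Pr g \<Longrightarrow> w \<in> B \<Longrightarrow> P w \<Longrightarrow> Pr (g + scal c (ind w))"
  shows "Pr f"
proof -
  have "finite S \<Longrightarrow> S \<subseteq> {w\<in>B. P w} \<Longrightarrow> Pr (\<Sum>w\<in>S. scal (f w) (ind w))" for S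
  proof (induction S rule: finite_induct)
    case (insert w S)
    have IH: "Pr (\<Sum>w\<in>S. scal (f w) (ind w))"
      using insert by blast
    have "(\<Sum>w\<in>S. scal (f w) (ind w)) \<in> spanned P"
      using insert.prems by (intro spanned_sum spanned_scal ind_spanned) blast+
    hence "Pr ((\<Sum>w\<in>S. scal (f w) (ind w)) + scal (f w) (ind w))"
      using insert.prems by (intro assms(3)[OF _ IH]) auto
    thus ?case unfolding sum.insert[OF insert(1,2)] by (simp only: add.commute)
  qed (use assms in simp)
  from this[OF _ order_refl] show ?thesis
    using B_finite by (subst basis_expansion[OF assms(1)]) simp
qed

subsection \<open>The product\<close>

lemma conv_V [simp]: "f \<star> g \<in> V"
  by (simp add: spanned_def conv_on_basis_def)

lemma conv_zero [simp]: "0 \<star> f = 0" "f \<star> 0 = 0"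
  by (simp_all add: fun_eq_iff conv_on_basis_def)

lemma conv_add_left: "(f + g) \<star> h = f \<star> h + g \<star> h"
  and conv_add_right: "h \<star> (f + g) = h \<star> f + h \<star> g"
  and conv_diff_left: "(f - g) \<star> h = f \<star> h - g \<star> h"
  and conv_diff_right: "h \<star> (f - g) = h \<star> f - h \<star> g"
  by (simp_all add: fun_eq_iff conv_on_basis_def algebra_simps sum.distrib sum_subtractf)

lemma conv_scal_left: "scal c f \<star> g = scal c (f \<star> g)"
  and conv_scal_right: "f \<star> scal c g = scal c (f \<star> g)"
  by (simp_all add: fun_eq_iff conv_on_basis_def sum_distrib_left mult_ac)

lemmas conv_bilinear = conv_add_left conv_add_right conv_diff_left conv_diff_right
  conv_scal_left conv_scal_right

text \<open>
  Both sides sum over all ways to cut \<open>p\<close> into three pieces.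
\<close>

lemma conv_assoc: "(f \<star> g) \<star> h = f \<star> (g \<star> h)"
proof
  fix p
  show "((f \<star> g) \<star> h) p = (f \<star> (g \<star> h)) p"
  proof (cases "p \<in> B")
    case True
    let ?t = "\<lambda>i j. f (path_take i p) * g (path_take j (path_drop Q i p)) * h (path_drop Q (i + j) p)"
    have "((f \<star> g) \<star> h) p = (\<Sum>n\<le>plength p. \<Sum>i\<le>n. ?t i (n - i))"
      using True
      by (auto simp: conv_on_basis_def[of Q B "f \<star> g"] sum_distrib_right intro!: sum.cong)
        (auto simp: conv_on_basis_def B_take sum_distrib_right plength_path_take path_take_take
          simp flip: path_drop_take intro!: sum.cong)
    also have "\<dots> = (\<Sum>i\<le>plength p. \<Sum>j\<le>plength p - i. ?t i j)"
      by (subst sum.Sigma, simp, simp, subst sum.Sigma, simp, simp)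
        (rule sum.reindex_bij_witness[of _ "\<lambda>(i, j). (i + j, i)" "\<lambda>(n, i). (i, n - i)"], auto)
    also have "\<dots> = (f \<star> (g \<star> h)) p"
      using True
      by (auto simp: conv_on_basis_def B_drop sum_distrib_left plength_path_drop path_drop_drop mult.assoc
          intro!: sum.cong)
    finally show ?thesis .
  qed (simp add: conv_on_basis_def)
qed

lemma conv_nonzeroD:
  assumes "(f \<star> g) p \<noteq> 0"
  shows "p \<in> B \<and> (\<exists>i\<le>plength p. f (path_take i p) \<noteq> 0 \<and> g (path_drop Q i p) \<noteq> 0)"
proof (rule ccontr)
  assume "\<not> ?thesis"
  hence "(f \<star> g) p = 0"
    by (force simp: conv_on_basis_def intro!: sum.neutral)
  thus False using assms by simp
qed

lemma conv_spanned:
  assumes "f \<in> spanned P" "g \<in> spanned R"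
    and "\<And>u w. u \<in> B \<Longrightarrow> w \<in> B \<Longrightarrow> P u \<Longrightarrow> R w \<Longrightarrow> ptarget Q u = psource w \<Longrightarrow>
          pconcat u w \<in> B \<Longrightarrow> S (pconcat u w)"
  shows "f \<star> g \<in> spanned S"
proof (rule spannedI)
  fix p assume "(f \<star> g) p \<noteq> 0"
  then obtain i where "p \<in> B" "i \<le> plength p" "f (path_take i p) \<noteq> 0" "g (path_drop Q i p) \<noteq> 0"
    using conv_nonzeroD by blast
  thus "p \<in> B \<and> S p"
    using assms(3)[of "path_take i p" "path_drop Q i p"] assms(1,2)
    by (auto simp: pconcat_take_drop ptarget_take dest: spannedD)
qed

lemma conv_eq_0:
  assumes "f \<in> spanned P" "g \<in> spanned R"
    and "\<And>u w. u \<in> B \<Longrightarrow> w \<in> B \<Longrightarrow> P u \<Longrightarrow> R w \<Longrightarrow> ptarget Q u = psource w \<Longrightarrow> pconcat u w \<notin> B"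
  shows "f \<star> g = 0"
  using conv_spanned[OF assms(1,2), of "\<lambda>_. False"] assms(3) by (auto dest: spanned_False)

lemma conv_ind:
  "(ind u :: _ \<Rightarrow> 'k::field) \<star> ind w = (if ptarget Q u = psource w \<and> pconcat u w \<in> B then ind (pconcat u w) else 0)"
proof
  fix p
  show "((ind u :: _ \<Rightarrow> 'k) \<star> ind w) p =
    (if ptarget Q u = psource w \<and> pconcat u w \<in> B then ind (pconcat u w) else 0) p"
  proof (cases "p = pconcat u w \<and> ptarget Q u = psource w \<and> p \<in> B")
    case True
    have "ind u (path_take i p) * ind w (path_drop Q i p) = (if i = plength u then 1 else (0::'k))"
      if "i \<le> plength p" for i
      using True that plength_path_take[OF that]
      by (auto simp: ind_def take_pconcat drop_pconcat)
    hence "(\<Sum>i\<le>plength p. ind u (path_take i p) * ind w (path_drop Q i p)) =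
        (\<Sum>i\<le>plength p. if i = plength u then 1 else (0::'k))"
      by (intro sum.cong) auto
    hence "((ind u :: _ \<Rightarrow> 'k) \<star> ind w) p = (\<Sum>i\<le>plength p. if i = plength u then 1 else 0)"
      using True by (auto simp: conv_on_basis_def)
    thus ?thesis using True by (auto simp: ind_def)
  next
    case False
    have "((ind u :: _ \<Rightarrow> 'k) \<star> ind w) p = 0"
    proof (rule ccontr)
      assume "\<not> ?thesis"
      then obtain i where "p \<in> B" "path_take i p = u" "path_drop Q i p = w"
        using conv_nonzeroD[of "ind u :: _ \<Rightarrow> 'k" "ind w" p] by (auto simp: ind_def split: if_splits)
      thus False using False pconcat_take_drop[of i p Q] ptarget_take[of Q i p] by auto
    qed
    thus ?thesis using False by (auto simp: ind_def)
  qed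
qed

lemma conv_stat_left: "f \<in> V \<Longrightarrow> (ind (stat v) \<star> f) p = (if psource p = v then f p else 0)"
proof -
  assume f: "f \<in> V"
  have "(\<Sum>i\<le>plength p. ind (stat v) (path_take i p) * f (path_drop Q i p)) =
    (\<Sum>i\<le>plength p. if i = 0 then ind (stat v) (stat (psource p)) * f p else 0)"
    by (intro sum.cong) (auto simp: ind_def plength_path_take dest!: arg_cong[of _ _ plength])
  thus ?thesis
    using spanned_outside[OF f, of p] by (auto simp: conv_on_basis_def ind_def)
qed

lemma conv_stat_right: "f \<in> V \<Longrightarrow> (f \<star> ind (stat v)) p = (if ptarget Q p = v then f p else 0)"
proof -
  assume f: "f \<in> V"
  have "(\<Sum>i\<le>plength p. f (path_take i p) * ind (stat v) (path_drop Q i p)) =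
    (\<Sum>i\<le>plength p. if i = plength p then f p * ind (stat v) (stat (ptarget Q p)) else 0)"
    by (intro sum.cong) (auto simp: ind_def plength_path_drop drop_plength path_take_all
        dest!: arg_cong[of _ _ plength])
  thus ?thesis
    using spanned_outside[OF f, of p] by (auto simp: conv_on_basis_def ind_def)
qed

lemma unit_conv_sum: "unit = (\<Sum>v\<in>verts Q. ind (stat v))"
proof
  fix p
  have "(\<Sum>v\<in>verts Q. if p = stat v then 1 else 0) = (if p \<in> B \<and> plength p = 0 then 1 else (0::'a))"
  proof (cases "p \<in> B \<and> plength p = 0")
    case True
    hence "p = stat (psource p)" "psource p \<in> verts Q"
      using B_paths paths_verts(1) plength_0_iff by blast+
    hence "(if p = stat v then 1 else 0) = (if v = psource p then 1 else (0::'a))" for v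
      by (metis stat_simps(3))
    thus ?thesis using True \<open>psource p \<in> verts Q\<close> by simp
  next
    case False
    thus ?thesis using B_stat by (auto intro!: sum.neutral)
  qed
  thus "(unit :: _ \<Rightarrow> 'a) p = (\<Sum>v\<in>verts Q. ind (stat v)) p"
    by (simp add: fun_sum_apply unit_def ind_def)
qed

lemma conv_sum_left: "(\<Sum>i\<in>S. F i) \<star> g = (\<Sum>i\<in>S. F i \<star> g)"
  and conv_sum_right: "g \<star> (\<Sum>i\<in>S. F i) = (\<Sum>i\<in>S. g \<star> F i)"
  by (induction S rule: infinite_finite_induct) (auto simp: conv_bilinear)

lemma psource_verts: "p \<in> B \<Longrightarrow> psource p \<in> verts Q"
  and ptarget_verts: "p \<in> B \<Longrightarrow> ptarget Q p \<in> verts Q"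
  using B_paths paths_verts by blast+

lemma conv_unit_left:
  assumes "f \<in> V"
  shows "unit \<star> f = f"
proof
  fix p
  have "(unit \<star> f) p = (\<Sum>v\<in>verts Q. if psource p = v then f p else 0)"
    using assms by (simp add: unit_conv_sum conv_sum_left fun_sum_apply conv_stat_left)
  thus "(unit \<star> f) p = f p"
    using spanned_outside[OF assms, of p] psource_verts[of p] by (cases "p \<in> B") auto
qed

lemma conv_unit_right:
  assumes "f \<in> V"
  shows "f \<star> unit = f"
proof
  fix p
  have "(f \<star> unit) p = (\<Sum>v\<in>verts Q. if ptarget Q p = v then f p else 0)"
    using assms by (simp add: unit_conv_sum conv_sum_right fun_sum_apply conv_stat_right)
  thus "(f \<star> unit) p = f p"
    using spanned_outside[OF assms, of p] ptarget_verts[of p] by (cases "p \<in> B") auto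
qed

end

section \<open>Linear maps and unipotent endomorphisms of the model\<close>

text \<open>
  From here on functions are treated as vectors, and evaluated at a path only on request.
\<close>

lemmas fun_apply = plus_fun_apply zero_fun_apply minus_apply uminus_apply scal_apply

declare fun_apply [simp del]

context path_basis
begin

text \<open>
  Linearity, multiplicativity and the derivation property are only required on \<open>V\<close>, the
  functions that are coordinates of elements of \<open>A\<close>.
\<close>

definition linear_map :: "((('v, 'e) qpath \<Rightarrow> 'k::field) \<Rightarrow> ('v, 'e) qpath \<Rightarrow> 'k) \<Rightarrow> bool" where
  "linear_map T \<longleftrightarrow> (\<forall>f\<in>V. T f \<in> V) \<and> (\<forall>f\<in>V. \<forall>g\<in>V. T (f + g) = T f + T g) \<and>
    (\<forall>c. \<forall>f\<in>V. T (scal c f) = scal c (T f))"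

definition algebra_endo :: "((('v, 'e) qpath \<Rightarrow> 'k::field) \<Rightarrow> ('v, 'e) qpath \<Rightarrow> 'k) \<Rightarrow> bool" where
  "algebra_endo T \<longleftrightarrow> linear_map T \<and> (\<forall>f\<in>V. \<forall>g\<in>V. T (f \<star> g) = T f \<star> T g) \<and>
    (\<forall>v\<in>verts Q. T (ind (stat v)) = ind (stat v))"

definition unipotent :: "((('v, 'e) qpath \<Rightarrow> 'k::field) \<Rightarrow> ('v, 'e) qpath \<Rightarrow> 'k) \<Rightarrow> bool" where
  "unipotent T \<longleftrightarrow> (\<forall>w\<in>B. T (ind w) - ind w \<in> spanned (\<lambda>p. plength w < plength p))"

abbreviation deg :: "nat \<Rightarrow> (('v, 'e) qpath \<Rightarrow> 'k::field) set" where
  "deg n \<equiv> spanned (\<lambda>p. n \<le> plength p)"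

lemma linear_mapD:
  assumes "linear_map T"
  shows "f \<in> V \<Longrightarrow> T f \<in> V" "f \<in> V \<Longrightarrow> g \<in> V \<Longrightarrow> T (f + g) = T f + T g"
    "f \<in> V \<Longrightarrow> T (scal c f) = scal c (T f)"
  using assms by (auto simp: linear_map_def)

lemma linear_map_0: "linear_map T \<Longrightarrow> T 0 = 0"
  using linear_mapD(3)[of T 0 0] by simp

lemma linear_map_diff: "linear_map T \<Longrightarrow> f \<in> V \<Longrightarrow> g \<in> V \<Longrightarrow> T (f - g) = T f - T g"
  using linear_mapD(2)[of T "f - g" g] by (simp add: spanned_diff algebra_simps)

lemma linear_map_sum:
  "linear_map T \<Longrightarrow> (\<And>i. i \<in> S \<Longrightarrow> F i \<in> V) \<Longrightarrow> T (\<Sum>i\<in>S. F i) = (\<Sum>i\<in>S. T (F i))"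
  by (induction S rule: infinite_finite_induct) (auto simp: linear_map_0 linear_mapD spanned_sum)

lemma linear_map_sub_id: "linear_map T \<Longrightarrow> linear_map (\<lambda>f. T f - f)"
  and linear_map_sub: "linear_map T \<Longrightarrow> linear_map S \<Longrightarrow> linear_map (\<lambda>f. T f - S f)"
  by (auto simp: linear_map_def scal_diff intro!: spanned_diff)

lemma linear_map_spanned:
  assumes "linear_map T" "f \<in> spanned P"
    and "\<And>w. w \<in> B \<Longrightarrow> P w \<Longrightarrow> T (ind w) \<in> spanned R"
  shows "T f \<in> spanned R"
  using assms(2)
proof (induction rule: spanned_induct)
  case zero
  thus ?case using linear_map_0[OF assms(1)] by simp
next
  case (add g c w)
  thus ?case
    using assms(1,3) by (simp add: linear_mapD spanned_V[of g] spanned_scal ind_V spanned_add)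
qed

lemma linear_map_eqI:
  assumes "linear_map S" "linear_map T" "f \<in> spanned P"
    and "\<And>w. w \<in> B \<Longrightarrow> P w \<Longrightarrow> S (ind w) = T (ind w)"
  shows "S f = T f"
proof -
  have "S f - T f \<in> spanned (\<lambda>_. False)"
    using linear_map_spanned[OF linear_map_sub[OF assms(1,2)] assms(3)] assms(4) by simp
  from spanned_False[OF this] show ?thesis by simp
qed

lemma conv_left_linear: "linear_map T \<Longrightarrow> linear_map (\<lambda>f. T f \<star> h)"
  and conv_right_linear: "linear_map T \<Longrightarrow> linear_map (\<lambda>f. h \<star> T f)"
  by (auto simp: linear_map_def conv_bilinear)

lemma linear_map_id: "linear_map (\<lambda>f. f)"
  by (simp add: linear_map_def)

lemma linear_map_comp: "linear_map S \<Longrightarrow> linear_map T \<Longrightarrow> linear_map (\<lambda>f. S (T f))"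
  by (auto simp: linear_map_def)

lemma multiplicativeI:
  assumes "linear_map T" "f \<in> V" "g \<in> V"
    and "\<And>u w. u \<in> B \<Longrightarrow> w \<in> B \<Longrightarrow> T (ind u \<star> ind w) = T (ind u) \<star> T (ind w)"
  shows "T (f \<star> g) = T f \<star> T g"
proof (rule linear_map_eqI[OF _ _ assms(3)])
  show "linear_map (\<lambda>g. T (f \<star> g))" "linear_map (\<lambda>g. T f \<star> T g)"
    using assms(1) by (auto simp: linear_map_def conv_bilinear)
  fix w assume w: "w \<in> B"
  show "T (f \<star> ind w) = T f \<star> T (ind w)"
  proof (rule linear_map_eqI[OF _ _ assms(2)])
    show "linear_map (\<lambda>f. T (f \<star> ind w))" "linear_map (\<lambda>f. T f \<star> T (ind w))"
      using assms(1) by (auto simp: linear_map_def conv_bilinear)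
  qed (use assms(4) w in simp)
qed

lemma algebra_endoD:
  assumes "algebra_endo T"
  shows "linear_map T" "f \<in> V \<Longrightarrow> g \<in> V \<Longrightarrow> T (f \<star> g) = T f \<star> T g"
    "v \<in> verts Q \<Longrightarrow> T (ind (stat v)) = ind (stat v)"
  using assms by (auto simp: algebra_endo_def)

lemma stat_V: "v \<in> verts Q \<Longrightarrow> ind (stat v) \<in> V"
  by (simp add: ind_V B_stat)

lemma algebra_endo_unit: "algebra_endo T \<Longrightarrow> T unit = unit"
  by (simp add: unit_conv_sum linear_map_sum algebra_endoD stat_V)

lemma algebra_endo_comp:
  assumes "algebra_endo S" "algebra_endo T"
  shows "algebra_endo (\<lambda>f. S (T f))"
  using algebra_endoD[OF assms(1)] algebra_endoD[OF assms(2)]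
    linear_mapD(1)[OF algebra_endoD(1)[OF assms(2)]]
  by (simp add: algebra_endo_def linear_map_comp)

text \<open>
  Multiplying \<open>w\<close> by the stationary paths at its ends does not change it, and \<open>T\<close> fixes these.
\<close>

lemma algebra_endo_parallel:
  assumes "algebra_endo T" "w \<in> B"
  shows "T (ind w) \<in> spanned (\<lambda>p. psource p = psource w \<and> ptarget Q p = ptarget Q w)"
proof -
  let ?s = "ind (stat (psource w))" and ?t = "ind (stat (ptarget Q w))"
  have st: "psource w \<in> verts Q" "ptarget Q w \<in> verts Q"
    using assms(2) psource_verts ptarget_verts by blast+
  note lin = algebra_endoD(1)[OF assms(1)]
  have TV: "T (ind w) \<in> V"
    using lin assms(2) by (simp add: linear_mapD ind_V)
  have "?s \<star> ind w = ind w" "ind w \<star> ?t = ind w"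
    using assms(2) by (simp_all add: conv_ind pconcat_stat_left pconcat_stat_right)
  hence "?s \<star> T (ind w) = T (ind w)" "T (ind w) \<star> ?t = T (ind w)"
    using algebra_endoD(2,3)[OF assms(1)] st assms(2) by (metis ind_V stat_V)+
  moreover have "p \<in> B \<and> psource p = psource w \<and> ptarget Q p = ptarget Q w"
    if "?s \<star> T (ind w) = T (ind w)" "T (ind w) \<star> ?t = T (ind w)" "T (ind w) p \<noteq> 0" for p
    using that spannedD[OF TV, of p] conv_stat_left[OF TV, of "psource w" p]
      conv_stat_right[OF TV, of "ptarget Q w" p]
    by (auto split: if_splits)
  ultimately show ?thesis
    by (intro spannedI) blast
qed

lemma deg_conv: "f \<in> deg m \<Longrightarrow> g \<in> deg n \<Longrightarrow> f \<star> g \<in> deg (m + n)"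
  by (erule (1) conv_spanned) simp

lemma deg_mono: "f \<in> deg n \<Longrightarrow> m \<le> n \<Longrightarrow> f \<in> deg m"
  by (erule spanned_mono) simp

lemma deg_0: "f \<in> V \<Longrightarrow> f \<in> deg 0"
  by (erule spanned_mono) simp

lemma deg_vanishes: "\<exists>N. \<forall>f\<in>deg N. f = 0"
proof -
  have "plength p < Suc (Max (plength ` B))" if "p \<in> B" for p
    using that B_finite by (simp add: le_imp_less_Suc)
  thus ?thesis
    using spanned_False by (metis linorder_not_less)
qed

lemma unipotent_raise:
  assumes "linear_map T" "unipotent T" "f \<in> deg n"
  shows "T f - f \<in> deg (Suc n)"
proof (rule linear_map_spanned[OF linear_map_sub_id[OF assms(1)] assms(3)])
  fix w assume "w \<in> B" "n \<le> plength w"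
  thus "T (ind w) - ind w \<in> deg (Suc n)"
    using assms(2) unfolding unipotent_def by (auto elim!: spanned_mono)
qed

lemma unipotent_deg: "linear_map T \<Longrightarrow> unipotent T \<Longrightarrow> f \<in> deg n \<Longrightarrow> T f \<in> deg n"
  using spanned_add[of f "\<lambda>p. n \<le> plength p" "T f - f"] unipotent_raise[of T f n] deg_mono[of "T f - f" "Suc n" n]
  by simp

text \<open>
  An element of the kernel has arbitrarily large degree: \<open>T f = 0\<close> gives \<open>f = -(T f - f)\<close>.
\<close>

lemma unipotent_inj:
  assumes "linear_map T" "unipotent T" "f \<in> V" "T f = 0"
  shows "f = 0"
proof -
  have "f \<in> deg n" for n
  proof (induction n)
    case (Suc n)
    thus ?case
      using unipotent_raise[OF assms(1,2) Suc] spanned_uminus[of "- f"] assms(4) by simp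
  qed (use assms(3) deg_0 in blast)
  thus ?thesis using deg_vanishes by blast
qed

text \<open>
  Replacing an approximate solution \<open>f\<close> by \<open>f - (T f - g)\<close> raises the degree of the error. All
  approximations stay in any span that \<open>T\<close> preserves and that contains \<open>g\<close>.
\<close>

lemma unipotent_surj:
  assumes "linear_map T" "unipotent T" "g \<in> spanned P"
    and "\<And>f. f \<in> spanned P \<Longrightarrow> T f \<in> spanned P"
  shows "\<exists>f\<in>spanned P. T f = g"
proof -
  have "\<exists>f\<in>spanned P. T f - g \<in> deg n" for n
  proof (induction n)
    case 0
    show ?case
      using linear_map_0[OF assms(1)] deg_0[OF spanned_V[OF spanned_uminus[OF assms(3)]]]
      by (intro bexI[of _ 0]) auto
  next
    case (Suc n)
    then obtain f where f: "f \<in> spanned P" "T f - g \<in> deg n" by blast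
    let ?r = "T f - g"
    have r: "?r \<in> spanned P"
      using f assms by (intro spanned_diff) auto
    have "T (f - ?r) - g = - (T ?r - ?r)"
      using linear_map_diff[OF assms(1) spanned_V[OF f(1)] spanned_V[OF r]] by (simp add: algebra_simps)
    hence "T (f - ?r) - g \<in> deg (Suc n)"
      using spanned_uminus[OF unipotent_raise[OF assms(1,2) f(2)]] by (simp only:)
    thus ?case using f(1) r spanned_diff by blast
  qed
  thus ?thesis using deg_vanishes by (metis eq_iff_diff_eq_0)
qed

section \<open>Units and conjugation\<close>

text \<open>
  Units are taken in the span of the cycles, because these commute with the stationary paths;
  conjugation by them therefore fixes the vertices.
\<close>

abbreviation cyclic :: "('v, 'e) qpath \<Rightarrow> bool" where
  "cyclic p \<equiv> psource p = ptarget Q p"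

lemma unit_cyclic: "unit \<in> spanned cyclic"
  using unit_spanned by (rule spanned_mono) (metis plength_0_iff stat_simps(3,4))

lemma conv_cyclic: "f \<in> spanned cyclic \<Longrightarrow> g \<in> spanned cyclic \<Longrightarrow> f \<star> g \<in> spanned cyclic"
  by (erule (1) conv_spanned) (simp add: ptarget_pconcat)

text \<open>
  Right multiplication by \<open>1 + y\<close> is unipotent, hence surjective.
\<close>

lemma one_plus_left_inverse:
  fixes y :: "('v, 'e) qpath \<Rightarrow> 'k::field"
  assumes "y \<in> deg 1" "y \<in> spanned P" "(unit :: ('v, 'e) qpath \<Rightarrow> 'k) \<in> spanned P"
    and "\<And>f. f \<in> spanned P \<Longrightarrow> f \<star> y \<in> spanned P"
  shows "\<exists>g\<in>spanned P. g \<star> (unit + y) = unit"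
proof -
  have fy: "f \<star> y = f \<star> (unit + y) - f" if "f \<in> V" for f
    using that by (simp add: conv_bilinear conv_unit_right)
  have lin: "linear_map (\<lambda>f. f \<star> (unit + y))"
    using conv_left_linear[OF linear_map_id] .
  have uni: "unipotent (\<lambda>f. f \<star> (unit + y))"
    unfolding unipotent_def
  proof
    fix w assume w: "w \<in> B"
    have "ind w \<star> y \<in> deg (plength w + 1)"
      using deg_conv[OF ind_spanned[OF w] assms(1)] by simp
    thus "ind w \<star> (unit + y) - ind w \<in> spanned (\<lambda>p. plength w < plength p)"
      using fy[OF ind_V[OF w]] by (simp add: Suc_le_eq)
  qed
  have pres: "f \<star> (unit + y) \<in> spanned P" if "f \<in> spanned P" for f
    using assms(4)[OF that] spanned_V[OF that] that by (simp add: conv_bilinear conv_unit_right spanned_add)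
  show ?thesis by (rule unipotent_surj[OF lin uni assms(3) pres])
qed

text \<open>
  A left inverse \<open>g\<close> again has the form \<open>1 + z\<close>, so it has a left inverse itself, which must be
  \<open>1 + y\<close>.
\<close>

lemma one_plus_inverse:
  fixes y :: "('v, 'e) qpath \<Rightarrow> 'k::field"
  assumes "y \<in> deg 1" "y \<in> spanned cyclic"
  shows "\<exists>g. g \<star> (unit + y) = unit \<and> (unit + y) \<star> g = unit \<and> g - unit \<in> deg 1 \<and> g \<in> spanned cyclic"
proof -
  let ?u = "unit + y"
  have ex: "\<exists>g\<in>spanned cyclic. g \<star> (unit + z) = unit \<and> g - unit = - (g \<star> z) \<and> g - unit \<in> deg 1"
    if z: "z \<in> deg 1" "z \<in> spanned cyclic" for z :: "_ \<Rightarrow> 'k"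
  proof -
    obtain g where g: "g \<in> spanned cyclic" "g \<star> (unit + z) = unit"
      using one_plus_left_inverse[OF z unit_cyclic] conv_cyclic z(2) by blast
    have "g - unit = - (g \<star> z)"
      using g spanned_V[OF g(1)] by (simp add: conv_bilinear conv_unit_right algebra_simps)
    moreover have "g \<star> z \<in> deg (0 + 1)"
      using deg_conv[OF deg_0[OF spanned_V[OF g(1)]] z(1)] .
    ultimately show ?thesis using g spanned_uminus[of "g \<star> z"] by auto
  qed
  obtain g where g: "g \<in> spanned cyclic" "g \<star> ?u = unit" "g - unit \<in> deg 1"
    using ex[OF assms] by blast
  have "g - unit \<in> spanned cyclic"
    using g unit_cyclic spanned_diff by blast
  then obtain h where h: "h \<in> spanned cyclic" "h \<star> g = unit"
    using ex[OF g(3)] by auto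
  have uV: "?u \<in> V" and hV: "h \<in> V"
    using assms h(1) by (auto intro: spanned_add unit_V spanned_V)
  have "h = (h \<star> g) \<star> ?u"
    using g(2) conv_unit_right[OF hV] by (simp add: conv_assoc)
  also have "\<dots> = ?u" using h(2) conv_unit_left[OF uV] by simp
  finally have "?u \<star> g = unit" using h(2) by simp
  thus ?thesis using g by blast
qed

definition unit_pair :: "(('v, 'e) qpath \<Rightarrow> 'k::field) \<Rightarrow> (('v, 'e) qpath \<Rightarrow> 'k) \<Rightarrow> bool" where
  "unit_pair g h \<longleftrightarrow> g \<star> h = unit \<and> h \<star> g = unit \<and> g - unit \<in> deg 1 \<and> h - unit \<in> deg 1 \<and>
    g \<in> spanned cyclic \<and> h \<in> spanned cyclic"

lemma cyclic_commutes_stat: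
  assumes "f \<in> spanned cyclic"
  shows "f \<star> ind (stat v) = ind (stat v) \<star> f"
proof
  fix p show "(f \<star> ind (stat v)) p = (ind (stat v) \<star> f) p"
    using conv_stat_left[OF spanned_V[OF assms]] conv_stat_right[OF spanned_V[OF assms]]
      spannedD[OF assms, of p] by (cases "f p = 0") simp_all
qed

lemma conj_algebra_endo:
  assumes "unit_pair g h" "algebra_endo T"
  shows "algebra_endo (\<lambda>f. g \<star> T f \<star> h)"
proof -
  note T = algebra_endoD[OF assms(2)] and gh = assms(1)[unfolded unit_pair_def]
  have hg: "h \<star> (g \<star> x) = x" if "x \<in> V" for x
    using gh conv_assoc[of h g x] conv_unit_left[OF that] by simp
  have "g \<star> T (x \<star> y) \<star> h = g \<star> T x \<star> h \<star> (g \<star> T y \<star> h)" if "x \<in> V" "y \<in> V" for x y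
    using T(2)[OF that] hg[of "T y \<star> h"] by (simp add: conv_assoc)
  moreover have "g \<star> T (ind (stat v)) \<star> h = ind (stat v)" if "v \<in> verts Q" for v
  proof -
    have "g \<star> T (ind (stat v)) \<star> h = ind (stat v) \<star> (g \<star> h)"
      using T(3)[OF that] cyclic_commutes_stat[of g v] gh by (simp add: conv_assoc)
    thus ?thesis using gh conv_unit_right[OF stat_V[OF that]] by simp
  qed
  moreover have "linear_map (\<lambda>f. g \<star> T f \<star> h)"
    using conv_left_linear[OF conv_right_linear[OF T(1)]] .
  ultimately show ?thesis unfolding algebra_endo_def by blast
qed

lemma conj_unipotent:
  assumes "unit_pair g h" "linear_map T" "unipotent T"
  shows "unipotent (\<lambda>f. g \<star> T f \<star> h)"
  unfolding unipotent_def
proof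
  fix w assume w: "w \<in> B"
  let ?n = "plength w" and ?g = "g - unit" and ?h = "h - unit" and ?X = "T (ind w)"
  have wd: "ind w \<in> deg ?n" by (rule ind_spanned[OF w]) simp
  have X: "?X \<in> deg ?n" "?X - ind w \<in> deg (Suc ?n)"
    using unipotent_deg[OF assms(2,3) wd] unipotent_raise[OF assms(2,3) wd] by auto
  note XV = spanned_V[OF X(1)]
  have gh: "?g \<in> deg 1" "?h \<in> deg 1" "h \<in> deg 0"
    using assms(1) deg_0 spanned_V unfolding unit_pair_def by blast+
  have "g \<star> ?X \<star> h - ind w = (?X - ind w) + ?g \<star> ?X \<star> h + ?X \<star> ?h"
    using conv_unit_left[OF XV] conv_unit_right[OF XV] by (simp add: conv_bilinear)
  moreover have "?g \<star> ?X \<star> h \<in> deg (1 + ?n + 0)" "?X \<star> ?h \<in> deg (?n + 1)"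
    using gh X deg_conv by blast+
  ultimately have "g \<star> ?X \<star> h - ind w \<in> deg (Suc ?n)"
    using X(2) by (simp only: spanned_add add_0_right plus_1_eq_Suc Suc_eq_plus1)
  thus "g \<star> ?X \<star> h - ind w \<in> spanned (\<lambda>p. plength w < plength p)"
    by (simp add: Suc_le_eq)
qed

lemma unipotent_inverse:
  assumes "algebra_endo T" "unipotent T"
  shows "\<exists>S. algebra_endo S \<and> (\<forall>f\<in>V. T (S f) = f \<and> S (T f) = f)"
proof -
  note T = algebra_endoD[OF assms(1)]
  note TV = linear_mapD(1)[OF T(1)]
  have "\<forall>g\<in>V. \<exists>f\<in>V. T f = g"
    using unipotent_surj[OF T(1) assms(2)] TV by blast
  then obtain S where S: "\<And>g. g \<in> V \<Longrightarrow> S g \<in> V" "\<And>g. g \<in> V \<Longrightarrow> T (S g) = g"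
    by metis
  have inj: "f = g" if "f \<in> V" "g \<in> V" "T f = T g" for f g
    using unipotent_inj[OF T(1) assms(2), of "f - g"] linear_map_diff[OF T(1)] that
    by (simp add: spanned_diff)
  have "S (f + g) = S f + S g" if "f \<in> V" "g \<in> V" for f g
    by (rule inj; use S linear_mapD(2)[OF T(1)] that in \<open>simp add: spanned_add\<close>)
  moreover have "S (scal c f) = scal c (S f)" if "f \<in> V" for f c
    by (rule inj; use S linear_mapD(3)[OF T(1)] that in \<open>simp add: spanned_scal\<close>)
  ultimately have "linear_map S"
    using S(1) by (simp add: linear_map_def)
  moreover have "S (f \<star> g) = S f \<star> S g" if "f \<in> V" "g \<in> V" for f g
    by (rule inj; use S T(2) that in simp)
  moreover have "S (ind (stat v)) = ind (stat v)" if "v \<in> verts Q" for v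
    by (rule inj; simp add: S T(3) that stat_V)
  moreover have "S (T f) = f" if "f \<in> V" for f
    by (rule inj; use S TV that in simp)
  ultimately show ?thesis
    using S(2) unfolding algebra_endo_def by blast
qed

end

locale string_basis = path_basis +
  assumes B_succ: "pconcat (arrow Q c) (arrow Q b) \<in> B \<Longrightarrow> pconcat (arrow Q c) (arrow Q b') \<in> B \<Longrightarrow> b = b'"
    and B_pred: "pconcat (arrow Q b) (arrow Q c) \<in> B \<Longrightarrow> pconcat (arrow Q b') (arrow Q c) \<in> B \<Longrightarrow> b = b'"
begin

section \<open>Words\<close>

definition word :: "'b list \<Rightarrow> ('a, 'b) qpath" where
  "word es = (tail Q (hd es), es)"

definition W :: "'b list \<Rightarrow> bool" where
  "W es \<longleftrightarrow> es \<noteq> [] \<and> word es \<in> B"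

lemma word_simps [simp]: "snd (word es) = es" "fst (word es) = tail Q (hd es)"
    "plength (word es) = length es" "psource (word es) = tail Q (hd es)"
  by (simp_all add: word_def plength_def psource_def)

lemma word_single: "word [a] = arrow Q a"
  by (simp add: word_def arrow_def)

lemma word_Cons: "word (a # es) = pconcat (arrow Q a) (head Q a, es)"
  by (simp add: word_def prod_eq_iff)

lemma word_of_basis: "p \<in> B \<Longrightarrow> snd p \<noteq> [] \<Longrightarrow> p = word (snd p)"
  using paths_source[OF B_paths] by (simp add: prod_eq_iff)

lemma W_of_basis: "p \<in> B \<Longrightarrow> snd p \<noteq> [] \<Longrightarrow> W (snd p)"
  using word_of_basis[of p] by (simp add: W_def)

lemma W_single: "W [a] \<longleftrightarrow> a \<in> arcs Q"
  using B_arrow[of a] paths_arcs[OF B_paths, of "arrow Q a"] by (auto simp: W_def word_single)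

lemma W_pair: "W [a, b] \<longleftrightarrow> pconcat (arrow Q a) (arrow Q b) \<in> B"
  by (simp add: W_def word_def pconcat_def)

lemma W_factor: "W (xs @ ys @ zs) \<Longrightarrow> ys \<noteq> [] \<Longrightarrow> W ys"
  using W_of_basis[OF B_take[OF B_drop], of "word (xs @ ys @ zs)" "length ys" "length xs"]
  by (simp add: W_def)

lemma W_prefix: "W (xs @ ys) \<Longrightarrow> xs \<noteq> [] \<Longrightarrow> W xs"
  using W_factor[of "[]" xs ys] by simp

lemma W_suffix: "W (xs @ ys) \<Longrightarrow> ys \<noteq> [] \<Longrightarrow> W ys"
  using W_factor[of xs ys "[]"] by simp

lemma W_Cons_composable:
  assumes "W (a # es)"
  shows "a \<in> arcs Q" "(head Q a, es) \<in> B" "es \<noteq> [] \<Longrightarrow> head Q a = tail Q (hd es)"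
    "es \<noteq> [] \<Longrightarrow> word es = (head Q a, es)"
proof -
  have w: "word (a # es) \<in> B" using assms by (simp add: W_def)
  show "a \<in> arcs Q"
    using paths_Cons[OF B_paths[OF w]] by simp
  have "path_drop Q 1 (word (a # es)) = (head Q a, es)"
    using drop_pconcat[of Q "arrow Q a" "(head Q a, es)"]
    by (simp add: word_Cons psource_def)
  thus B: "(head Q a, es) \<in> B"
    using B_drop[OF w] by metis
  show "es \<noteq> [] \<Longrightarrow> head Q a = tail Q (hd es)"
    using paths_source[OF B_paths[OF B]] by simp
  thus "es \<noteq> [] \<Longrightarrow> word es = (head Q a, es)"
    by (simp add: word_def)
qed

lemma W_pred: "W (a # es) \<Longrightarrow> W (b # es) \<Longrightarrow> es \<noteq> [] \<Longrightarrow> a = b"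
  using B_pred[of a "hd es" b] W_prefix[of "[a, hd es]" "tl es"] W_prefix[of "[b, hd es]" "tl es"]
  by (simp add: W_pair)

definition coefficient :: "(('a, 'b) qpath \<Rightarrow> 'k::field) \<Rightarrow> 'b list \<Rightarrow> 'k" where
  "coefficient f es = (if W es then f (word es) else 0)"

lemma coefficient_apply: "f \<in> deg 1 \<Longrightarrow> p \<in> B \<Longrightarrow> f p = coefficient f (snd p)"
  using spannedD[of f "\<lambda>p. 1 \<le> plength p" p] word_of_basis[of p] W_of_basis[of p]
  by (cases "snd p = []") (auto simp: coefficient_def W_def plength_def)

lemma conv_coefficient:
  assumes "f \<in> deg 1" "g \<in> deg 1" "W es"
  shows "(f \<star> g) (word es) = (\<Sum>i\<le>length es. coefficient f (take i es) * coefficient g (drop i es))"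
proof -
  have B: "word es \<in> B" using assms(3) by (simp add: W_def)
  thus ?thesis
    by (simp add: conv_on_basis_def coefficient_apply[OF assms(1) B_take] coefficient_apply[OF assms(2) B_drop])
qed

lemma conv_ind_left:
  assumes "pconcat u w \<in> B" "ptarget Q u = psource w"
  shows "(ind u \<star> f) (pconcat u w) = (f w :: 'k::field)"
proof -
  let ?p = "pconcat u w"
  have "ind u (path_take i ?p) * f (path_drop Q i ?p) = (if i = plength u then f w else 0)"
    if "i \<le> plength ?p" for i
    using that plength_path_take[OF that] assms(2)
    by (auto simp: ind_apply take_pconcat drop_pconcat)
  hence "(\<Sum>i\<le>plength ?p. ind u (path_take i ?p) * f (path_drop Q i ?p)) =
      (\<Sum>i\<le>plength ?p. if i = plength u then f w else 0)"
    by (intro sum.cong) auto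
  thus ?thesis using assms(1) by (simp add: conv_on_basis_def)
qed

section \<open>Eliminating bad coefficients by inner automorphisms\<close>

text \<open>
  The paths whose coefficients are removed: \<open>aq\<close> with \<open>q\<close> not ending in \<open>a\<close> that can be
  continued on the right or on the left. The paths \<open>aq\<close> with \<open>q\<close> ending in \<open>a\<close> are left to \<open>\<rho>\<close>,
  and those that are left and right maximal to \<open>\<delta>\<close>.
\<close>

definition bad :: "'b \<Rightarrow> 'b list \<Rightarrow> bool" where
  "bad a es \<longleftrightarrow> (\<exists>q. es = a # q \<and> q \<noteq> [] \<and> last q \<noteq> a \<and>
    ((\<exists>c. W (a # q @ [c])) \<or> (\<exists>c. W (c # a # q))))"

lemma bad_W: "bad a es \<Longrightarrow> W es"
  unfolding bad_def using W_prefix[of es] W_suffix[of "[_]" es] by fastforce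

lemma arrow_deg: "a \<in> arcs Q \<Longrightarrow> ind (arrow Q a) \<in> deg 1"
  by (rule ind_spanned[OF B_arrow]) auto

lemma unipotent_arrow:
  assumes "algebra_endo T" "unipotent T" "a \<in> arcs Q"
  shows "T (ind (arrow Q a)) - ind (arrow Q a) \<in> deg 2" "T (ind (arrow Q a)) \<in> deg 1"
  using unipotent_raise[OF algebra_endoD(1)[OF assms(1)] assms(2) arrow_deg[OF assms(3)]]
    unipotent_deg[OF algebra_endoD(1)[OF assms(1)] assms(2) arrow_deg[OF assms(3)]]
  by (simp_all add: numeral_2_eq_2)

lemma unit_pair_mult:
  assumes "unit_pair g h" "unit_pair g' h'"
  shows "unit_pair (g' \<star> g) (h \<star> h')"
proof -
  have V: "g \<in> V" "h \<in> V" "g' \<in> V" "h' \<in> V"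
    using assms spanned_V unfolding unit_pair_def by blast+
  have inv: "x \<star> y = unit \<Longrightarrow> z \<in> V \<Longrightarrow> x \<star> (y \<star> z) = z" for x y z
    using conv_assoc[of x y z] conv_unit_left[of z] by simp
  have "g' \<star> g \<star> (h \<star> h') = unit" "h \<star> h' \<star> (g' \<star> g) = unit"
    using assms inv[of g h h'] inv[of h' g' g] V by (simp_all add: conv_assoc unit_pair_def)
  moreover have "x \<star> y - unit \<in> deg 1" if "x - unit \<in> deg 1" "y - unit \<in> deg 1" "x \<in> V" "y \<in> V" for x y
  proof -
    have "x \<star> y - unit = (x - unit) \<star> y + (y - unit)"
      using that by (simp add: conv_bilinear conv_unit_left)
    moreover have "(x - unit) \<star> y \<in> deg (1 + 0)"
      using deg_conv[OF that(1) deg_0[OF that(4)]] .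
    ultimately show ?thesis using that(2) by (simp only: spanned_add add_0_right)
  qed
  ultimately show ?thesis
    using assms V conv_cyclic unfolding unit_pair_def by blast
qed

text \<open>
  Let \<open>Y\<close> be the combination of the cycles \<open>q\<close> of length \<open>d + 1\<close> with the coefficients of the bad
  paths \<open>aq\<close> in \<open>T(a)\<close>; this makes sense because \<open>q\<close> determines \<open>a\<close>. Conjugation by \<open>1 - Y\<close>
  changes \<open>T(a)\<close> by \<open>Ya - aY\<close> up to paths of length at least \<open>d + 3\<close>. The term \<open>aY\<close> cancels the
  bad coefficients of length \<open>d + 2\<close>; the paths in \<open>Ya\<close> end in \<open>a\<close> and are not bad.
\<close>

lemma eliminate_step:
  fixes T :: "(('a, 'b) qpath \<Rightarrow> 'k::field) \<Rightarrow> ('a, 'b) qpath \<Rightarrow> 'k"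
  assumes T: "algebra_endo T" "unipotent T"
    and IH: "\<And>a es. a \<in> arcs Q \<Longrightarrow> bad a es \<Longrightarrow> length es \<le> Suc d \<Longrightarrow> T (ind (arrow Q a)) (word es) = 0"
  shows "\<exists>g h. unit_pair g h \<and> (\<forall>a es. a \<in> arcs Q \<longrightarrow> bad a es \<longrightarrow> length es \<le> Suc (Suc d) \<longrightarrow>
    (g \<star> T (ind (arrow Q a)) \<star> h) (word es) = 0)"
proof -
  \<comment> \<open>The unique arrow that continues \<open>p\<close> to the left, provided that there is one.\<close>
  define pre where "pre p = (THE a. W (a # snd p))" for p :: "('a, 'b) qpath"
  define Y where "Y p = (if p \<in> B \<and> plength p = Suc d \<and> bad (pre p) (pre p # snd p)
    then T (ind (arrow Q (pre p))) (word (pre p # snd p)) else 0)" for p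
  have pre: "pre p = a" if "W (a # snd p)" "snd p \<noteq> []" for p a
    unfolding pre_def using that W_pred by blast
  have Yd: "Y \<in> deg (Suc d)"
    by (rule spannedI) (auto simp: Y_def split: if_splits)
  have Yc: "Y \<in> spanned cyclic"
  proof (rule spannedI)
    fix p assume nz: "Y p \<noteq> 0"
    let ?a = "pre p" and ?w = "word (pre p # snd p)"
    have p: "p \<in> B" "snd p \<noteq> []" "bad ?a (?a # snd p)" and nz': "T (ind (arrow Q ?a)) ?w \<noteq> 0"
      using nz by (auto simp: Y_def plength_def split: if_splits)
    note Wp = bad_W[OF p(3)]
    note comp = W_Cons_composable[OF Wp]
    have "ptarget Q ?w = head Q ?a"
      using spannedD[OF algebra_endo_parallel[OF T(1) B_arrow[OF comp(1)]] nz'] by simp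
    moreover have "ptarget Q ?w = ptarget Q p"
      using p(2) by (simp add: ptarget_conv)
    moreover have "psource p = head Q ?a"
      using comp(3) p(2) paths_source[OF B_paths[OF p(1)]] by (simp add: psource_def)
    ultimately show "p \<in> B \<and> cyclic p" using p(1) by simp
  qed
  have nYd: "- Y \<in> deg 1" and nYc: "- Y \<in> spanned cyclic"
    using spanned_uminus[OF deg_mono[OF Yd, of 1]] spanned_uminus[OF Yc] by simp_all
  then obtain g where g: "g \<star> (unit - Y) = unit" "(unit - Y) \<star> g = unit" "g - unit \<in> deg 1"
      "g \<in> spanned cyclic"
    using one_plus_inverse[of "- Y"] by auto
  let ?h = "unit - Y"
  have pair: "unit_pair g ?h"
    using g nYd spanned_diff[OF unit_cyclic Yc] by (simp add: unit_pair_def)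
  have gV: "g \<in> V" using g(4) by (rule spanned_V)
  have g1: "g = unit + g \<star> Y"
    using g(1) conv_unit_right[OF gV] by (simp add: conv_bilinear algebra_simps)
  have "g \<star> Y = Y + g \<star> Y \<star> Y"
    using arg_cong[OF g1, of "\<lambda>x. x \<star> Y"] conv_unit_left[OF spanned_V[OF Yc]] by (simp add: conv_bilinear)
  hence g2: "g = unit + Y + g \<star> Y \<star> Y"
    using g1 by (metis add.assoc)
  have "(g \<star> T (ind (arrow Q a)) \<star> ?h) (word es) = 0"
    if a: "a \<in> arcs Q" and b: "bad a es" and len: "length es \<le> Suc (Suc d)" for a es
  proof -
    let ?A = "ind (arrow Q a) :: ('a, 'b) qpath \<Rightarrow> 'k"
    let ?X = "T ?A"
    let ?w = "word es"
    note Xd = unipotent_arrow[OF T a]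
    note XV = spanned_V[OF Xd(2)]
    \<comment> \<open>Each term of \<open>R\<close> contains \<open>Y\<close> and \<open>T(a) - a\<close>, or \<open>Y\<close> twice and \<open>T(a)\<close>.\<close>
    define R where "R = Y \<star> (?X - ?A) + g \<star> Y \<star> Y \<star> ?X - (?X - ?A) \<star> Y - g \<star> Y \<star> ?X \<star> Y"
    have "g \<star> ?X = ?X + Y \<star> ?X + g \<star> Y \<star> Y \<star> ?X"
      using arg_cong[OF g2, of "\<lambda>x. x \<star> ?X"] conv_unit_left[OF XV] by (simp add: conv_bilinear)
    moreover have "g \<star> ?X \<star> Y = ?X \<star> Y + g \<star> Y \<star> ?X \<star> Y"
      using arg_cong[OF g1, of "\<lambda>x. x \<star> ?X \<star> Y"] conv_unit_left[OF XV] by (simp add: conv_bilinear)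
    moreover have "g \<star> ?X \<star> ?h = g \<star> ?X - g \<star> ?X \<star> Y"
      by (simp only: conv_diff_right[of "g \<star> ?X"] conv_unit_right[OF conv_V])
    ultimately have "g \<star> ?X \<star> ?h = (?X + Y \<star> ?X + g \<star> Y \<star> Y \<star> ?X) - (?X \<star> Y + g \<star> Y \<star> ?X \<star> Y)"
      by metis
    hence expansion: "g \<star> ?X \<star> ?h = ?X + Y \<star> ?A - ?A \<star> Y + R"
      by (simp only:) (simp add: R_def conv_bilinear)
    have R: "R \<in> deg (d + 3)"
    proof -
      have "Y \<star> (?X - ?A) \<in> deg (Suc d + 2)" "(?X - ?A) \<star> Y \<in> deg (2 + Suc d)"
        "g \<star> Y \<star> Y \<star> ?X \<in> deg (0 + Suc d + Suc d + 1)" "g \<star> Y \<star> ?X \<star> Y \<in> deg (0 + Suc d + 1 + Suc d)"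
        by (intro deg_conv Yd Xd deg_0 gV)+
      thus ?thesis unfolding R_def by (intro spanned_add spanned_diff) (erule deg_mono; simp)+
    qed
    hence R0: "R ?w = 0"
      using spannedD[OF R, of ?w] len by auto
    have YA: "Y \<star> ?A \<in> deg (Suc d + 1)" and AY: "?A \<star> Y \<in> deg (1 + Suc d)"
      by (intro deg_conv Yd arrow_deg a)+
    have "(?X + Y \<star> ?A - ?A \<star> Y) ?w = 0"
    proof (cases "length es \<le> Suc d")
      case True
      thus ?thesis
        using IH[OF a b True] spanned_zero_at[OF YA, of ?w] spanned_zero_at[OF AY, of ?w]
        by (simp add: fun_apply)
    next
      case False
      hence len': "length es = Suc (Suc d)" using len by simp
      obtain q where q: "es = a # q" "q \<noteq> []" "last q \<noteq> a"
        using b unfolding bad_def by blast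
      let ?q = "(head Q a, q)"
      have Wq: "W (a # q)" using bad_W[OF b] q(1) by simp
      have w: "?w = pconcat (arrow Q a) ?q" "pconcat (arrow Q a) ?q \<in> B"
        using Wq q(1) by (simp_all add: W_def word_Cons)
      have "Y ?q = ?X ?w"
        using pre[of a ?q] W_Cons_composable(2)[OF Wq] Wq q b len' by (simp add: Y_def plength_def)
      hence "(?A \<star> Y) ?w = ?X ?w"
        using conv_ind_left[OF w(2), of Y] w(1) by (simp add: psource_def)
      moreover have "(Y \<star> ?A) ?w = 0"
      proof (rule ccontr)
        assume "(Y \<star> ?A) ?w \<noteq> 0"
        then obtain i where "path_drop Q i ?w = arrow Q a"
          using conv_nonzeroD[of Y ?A ?w] by (auto simp: ind_apply split: if_splits)
        hence "drop i es = [a]"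
          by (metis snd_path_drop word_simps(1) arrow_simps(2))
        hence "last es = a"
          by (metis drop_all last_ConsL last_drop list.discI not_le)
        thus False using q by simp
      qed
      ultimately show ?thesis by (simp add: fun_apply)
    qed
    thus ?thesis using R0 unfolding expansion by (simp add: plus_fun_apply)
  qed
  thus ?thesis using pair by blast
qed

lemma eliminate:
  assumes "algebra_endo T" "unipotent T"
  shows "\<exists>g h. unit_pair g h \<and> (\<forall>a es. a \<in> arcs Q \<longrightarrow> bad a es \<longrightarrow>
    (g \<star> T (ind (arrow Q a)) \<star> h) (word es) = 0)"
proof -
  have "\<exists>g h. unit_pair g h \<and> (\<forall>a es. a \<in> arcs Q \<longrightarrow> bad a es \<longrightarrow> length es \<le> Suc d \<longrightarrow>
    (g \<star> T (ind (arrow Q a)) \<star> h) (word es) = 0)" for d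
  proof (induction d)
    case 0
    have "unit_pair unit unit"
      by (simp add: unit_pair_def conv_unit_left unit_V unit_cyclic)
    moreover have "\<not> (bad a es \<and> length es \<le> Suc 0)" for a es
      by (auto simp: bad_def)
    ultimately show ?case by blast
  next
    case (Suc d)
    then obtain g h where gh: "unit_pair g h" and
      c: "\<And>a es. a \<in> arcs Q \<Longrightarrow> bad a es \<Longrightarrow> length es \<le> Suc d \<Longrightarrow>
        (g \<star> T (ind (arrow Q a)) \<star> h) (word es) = 0" by blast
    obtain g' h' where gh': "unit_pair g' h'" and
      c': "\<forall>a es. a \<in> arcs Q \<longrightarrow> bad a es \<longrightarrow> length es \<le> Suc (Suc d) \<longrightarrow>
        (g' \<star> (g \<star> T (ind (arrow Q a)) \<star> h) \<star> h') (word es) = 0"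
      using eliminate_step[OF conj_algebra_endo[OF gh assms(1)]
          conj_unipotent[OF gh algebra_endoD(1)[OF assms(1)] assms(2)] c] by blast
    show ?case
      using unit_pair_mult[OF gh gh'] c' by (intro exI[of _ "g' \<star> g"] exI[of _ "h \<star> h'"]) (simp add: conv_assoc)
  qed
  moreover obtain N where N: "\<And>f. f \<in> deg N \<Longrightarrow> f = (0 :: ('a, 'b) qpath \<Rightarrow> 'c)"
    using deg_vanishes by blast
  have "length es < N" if "bad a es" for a es
  proof (rule ccontr)
    assume "\<not> ?thesis"
    hence "(ind (word es) :: ('a, 'b) qpath \<Rightarrow> 'c) \<in> deg N"
      using bad_W[OF that] by (intro ind_spanned) (auto simp: W_def)
    hence "(ind (word es) :: ('a, 'b) qpath \<Rightarrow> 'c) (word es) = 0"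
      using N zero_fun_apply by metis
    thus False by simp
  qed
  ultimately show ?thesis by (metis less_imp_le_nat le_SucI)
qed

section \<open>The support of a normalized automorphism\<close>

text \<open>
  Left and right maximality expressed by membership in the basis.
\<close>

definition lmax :: "('a, 'b) qpath \<Rightarrow> bool" where
  "lmax p \<longleftrightarrow> (\<forall>c\<in>arcs Q. head Q c = psource p \<longrightarrow> pconcat (arrow Q c) p \<notin> B)"

definition rmax :: "('a, 'b) qpath \<Rightarrow> bool" where
  "rmax p \<longleftrightarrow> (\<forall>c\<in>arcs Q. ptarget Q p = tail Q c \<longrightarrow> pconcat p (arrow Q c) \<notin> B)"

lemma lmax_word: "es \<noteq> [] \<Longrightarrow> (\<And>c. \<not> W (c # es)) \<Longrightarrow> lmax (word es)"
  unfolding lmax_def W_def by (auto simp: word_def pconcat_def arrow_def)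

lemma rmax_word: "es \<noteq> [] \<Longrightarrow> (\<And>c. \<not> W (es @ [c])) \<Longrightarrow> rmax (word es)"
  unfolding rmax_def W_def by (auto simp: word_def pconcat_def arrow_def)

definition no_bad_coefficients :: "((('a, 'b) qpath \<Rightarrow> 'k::field) \<Rightarrow> ('a, 'b) qpath \<Rightarrow> 'k) \<Rightarrow> bool" where
  "no_bad_coefficients T \<longleftrightarrow> (\<forall>a\<in>arcs Q. \<forall>es. bad a es \<longrightarrow> T (ind (arrow Q a)) (word es) = 0)"

lemma word_coefficients_of_endo:
  assumes T: "algebra_endo T" "unipotent T" "no_bad_coefficients T"
  shows "word_coefficients W (\<lambda>a es. if a \<in> arcs Q then coefficient (T (ind (arrow Q a))) es else 0)"
    (is "word_coefficients W ?G")
proof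
  fix a es
  show "?G a [] = 0"
    by (simp add: coefficient_def W_def)
  show "?G a es \<noteq> 0 \<Longrightarrow> W es \<and> W [a]"
    by (auto simp: coefficient_def W_single split: if_splits)
next
  fix a b assume "W [a]"
  hence a: "a \<in> arcs Q" by (simp add: W_single)
  have "T (ind (arrow Q a)) (arrow Q b) = ind (arrow Q a) (arrow Q b)"
    using spanned_zero_at[OF unipotent_arrow(1)[OF T(1,2) a], of "arrow Q b"] by (simp add: fun_apply)
  thus "?G a [b] = (if b = a then 1 else 0)"
    using a by (auto simp: coefficient_def W_single word_single ind_apply dest: arg_cong[of _ _ snd])
next
  fix c a es assume *: "W [c]" "W [a]" "\<not> W [c, a]" "W es"
  hence ca: "c \<in> arcs Q" "a \<in> arcs Q" by (simp_all add: W_single)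
  have "T (ind (arrow Q c)) \<star> T (ind (arrow Q a)) = T (ind (arrow Q c) \<star> ind (arrow Q a))"
    using algebra_endoD(2)[OF T(1)] ca by (simp add: ind_V B_arrow)
  also have "ind (arrow Q c) \<star> ind (arrow Q a) = (0 :: _ \<Rightarrow> 'c)"
    using *(3) by (simp add: conv_ind W_pair)
  finally have "T (ind (arrow Q c)) \<star> T (ind (arrow Q a)) = 0"
    using linear_map_0[OF algebra_endoD(1)[OF T(1)]] by simp
  thus "(\<Sum>i\<le>length es. ?G c (take i es) * ?G a (drop i es)) = 0"
    using conv_coefficient[OF unipotent_arrow(2)[OF T(1,2) ca(1)] unipotent_arrow(2)[OF T(1,2) ca(2)] *(4)]
      ca by (simp add: zero_fun_apply)
next
  fix q a assume "q \<noteq> []" "last q \<noteq> a" "(\<exists>c. W (a # q @ [c])) \<or> (\<exists>c. W (c # a # q))"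
  hence "bad a (a # q)" unfolding bad_def by blast
  thus "?G a (a # q) = 0"
    using T(3) by (auto simp: no_bad_coefficients_def coefficient_def)
qed (use W_factor B_succ B_pred in \<open>auto simp: W_pair\<close>)

text \<open>
  The combinatorial result \<open>support_shape\<close>, read as a statement about paths.
\<close>

lemma support_of_arrow_image:
  assumes T: "algebra_endo T" "unipotent T" "no_bad_coefficients T" and a: "a \<in> arcs Q"
    and p: "T (ind (arrow Q a)) p \<noteq> 0" "p \<noteq> arrow Q a"
  shows "2 \<le> plength p \<and> (first_arrow Q p = arrow Q a \<and> last_arrow Q p = arrow Q a \<or>
    lmax p \<and> (rmax p \<or> last_arrow Q p = arrow Q a))"
proof -
  interpret word_coefficients W "\<lambda>a es. if a \<in> arcs Q then coefficient (T (ind (arrow Q a))) es else 0"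
    using word_coefficients_of_endo[OF T] .
  note X = unipotent_arrow[OF T(1,2) a]
  have pB: "p \<in> B" and "1 \<le> plength p"
    using spannedD[OF X(2) p(1)] by auto
  hence ne: "snd p \<noteq> []" by (auto simp: plength_def)
  have "(T (ind (arrow Q a)) - ind (arrow Q a)) p \<noteq> 0"
    using p by (simp add: fun_apply ind_apply)
  hence len: "2 \<le> plength p"
    using spannedD[OF X(1)] by blast
  have pw: "p = word (snd p)" using word_of_basis[OF pB ne] .
  have "coefficient (T (ind (arrow Q a))) (snd p) \<noteq> 0"
    using p(1) coefficient_apply[OF X(2) pB] by simp
  hence shape: "hd (snd p) = a \<and> last (snd p) = a \<or>
      (\<forall>c. \<not> W (c # snd p)) \<and> (last (snd p) = a \<or> (\<forall>c. \<not> W (snd p @ [c])))"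
    using support_shape[of a "snd p"] a len by (simp add: plength_def)
  have "lmax p" if "\<forall>c. \<not> W (c # snd p)"
    using lmax_word[OF ne] that pw by metis
  moreover have "rmax p" if "\<forall>c. \<not> W (snd p @ [c])"
    using rmax_word[OF ne] that pw by metis
  ultimately show ?thesis
    using shape len ne by (auto simp: first_arrow_def last_arrow_def)
qed

section \<open>The diagonal part\<close>

definition same_ends :: "('a, 'b) qpath \<Rightarrow> ('a, 'b) qpath \<Rightarrow> bool" where
  "same_ends p w \<longleftrightarrow> first_arrow Q p = first_arrow Q w \<and> last_arrow Q p = last_arrow Q w"

lemma same_ends_refl [simp]: "same_ends p p"
  and same_ends_trans: "same_ends p w \<Longrightarrow> same_ends w x \<Longrightarrow> same_ends p x"
  by (auto simp: same_ends_def)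

lemma first_arrow_pconcat: "snd u \<noteq> [] \<Longrightarrow> first_arrow Q (pconcat u w) = first_arrow Q u"
  and last_arrow_pconcat: "snd w \<noteq> [] \<Longrightarrow> last_arrow Q (pconcat u w) = last_arrow Q w"
  by (simp_all add: first_arrow_def last_arrow_def)

lemma arrow_inject [simp]: "arrow Q a = arrow Q b \<longleftrightarrow> a = b"
  by (auto simp: arrow_def)

lemma pconcat_B:
  assumes "pconcat u w \<in> B" "ptarget Q u = psource w"
  shows "u \<in> B" "w \<in> B"
  using B_take[OF assms(1), of "plength u"] B_drop[OF assms(1), of "plength u"] assms(2)
  by (simp_all add: take_pconcat drop_pconcat)

lemma basis_Cons:
  assumes "p \<in> B" "1 \<le> plength p"
  obtains a w where "a \<in> arcs Q" "w \<in> B" "p = pconcat (arrow Q a) w" "ptarget Q (arrow Q a) = psource w"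
    "plength p = Suc (plength w)"
proof -
  obtain a es where "snd p = a # es"
    using assms(2) by (cases "snd p") (auto simp: plength_def)
  note p = paths_Cons[OF B_paths[OF assms(1)] this]
  let ?w = "(head Q a, es)"
  have "ptarget Q (arrow Q a) = psource ?w" by (simp add: psource_def)
  moreover have "?w \<in> B"
    using pconcat_B(2)[of "arrow Q a" ?w] p assms(1) by (simp add: psource_def)
  moreover have "plength p = Suc (plength ?w)"
    using p arg_cong[of p "pconcat (arrow Q a) ?w" plength] by simp
  ultimately show ?thesis
    using p that by blast
qed

lemma last_arrow_split:
  assumes "p \<in> B" "last_arrow Q p = arrow Q b"
  obtains q where "q \<in> B" "p = pconcat q (arrow Q b)" "ptarget Q q = tail Q b" "plength p = Suc (plength q)"
proof -
  have ne: "snd p \<noteq> []" and last: "last (snd p) = b"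
    using assms(2) by (auto simp: last_arrow_def split: if_splits)
  let ?n = "plength p - 1"
  have n: "Suc ?n = plength p"
    using ne by (simp add: plength_def)
  have "snd (path_drop Q ?n p) = [b]"
    using ne last by (simp add: plength_def) (metis One_nat_def append_butlast_last_id append_eq_conv_conj length_butlast)
  hence drop: "path_drop Q ?n p = arrow Q b"
    using word_of_basis[OF B_drop[OF assms(1)], of ?n] by (simp add: word_single)
  have "p = pconcat (path_take ?n p) (arrow Q b)"
    using pconcat_take_drop[of ?n p Q] drop by simp
  moreover have "ptarget Q (path_take ?n p) = tail Q b"
    using drop by (simp add: ptarget_take)
  moreover have "plength p = Suc (plength (path_take ?n p))"
    using n by (simp add: plength_path_take)
  ultimately show ?thesis
    using that B_take[OF assms(1)] by blast
qed

text \<open>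
  Maximality excludes continuation by a single arrow, hence by any path of positive length.
\<close>

lemma left_maximal_no_extension:
  assumes "lmax w" "u \<in> B" "1 \<le> plength u" "ptarget Q u = psource w"
  shows "pconcat u w \<notin> B"
proof
  assume uw: "pconcat u w \<in> B"
  let ?x = "path_drop Q (plength u - 1) u"
  have x: "plength ?x = 1" "?x \<in> B" "1 \<le> plength ?x"
    using assms(2,3) B_drop by (simp_all add: plength_path_drop)
  obtain a v where a: "a \<in> arcs Q" "v \<in> B" "?x = pconcat (arrow Q a) v"
      "ptarget Q (arrow Q a) = psource v" "plength ?x = Suc (plength v)"
    by (rule basis_Cons[OF x(2,3)])
  have xa: "?x = arrow Q a"
    using a(3,5) x(1) pconcat_length_0[of v "arrow Q a"] by simp
  have "pconcat u w = pconcat (path_take (plength u - 1) u) (pconcat ?x w)"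
    by (metis pconcat_assoc pconcat_take_drop)
  moreover have "ptarget Q (path_take (plength u - 1) u) = psource (pconcat ?x w)"
    by (simp add: ptarget_take)
  ultimately have "pconcat ?x w \<in> B"
    using pconcat_B(2) uw by metis
  moreover have "head Q a = psource w"
    using arg_cong[OF xa, of "ptarget Q"] assms(4) by simp
  ultimately show False
    using assms(1) a(1) xa unfolding lmax_def by simp
qed

lemma right_maximal_no_extension:
  assumes "rmax u" "w \<in> B" "1 \<le> plength w" "ptarget Q u = psource w"
  shows "pconcat u w \<notin> B"
proof
  assume uw: "pconcat u w \<in> B"
  obtain a v where a: "a \<in> arcs Q" "v \<in> B" "w = pconcat (arrow Q a) v"
      "ptarget Q (arrow Q a) = psource v" "plength w = Suc (plength v)"
    by (rule basis_Cons[OF assms(2,3)])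
  have "pconcat u w = pconcat (pconcat u (arrow Q a)) v" using a by (simp add: pconcat_assoc)
  moreover have "ptarget Q (pconcat u (arrow Q a)) = psource v"
    using a assms(4) by (simp add: ptarget_pconcat)
  ultimately have "pconcat u (arrow Q a) \<in> B"
    using pconcat_B(1) uw by metis
  thus False
    using assms(1,4) a unfolding rmax_def by simp
qed

lemma lmax_pconcat:
  assumes "lmax u" "pconcat u w \<in> B" "ptarget Q u = psource w" "u \<in> B"
  shows "lmax (pconcat u w)"
  unfolding lmax_def
proof (intro ballI impI)
  fix c assume c: "c \<in> arcs Q" "head Q c = psource (pconcat u w)"
  have "pconcat (arrow Q c) (pconcat u w) = pconcat (pconcat (arrow Q c) u) w"
    by (simp add: pconcat_assoc)
  moreover have "ptarget Q (pconcat (arrow Q c) u) = psource w"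
    using c assms(3) by (simp add: ptarget_pconcat)
  moreover have "pconcat (arrow Q c) u \<notin> B"
    using assms(1) c unfolding lmax_def by simp
  ultimately show "pconcat (arrow Q c) (pconcat u w) \<notin> B"
    using pconcat_B(1) by metis
qed

text \<open>
  The shape of the paths in \<open>T(w) - \<rho>(w)\<close>. The clause on the last arrow makes sure that
  a path that is not right maximal still ends like \<open>w\<close>, and so differs from it at the beginning.
\<close>

abbreviation residual :: "('a, 'b) qpath \<Rightarrow> ('a, 'b) qpath \<Rightarrow> bool" where
  "residual w p \<equiv> 2 \<le> plength p \<and> lmax p \<and> \<not> same_ends p w \<and>
    (rmax p \<or> last_arrow Q p = last_arrow Q w)"

abbreviation left_annihilated :: "('a, 'b) qpath \<Rightarrow> bool" where
  "left_annihilated p \<equiv> 2 \<le> plength p \<and> lmax p"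

lemma deg1_conv_left_annihilated:
  assumes "f \<in> deg 1" "g \<in> spanned left_annihilated"
  shows "f \<star> g = 0"
  using assms by (rule conv_eq_0) (use left_maximal_no_extension in blast)

text \<open>
  The linear map whose value at a basis path \<open>w\<close> is the part of \<open>T(w)\<close> on the paths
  with the first and the last arrow of \<open>w\<close>.
\<close>

definition diagonal_part ::
    "((('a, 'b) qpath \<Rightarrow> 'k::field) \<Rightarrow> ('a, 'b) qpath \<Rightarrow> 'k) \<Rightarrow>
      (('a, 'b) qpath \<Rightarrow> 'k) \<Rightarrow> ('a, 'b) qpath \<Rightarrow> 'k" where
  "diagonal_part T f p = (\<Sum>w\<in>{w\<in>B. same_ends p w}. f w * T (ind w) p)"

lemma diagonal_part_ind:
  "w \<in> B \<Longrightarrow> diagonal_part T (ind w) p = (if same_ends p w then T (ind w) p else 0)"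
  by (simp add: diagonal_part_def ind_apply B_finite if_distrib[of "\<lambda>x. x * _"] cong: if_cong)

lemma diagonal_part_linear:
  assumes "linear_map T"
  shows "linear_map (diagonal_part T)"
  unfolding linear_map_def
proof (intro conjI ballI allI)
  fix f :: "('a, 'b) qpath \<Rightarrow> 'c"
  show "diagonal_part T f \<in> V"
  proof (rule spannedI)
    fix p assume "diagonal_part T f p \<noteq> 0"
    then obtain w where "w \<in> B" "T (ind w) p \<noteq> 0"
      unfolding diagonal_part_def by (auto elim!: sum.not_neutral_contains_not_neutral)
    thus "p \<in> B \<and> True"
      using spannedD linear_mapD(1)[OF assms] ind_V by blast
  qed
qed (auto simp: diagonal_part_def fun_eq_iff fun_apply algebra_simps sum.distrib sum_distrib_left)

lemma diagonal_part_eqI: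
  assumes "w \<in> B" "T (ind w) = \<alpha> + \<beta>"
    and "\<alpha> \<in> spanned (\<lambda>p. same_ends p w)" "\<beta> \<in> spanned (\<lambda>p. \<not> same_ends p w)"
  shows "diagonal_part T (ind w) = \<alpha>"
proof
  fix p show "diagonal_part T (ind w) p = \<alpha> p"
    using assms(2) spanned_zero_at[OF assms(3), of p] spanned_zero_at[OF assms(4), of p]
    by (auto simp: diagonal_part_ind[OF assms(1)] fun_apply)
qed

lemma diagonal_part_spanned:
  assumes "linear_map T" "w \<in> B"
  shows "diagonal_part T (ind w) \<in> spanned (\<lambda>p. same_ends p w)"
  by (rule spannedI) (use spannedD[OF linear_mapD(1)[OF diagonal_part_linear[OF assms(1)] ind_V[OF assms(2)]]]
      diagonal_part_ind[OF assms(2), of T] in \<open>auto split: if_splits\<close>)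

lemma diagonal_part_unipotent:
  assumes "linear_map T" "unipotent T"
  shows "unipotent (diagonal_part T)"
  unfolding unipotent_def
proof (intro ballI spannedI)
  fix w p assume w: "w \<in> B" and nz: "(diagonal_part T (ind w) - ind w) p \<noteq> 0"
  hence "(T (ind w) - ind w) p \<noteq> 0"
    by (auto simp: fun_apply diagonal_part_ind ind_apply split: if_splits)
  thus "p \<in> B \<and> plength w < plength p"
    using assms(2) w spannedD unfolding unipotent_def by blast
qed

lemma basis_cases:
  assumes "w \<in> B"
  obtains v where "v \<in> verts Q" "w = stat v" | "1 \<le> plength w"
  using assms plength_0_iff[of w] psource_verts[OF assms] by (cases "plength w = 0") auto

text \<open>
  The paths that a derivation of type II may have in the image of \<open>a\<close>. The condition on the
  first arrow in \<open>delta_pair\<close> does not appear because left maximality implies it.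
\<close>

definition type_II_support :: "'b \<Rightarrow> ('a, 'b) qpath \<Rightarrow> bool" where
  "type_II_support a p \<longleftrightarrow> 2 \<le> plength p \<and> lmax p \<and> (rmax p \<or> last_arrow Q p = arrow Q a) \<and>
    psource p = tail Q a \<and> ptarget Q p = head Q a"

context
  fixes T :: "(('a, 'b) qpath \<Rightarrow> 'k::field) \<Rightarrow> ('a, 'b) qpath \<Rightarrow> 'k"
  assumes T: "algebra_endo T" "unipotent T" "no_bad_coefficients T"
begin

abbreviation "\<rho> \<equiv> diagonal_part T"

abbreviation splits :: "('a, 'b) qpath \<Rightarrow> bool" where
  "splits w \<equiv> T (ind w) - \<rho> (ind w) \<in> spanned (residual w)"

lemma linear_T: "linear_map T"
  using algebra_endoD(1)[OF T(1)] .

lemma arrow_splits: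
  assumes "a \<in> arcs Q"
  shows "splits (arrow Q a)"
proof (rule spannedI)
  fix p assume nz: "(T (ind (arrow Q a)) - \<rho> (ind (arrow Q a))) p \<noteq> 0"
  hence "T (ind (arrow Q a)) p \<noteq> 0" "\<not> same_ends p (arrow Q a)"
    using assms by (auto simp: fun_apply diagonal_part_ind B_arrow split: if_splits)
  moreover from this have "p \<in> B" "p \<noteq> arrow Q a"
    using spannedD[OF linear_mapD(1)[OF linear_T ind_V[OF B_arrow[OF assms]]]] by auto
  ultimately show "p \<in> B \<and> residual (arrow Q a) p"
    using support_of_arrow_image[OF T assms, of p]
    by (auto simp: same_ends_def first_arrow_def[of Q "arrow Q a"] last_arrow_def[of Q "arrow Q a"])
qed

text \<open>
  Write \<open>m(u)\<close> for \<open>T(u) - \<rho>(u)\<close>. In \<open>T(u)T(w)\<close> all terms with \<open>m(w)\<close> vanish, because \<open>m(w)\<close> is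
  annihilated from the left. What remains is \<open>\<rho>(u)\<rho>(w)\<close>, supported on paths that start like \<open>u\<close>
  and end like \<open>w\<close>, and \<open>m(u)\<rho>(w)\<close>, whose paths end like \<open>w\<close> but do not start like \<open>u\<close>: the right
  maximal paths in \<open>m(u)\<close> cannot be continued, and the others end like \<open>u\<close> without having both its
  ends. The supports being disjoint, \<open>\<rho>\<close> is multiplicative on \<open>u\<close> and \<open>w\<close> even if \<open>uw\<close> is zero.
\<close>

lemma product_splits:
  assumes u: "u \<in> B" "1 \<le> plength u" "splits u" and w: "w \<in> B" "1 \<le> plength w" "splits w"
  shows "\<rho> (ind u \<star> ind w) = \<rho> (ind u) \<star> \<rho> (ind w)"
    and "ptarget Q u = psource w \<Longrightarrow> pconcat u w \<in> B \<Longrightarrow> splits (pconcat u w)"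
proof -
  let ?m = "\<lambda>w. T (ind w) - \<rho> (ind w)"
  let ?F = "\<lambda>p. first_arrow Q p = first_arrow Q u \<and> last_arrow Q p = last_arrow Q w"
  let ?R = "\<lambda>p. 2 \<le> plength p \<and> lmax p \<and> first_arrow Q p \<noteq> first_arrow Q u \<and> last_arrow Q p = last_arrow Q w"
  have ne: "snd u \<noteq> []" "snd w \<noteq> []"
    using u(2) w(2) by (auto simp: plength_def)
  have Tu: "T (ind u) \<in> deg 1"
    using unipotent_deg[OF linear_T T(2) ind_spanned[OF u(1)]] u(2) by simp
  have \<rho>deg: "\<rho> (ind x) \<in> deg 1" if "x \<in> B" "1 \<le> plength x" for x
    using unipotent_deg[OF diagonal_part_linear[OF linear_T] diagonal_part_unipotent[OF linear_T T(2)]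
        ind_spanned[OF that(1)]] that(2) by simp
  have \<rho>ends: "\<rho> (ind x) \<in> spanned (\<lambda>p. 1 \<le> plength p \<and> same_ends p x)" if "x \<in> B" "1 \<le> plength x" for x
    using spanned_conj[OF \<rho>deg[OF that] diagonal_part_spanned[OF linear_T that(1)]] .
  have mw: "?m w \<in> spanned left_annihilated"
    using w(3) by (rule spanned_mono) auto
  have "T (ind u) \<star> T (ind w) = T (ind u) \<star> \<rho> (ind w) + T (ind u) \<star> ?m w"
    by (simp add: conv_bilinear)
  also have "\<dots> = \<rho> (ind u) \<star> \<rho> (ind w) + ?m u \<star> \<rho> (ind w)"
    using deg1_conv_left_annihilated[OF Tu mw] by (simp add: conv_bilinear)
  finally have prod: "T (ind u) \<star> T (ind w) = \<rho> (ind u) \<star> \<rho> (ind w) + ?m u \<star> \<rho> (ind w)" .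
  have F: "\<rho> (ind u) \<star> \<rho> (ind w) \<in> spanned ?F"
  proof (rule conv_spanned[OF \<rho>ends[OF u(1,2)] \<rho>ends[OF w(1,2)]])
    fix x y assume xy: "1 \<le> plength x \<and> same_ends x u" "1 \<le> plength y \<and> same_ends y w"
    hence "snd x \<noteq> []" "snd y \<noteq> []" by (auto simp: plength_def)
    thus "?F (pconcat x y)"
      using xy by (simp add: same_ends_def first_arrow_pconcat last_arrow_pconcat)
  qed
  have R: "?m u \<star> \<rho> (ind w) \<in> spanned ?R"
  proof (rule conv_spanned[OF u(3) \<rho>ends[OF w(1,2)]])
    fix x y assume xy: "x \<in> B" "y \<in> B" "residual u x" "1 \<le> plength y \<and> same_ends y w"
      "ptarget Q x = psource y" "pconcat x y \<in> B"
    have ne': "snd x \<noteq> []" "snd y \<noteq> []" using xy by (auto simp: plength_def)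
    have "\<not> rmax x"
      using right_maximal_no_extension[of x y] xy by blast
    thus "?R (pconcat x y)"
      using xy lmax_pconcat[of x y] first_arrow_pconcat[OF ne'(1), of y] last_arrow_pconcat[OF ne'(2), of x]
      by (auto simp: same_ends_def)
  qed
  have TT: "T (ind u) \<star> T (ind w) = T (ind u \<star> ind w)"
    using algebra_endoD(2)[OF T(1) ind_V[OF u(1)] ind_V[OF w(1)]] by simp
  have composable: "\<rho> (ind (pconcat u w)) = \<rho> (ind u) \<star> \<rho> (ind w) \<and> splits (pconcat u w)"
    if c: "ptarget Q u = psource w" "pconcat u w \<in> B"
  proof -
    have eq: "T (ind (pconcat u w)) = \<rho> (ind u) \<star> \<rho> (ind w) + ?m u \<star> \<rho> (ind w)"
      using prod TT c by (simp add: conv_ind)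
    have ends: "first_arrow Q (pconcat u w) = first_arrow Q u" "last_arrow Q (pconcat u w) = last_arrow Q w"
      using first_arrow_pconcat[OF ne(1)] last_arrow_pconcat[OF ne(2)] by auto
    have "\<rho> (ind (pconcat u w)) = \<rho> (ind u) \<star> \<rho> (ind w)"
      by (rule diagonal_part_eqI[of "pconcat u w" T, OF c(2) eq]) (rule spanned_mono[OF F] spanned_mono[OF R]; simp add: same_ends_def ends)+
    moreover from this have "T (ind (pconcat u w)) - \<rho> (ind (pconcat u w)) = ?m u \<star> \<rho> (ind w)"
      using eq by simp
    moreover have "?m u \<star> \<rho> (ind w) \<in> spanned (residual (pconcat u w))"
      by (rule spanned_mono[OF R]) (simp add: same_ends_def ends)
    ultimately show ?thesis by simp
  qed
  thus "ptarget Q u = psource w \<Longrightarrow> pconcat u w \<in> B \<Longrightarrow> splits (pconcat u w)" by blast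
  show "\<rho> (ind u \<star> ind w) = \<rho> (ind u) \<star> \<rho> (ind w)"
  proof (cases "ptarget Q u = psource w \<and> pconcat u w \<in> B")
    case True
    thus ?thesis using composable by (simp add: conv_ind)
  next
    case False
    hence zero: "ind u \<star> ind w = (0 :: _ \<Rightarrow> 'k)" by (auto simp: conv_ind)
    hence "\<rho> (ind u) \<star> \<rho> (ind w) + ?m u \<star> \<rho> (ind w) = 0"
      using prod TT linear_map_0[OF linear_T] by simp
    hence "\<rho> (ind u) \<star> \<rho> (ind w) = 0"
      by (rule spanned_disjoint(1)[OF F R]) auto
    thus ?thesis using zero linear_map_0[OF diagonal_part_linear[OF linear_T]] by simp
  qed
qed

lemma all_split: "w \<in> B \<Longrightarrow> 1 \<le> plength w \<Longrightarrow> splits w"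
proof (induction "plength w" arbitrary: w rule: less_induct)
  case less
  obtain a v where a: "a \<in> arcs Q" "v \<in> B" "w = pconcat (arrow Q a) v"
      "ptarget Q (arrow Q a) = psource v" "plength w = Suc (plength v)"
    by (rule basis_Cons[OF less.prems])
  show ?case
  proof (cases "plength v = 0")
    case True
    hence "w = arrow Q a"
      using a(3) pconcat_length_0 by simp
    thus ?thesis using arrow_splits[OF a(1)] by simp
  next
    case False
    thus ?thesis
      using product_splits(2)[OF B_arrow[OF a(1)] _ arrow_splits[OF a(1)] a(2)] less.hyps[of v] less.prems(1) a
      by simp
  qed
qed

lemma diagonal_part_stat:
  assumes "v \<in> verts Q"
  shows "\<rho> (ind (stat v)) = ind (stat v)"
proof
  fix p show "\<rho> (ind (stat v)) p = ind (stat v) p"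
    using algebra_endoD(3)[OF T(1) assms] diagonal_part_ind[OF B_stat[OF assms], of T p]
    by (cases "p = stat v") (simp_all add: ind_apply)
qed

lemma diagonal_part_endo: "algebra_endo \<rho>"
proof -
  have V: "\<rho> (ind w) \<in> V" if "w \<in> B" for w
    using linear_mapD(1)[OF diagonal_part_linear[OF linear_T] ind_V[OF that]] .
  have par: "\<rho> (ind w) \<in> spanned (\<lambda>p. psource p = psource w \<and> ptarget Q p = ptarget Q w)" if "w \<in> B" for w
    using spannedD[OF algebra_endo_parallel[OF T(1) that]]
    by (intro spannedI) (auto simp: diagonal_part_ind[OF that] split: if_splits)
  have left: "ind (stat v) \<star> \<rho> (ind w) = (if psource w = v then \<rho> (ind w) else 0)" if "w \<in> B" for v w
    using spannedD[OF par[OF that]] conv_stat_left[OF V[OF that]] by (fastforce simp: fun_eq_iff fun_apply)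
  have right: "\<rho> (ind w) \<star> ind (stat v) = (if ptarget Q w = v then \<rho> (ind w) else 0)" if "w \<in> B" for v w
    using spannedD[OF par[OF that]] conv_stat_right[OF V[OF that]] by (fastforce simp: fun_eq_iff fun_apply)
  note \<rho>0 = linear_map_0[OF diagonal_part_linear[OF linear_T]]
  have "\<rho> (ind u \<star> ind w) = \<rho> (ind u) \<star> \<rho> (ind w)" if u: "u \<in> B" and w: "w \<in> B" for u w
  proof (cases rule: basis_cases[OF u])
    case (1 v)
    thus ?thesis
      using left[OF w, of v] diagonal_part_stat[of v] \<rho>0 w by (auto simp: conv_ind pconcat_stat_left)
  next
    case 2
    show ?thesis
    proof (cases rule: basis_cases[OF w])
      case (1 v)
      thus ?thesis
        using right[OF u, of v] diagonal_part_stat[of v] \<rho>0 u by (auto simp: conv_ind pconcat_stat_right)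
    next
      case w2: 2
      thus ?thesis using product_splits(1)[OF u 2 all_split[OF u 2] w w2 all_split[OF w w2]] by blast
    qed
  qed
  hence "\<rho> (f \<star> g) = \<rho> f \<star> \<rho> g" if "f \<in> V" "g \<in> V" for f g
    using multiplicativeI[OF diagonal_part_linear[OF linear_T] that] by blast
  thus ?thesis
    using diagonal_part_linear[OF linear_T] diagonal_part_stat unfolding algebra_endo_def by blast
qed

section \<open>The derivation\<close>

lemma difference_left_annihilated: "f \<in> V \<Longrightarrow> T f - \<rho> f \<in> spanned left_annihilated"
proof (erule linear_map_spanned[OF linear_map_sub[OF linear_T diagonal_part_linear[OF linear_T]]])
  fix w assume w: "w \<in> B"
  show "T (ind w) - \<rho> (ind w) \<in> spanned left_annihilated"
  proof (cases rule: basis_cases[OF w])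
    case (1 v)
    thus ?thesis using algebra_endoD(3)[OF T(1)] diagonal_part_stat by simp
  next
    case 2
    show ?thesis using all_split[OF w 2] by (rule spanned_mono) simp
  qed
qed

text \<open>
  With \<open>\<delta> = T\<rho>\<^sup>-\<^sup>1 - 1\<close> one has \<open>\<delta>(xy) = \<delta>(x)y + x\<delta>(y) + \<delta>(x)\<delta>(y)\<close>, and the last product is
  zero since \<open>\<delta>(y)\<close> is spanned by left maximal paths and \<open>\<delta>(x)\<close> has positive degree.
\<close>

lemma exponential_factor:
  obtains \<delta> where "linear_map \<delta>"
    and "\<And>f g. f \<in> V \<Longrightarrow> g \<in> V \<Longrightarrow> \<delta> (f \<star> g) = \<delta> f \<star> g + f \<star> \<delta> g"
    and "\<And>v. v \<in> verts Q \<Longrightarrow> \<delta> (ind (stat v)) = 0"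
    and "\<And>a. a \<in> arcs Q \<Longrightarrow> \<delta> (ind (arrow Q a)) \<in> spanned (type_II_support a)"
    and "\<And>f. f \<in> V \<Longrightarrow> \<delta> (\<delta> f) = 0"
    and "\<And>f. f \<in> V \<Longrightarrow> T f = \<rho> f + \<delta> (\<rho> f)"
proof -
  note \<rho>lin = diagonal_part_linear[OF linear_T] and \<rho>uni = diagonal_part_unipotent[OF linear_T T(2)]
  obtain \<sigma> where \<sigma>: "algebra_endo \<sigma>" and inv: "\<And>f. f \<in> V \<Longrightarrow> \<rho> (\<sigma> f) = f" "\<And>f. f \<in> V \<Longrightarrow> \<sigma> (\<rho> f) = f"
    using unipotent_inverse[OF diagonal_part_endo \<rho>uni] by blast
  note \<sigma>V = linear_mapD(1)[OF algebra_endoD(1)[OF \<sigma>]]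
  define \<chi> where "\<chi> f = T (\<sigma> f)" for f
  have \<chi>: "algebra_endo \<chi>"
    unfolding \<chi>_def using algebra_endo_comp[OF T(1) \<sigma>] .
  note \<chi>lin = algebra_endoD(1)[OF \<chi>]
  define \<delta> where "\<delta> f = \<chi> f - f" for f
  have lin: "linear_map \<delta>"
    unfolding \<delta>_def using linear_map_sub_id[OF \<chi>lin] .
  have \<delta>_diff: "\<delta> f = T (\<sigma> f) - \<rho> (\<sigma> f)" if "f \<in> V" for f
    using inv(1)[OF that] by (simp add: \<delta>_def \<chi>_def)
  have left_ann: "\<delta> f \<in> spanned left_annihilated" if "f \<in> V" for f
    using difference_left_annihilated[OF \<sigma>V[OF that]] \<delta>_diff[OF that] by simp
  have kill: "f \<star> \<delta> g = 0" if "f \<in> deg 1" "g \<in> V" for f g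
    using deg1_conv_left_annihilated[OF that(1) left_ann[OF that(2)]] .
  have der: "\<delta> (f \<star> g) = \<delta> f \<star> g + f \<star> \<delta> g" if "f \<in> V" "g \<in> V" for f g
  proof -
    have "\<delta> f \<in> deg 1" using left_ann[OF that(1)] by (rule spanned_mono) simp
    hence "\<delta> f \<star> \<delta> g = 0" using kill that(2) by blast
    moreover have "\<chi> (f \<star> g) = (f + \<delta> f) \<star> (g + \<delta> g)"
      using algebra_endoD(2)[OF \<chi> that] by (simp add: \<delta>_def)
    ultimately show ?thesis by (simp add: \<delta>_def[of "f \<star> g"] conv_bilinear)
  qed
  have arr: "\<delta> (ind (arrow Q a)) \<in> spanned (type_II_support a)" if a: "a \<in> arcs Q" for a
  proof -
    let ?A = "ind (arrow Q a) :: ('a, 'b) qpath \<Rightarrow> 'k"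
    let ?P = "\<lambda>p. same_ends p (arrow Q a)"
    have "\<rho> f \<in> spanned ?P" if "f \<in> spanned ?P" for f
      using that by (rule linear_map_spanned[OF \<rho>lin])
        (rule spanned_mono[OF diagonal_part_spanned[OF linear_T]], auto intro: same_ends_trans)
    \<comment> \<open>The inverse of \<open>\<rho>\<close> sends \<open>a\<close> to a combination of paths that start and end in \<open>a\<close>.\<close>
    then obtain f where f: "f \<in> spanned ?P" "\<rho> f = ?A"
      using unipotent_surj[OF \<rho>lin \<rho>uni ind_spanned[OF B_arrow[OF a], of ?P]] by auto
    have fA: "\<sigma> ?A = f"
      using f inv(2)[OF spanned_V[OF f(1)]] by simp
    have "T f - \<rho> f \<in> spanned (\<lambda>p. 2 \<le> plength p \<and> lmax p \<and> (rmax p \<or> last_arrow Q p = arrow Q a))"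
    proof (rule linear_map_spanned[OF linear_map_sub[OF linear_T \<rho>lin] f(1)])
      fix w assume w: "w \<in> B" "same_ends w (arrow Q a)"
      hence "last_arrow Q w = arrow Q a" "w \<noteq> stat v" for v
        by (auto simp: same_ends_def last_arrow_def arrow_def stat_def)
      moreover from this have "1 \<le> plength w"
        using plength_0_iff[of w] by (cases "plength w") auto
      ultimately show "T (ind w) - \<rho> (ind w) \<in>
          spanned (\<lambda>p. 2 \<le> plength p \<and> lmax p \<and> (rmax p \<or> last_arrow Q p = arrow Q a))"
        using spanned_mono[OF all_split[OF w(1)]] by auto
    qed
    hence ends: "\<delta> ?A \<in> spanned (\<lambda>p. 2 \<le> plength p \<and> lmax p \<and> (rmax p \<or> last_arrow Q p = arrow Q a))"
      using \<delta>_diff[OF ind_V[OF B_arrow[OF a]]] fA by simp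
    have par: "\<delta> ?A \<in> spanned (\<lambda>p. psource p = tail Q a \<and> ptarget Q p = head Q a)"
      unfolding \<delta>_def using algebra_endo_parallel[OF \<chi> B_arrow[OF a]] B_arrow[OF a]
      by (intro spanned_diff ind_spanned) auto
    show ?thesis
      using spanned_conj[OF ends par] by (rule spanned_mono) (simp add: type_II_support_def)
  qed
  \<comment> \<open>For \<open>p = bw\<close> left maximal, \<open>\<delta>(p) = \<delta>(b)w\<close>. A path in \<open>\<delta>(b)\<close> is right maximal or of the form \<open>rb\<close> with \<open>r\<close> of positive length, and \<open>rbw = rp\<close> is zero.\<close>
  have "\<delta> (\<delta> f) \<in> spanned (\<lambda>_. False)" if "f \<in> V" for f
  proof (rule linear_map_spanned[OF lin left_ann[OF that]])
    fix p assume p: "p \<in> B" "left_annihilated p"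
    have "1 \<le> plength p" using p(2) by simp
    then obtain b w where b: "b \<in> arcs Q" "w \<in> B" "p = pconcat (arrow Q b) w"
        "ptarget Q (arrow Q b) = psource w" "plength p = Suc (plength w)"
      by (rule basis_Cons[OF p(1)])
    have "ind p = ind (arrow Q b) \<star> (ind w :: _ \<Rightarrow> 'k)"
      using b p(1) by (simp add: conv_ind)
    hence "\<delta> (ind p) = \<delta> (ind (arrow Q b)) \<star> ind w"
      using der[of "ind (arrow Q b)" "ind w"] kill[OF arrow_deg[OF b(1)]] b by (simp add: ind_V B_arrow)
    moreover have "\<delta> (ind (arrow Q b)) \<star> ind w = 0"
    proof (rule conv_eq_0[OF arr[OF b(1)] ind_spanned[OF b(2), of "\<lambda>x. x = w"]])
      fix q x assume q: "q \<in> B" "x \<in> B" "type_II_support b q" "x = w" "ptarget Q q = psource x"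
      have len: "1 \<le> plength w" using b(5) p(2) by simp
      show "pconcat q x \<notin> B"
      proof (cases "rmax q")
        case True
        thus ?thesis using right_maximal_no_extension[of q x] q len by blast
      next
        case False
        hence last: "last_arrow Q q = arrow Q b" "2 \<le> plength q"
          using q(3) by (auto simp: type_II_support_def)
        obtain r where r: "r \<in> B" "q = pconcat r (arrow Q b)" "ptarget Q r = tail Q b" "plength q = Suc (plength r)"
          by (rule last_arrow_split[OF q(1) last(1)])
        have "pconcat q x = pconcat r p"
          using b(3) q(4) r(2) by (simp add: pconcat_assoc)
        moreover have "ptarget Q r = psource p"
          using r(3) b(3) by simp
        ultimately show ?thesis
          using left_maximal_no_extension[of p r] p(2) r(1,4) last(2) by simp
      qed
    qed simp
    ultimately show "\<delta> (ind p) \<in> spanned (\<lambda>_. False)" by simp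
  qed
  hence sq: "\<delta> (\<delta> f) = 0" if "f \<in> V" for f
    using spanned_False that by blast
  have "T f = \<rho> f + \<delta> (\<rho> f)" if "f \<in> V" for f
    using inv(2)[OF that] by (simp add: \<delta>_def \<chi>_def)
  moreover have "\<delta> (ind (stat v)) = 0" if "v \<in> verts Q" for v
    using algebra_endoD(3)[OF \<chi> that] by (simp add: \<delta>_def)
  ultimately show ?thesis using that lin der arr sq by blast
qed

end

end

section \<open>The path algebra and its monomial ideals\<close>

text \<open>
  The product of the path algebra as a convolution. A pair of paths contributes to the
  coefficient of \<open>r\<close> exactly when it is one of the cuts of \<open>r\<close>.
\<close>

lemma lookup_path_mult:
  "Poly_Mapping.lookup (path_mult Q f g) r =
    (\<Sum>i\<le>plength r. Poly_Mapping.lookup f (path_take i r) * Poly_Mapping.lookup g (path_drop Q i r))"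
proof -
  let ?f = "Poly_Mapping.lookup f" and ?g = "Poly_Mapping.lookup g"
  let ?S = "(\<lambda>i. (path_take i r, path_drop Q i r)) ` {..plength r}"
  have inj: "inj_on (\<lambda>i. (path_take i r, path_drop Q i r)) {..plength r}"
    by (rule inj_onI) (metis Pair_inject atMost_iff plength_path_take)
  have "Poly_Mapping.lookup (path_mult Q f g) r =
      (\<Sum>(p, q)\<in>Poly_Mapping.keys f \<times> Poly_Mapping.keys g.
        if ptarget Q p = psource q \<and> pconcat p q = r then ?f p * ?g q else 0)"
    unfolding path_mult_def lookup_sum sum.cartesian_product
    by (intro sum.cong) (auto simp: lookup_single when_def)
  also have "\<dots> = (\<Sum>(p, q)\<in>?S. ?f p * ?g q)"
  proof (rule sum.mono_neutral_cong)
    fix x assume "x \<in> ?S - Poly_Mapping.keys f \<times> Poly_Mapping.keys g"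
    thus "(case x of (p, q) \<Rightarrow> ?f p * ?g q) = 0"
      by (auto simp: in_keys_iff)
  next
    fix x assume x: "x \<in> Poly_Mapping.keys f \<times> Poly_Mapping.keys g - ?S"
    obtain p q where pq: "x = (p, q)" by (cases x)
    have "\<not> (ptarget Q p = psource q \<and> pconcat p q = r)"
    proof
      assume *: "ptarget Q p = psource q \<and> pconcat p q = r"
      hence "(p, q) = (path_take (plength p) r, path_drop Q (plength p) r)"
        using take_pconcat[of p q] drop_pconcat[of Q p q] by simp
      moreover have "plength p \<le> plength r" using * by auto
      ultimately show False using x pq by blast
    qed
    thus "(case x of (p, q) \<Rightarrow> if ptarget Q p = psource q \<and> pconcat p q = r then ?f p * ?g q else 0) = 0"
      using pq by auto
  next
    fix x assume "x \<in> Poly_Mapping.keys f \<times> Poly_Mapping.keys g \<inter> ?S"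
    then obtain i where "x = (path_take i r, path_drop Q i r)" by blast
    thus "(case x of (p, q) \<Rightarrow> if ptarget Q p = psource q \<and> pconcat p q = r then ?f p * ?g q else 0) =
        (case x of (p, q) \<Rightarrow> ?f p * ?g q)"
      by (simp add: ptarget_take pconcat_take_drop)
  qed auto
  also have "\<dots> = (\<Sum>i\<le>plength r. ?f (path_take i r) * ?g (path_drop Q i r))"
    by (subst sum.reindex[OF inj]) simp
  finally show ?thesis .
qed

lemma path_mult_keysD:
  assumes "r \<in> Poly_Mapping.keys (path_mult Q f g)"
  obtains i where "i \<le> plength r" "path_take i r \<in> Poly_Mapping.keys f" "path_drop Q i r \<in> Poly_Mapping.keys g"
proof -
  have "(\<Sum>i\<le>plength r. Poly_Mapping.lookup f (path_take i r) * Poly_Mapping.lookup g (path_drop Q i r)) \<noteq> 0"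
    using assms by (simp add: in_keys_iff lookup_path_mult)
  then obtain i where "i \<le> plength r"
      "Poly_Mapping.lookup f (path_take i r) * Poly_Mapping.lookup g (path_drop Q i r) \<noteq> 0"
    by (meson atMost_iff sum.neutral)
  thus ?thesis using that[of i] by (simp add: in_keys_iff)
qed

lemma path_mult_single:
  "ptarget Q p = psource q \<Longrightarrow> path_mult Q (Poly_Mapping.single p c) (Poly_Mapping.single q d) =
    Poly_Mapping.single (pconcat p q) (c * d)"
  by (cases "c = 0"; cases "d = 0") (simp_all add: path_mult_def)

lemma sum_singles: "(\<Sum>p\<in>Poly_Mapping.keys f. Poly_Mapping.single p (Poly_Mapping.lookup f p)) = f"
  by (rule poly_mapping_eqI)
    (auto simp: lookup_sum lookup_single when_def in_keys_iff sum.delta)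

lemma path_algebra_simps [simp]:
  "carrier (path_algebra Q) = {f. Poly_Mapping.keys f \<subseteq> paths Q}"
  "monoid.mult (path_algebra Q) = path_mult Q"
  "one (path_algebra Q) = (\<Sum>v\<in>verts Q. Poly_Mapping.single (stat v) 1)"
  "zero (path_algebra Q) = 0"
  "add (path_algebra Q) = (+)"
  "smult (path_algebra Q) c = Poly_Mapping.map ((*) c)"
  by (simp_all add: path_algebra_def)

lemma lookup_smult [simp]: "Poly_Mapping.lookup (Poly_Mapping.map ((*) c) f) p = (c * Poly_Mapping.lookup f p :: 'k::field)"
  by (simp add: Poly_Mapping.map.rep_eq when_def)

lemma path_elt_mult: "ptarget Q p = psource q \<Longrightarrow> path_mult Q (path_elt p) (path_elt q) = path_elt (pconcat p q)"
  by (simp add: path_elt_def path_mult_single)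

lemma keys_path_elt [simp]: "Poly_Mapping.keys (path_elt p :: _ \<Rightarrow>\<^sub>0 'k::field) = {p}"
  by (simp add: path_elt_def)

context string_algebra
begin

abbreviation P :: "('k, ('v, 'e) qpath \<Rightarrow>\<^sub>0 'k) module" where "P \<equiv> path_algebra Q"

lemma ideal_I: "ideal I P"
  using admissible by (simp add: admissible_def)

lemma ring_P: "ring P"
  using ideal.axioms(2)[OF ideal_I] .

lemma path_algebra_idealI:
  assumes "J \<subseteq> carrier P" "0 \<in> J" "\<And>f. f \<in> J \<Longrightarrow> - f \<in> J" "\<And>f g. f \<in> J \<Longrightarrow> g \<in> J \<Longrightarrow> f + g \<in> J"
    and "\<And>f x. f \<in> J \<Longrightarrow> x \<in> carrier P \<Longrightarrow> path_mult Q x f \<in> J"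
    and "\<And>f x. f \<in> J \<Longrightarrow> x \<in> carrier P \<Longrightarrow> path_mult Q f x \<in> J"
  shows "ideal J P"
proof -
  interpret P: ring P by (rule ring_P)
  have "\<ominus>\<^bsub>P\<^esub> f = - f" if "f \<in> J" for f
    using that assms(1) by (intro P.minus_equality) auto
  hence "subgroup J (add_monoid P)"
    using assms by (intro P.add.subgroupI) (auto simp: a_inv_def)
  thus ?thesis
    using assms by (intro idealI ring_P) auto
qed

abbreviation vanishing_path :: "('v, 'e) qpath \<Rightarrow> bool" where
  "vanishing_path p \<equiv> path_elt p \<in> I"

lemma vanishing_pconcat:
  assumes "p \<in> paths Q" "q \<in> paths Q" "ptarget Q p = psource q" "vanishing_path p \<or> vanishing_path q"
  shows "vanishing_path (pconcat p q)"
proof -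
  have "path_elt p \<in> carrier P" "path_elt q \<in> carrier P"
    using assms by simp_all
  hence "path_mult Q (path_elt p) (path_elt q) \<in> I"
    using assms(4) ideal.I_l_closed[OF ideal_I] ideal.I_r_closed[OF ideal_I]
    by (auto simp del: path_algebra_simps(1))
  thus ?thesis using path_elt_mult[OF assms(3)] by metis
qed

text \<open>
  The elements all of whose paths lie in \<open>I\<close> form an ideal that contains the generating paths,
  hence contains \<open>I\<close>.
\<close>

lemma ideal_monomial:
  assumes "f \<in> I" "p \<in> Poly_Mapping.keys f"
  shows "vanishing_path p"
proof -
  let ?J = "{f \<in> carrier P. \<forall>p\<in>Poly_Mapping.keys f. vanishing_path p}"
  obtain S where S: "S \<subseteq> paths Q" "I = Idl\<^bsub>P\<^esub> (path_elt ` S)"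
    using generated_by_paths by blast
  have "ideal ?J P"
  proof (rule path_algebra_idealI)
    fix f x assume f: "f \<in> ?J" and x: "x \<in> carrier P"
    have "r \<in> paths Q \<and> vanishing_path r" if r: "r \<in> Poly_Mapping.keys (path_mult Q x f)" for r
    proof -
      obtain i where i: "path_take i r \<in> Poly_Mapping.keys x" "path_drop Q i r \<in> Poly_Mapping.keys f"
        using path_mult_keysD[OF r] by metis
      thus ?thesis
        using f x vanishing_pconcat[of "path_take i r" "path_drop Q i r"]
          pconcat_paths_iff[of "path_take i r" "path_drop Q i r"]
        by (auto simp: ptarget_take pconcat_take_drop)
    qed
    thus "path_mult Q x f \<in> ?J" by auto
    have "r \<in> paths Q \<and> vanishing_path r" if r: "r \<in> Poly_Mapping.keys (path_mult Q f x)" for r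
    proof -
      obtain i where i: "path_take i r \<in> Poly_Mapping.keys f" "path_drop Q i r \<in> Poly_Mapping.keys x"
        using path_mult_keysD[OF r] by metis
      thus ?thesis
        using f x vanishing_pconcat[of "path_take i r" "path_drop Q i r"]
          pconcat_paths_iff[of "path_take i r" "path_drop Q i r"]
        by (auto simp: ptarget_take pconcat_take_drop)
    qed
    thus "path_mult Q f x \<in> ?J" by auto
  next
    fix f g assume "f \<in> ?J" "g \<in> ?J"
    thus "f + g \<in> ?J" using keys_add[of f g] by fastforce
  qed auto
  moreover have "path_elt ` S \<subseteq> ?J"
  proof -
    have "path_elt ` S \<subseteq> carrier P" using S(1) by auto
    hence "path_elt ` S \<subseteq> I"
      unfolding S(2) by (rule ring.genideal_self[OF ring_P])
    thus ?thesis using S(1) by auto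
  qed
  ultimately have "Idl\<^bsub>P\<^esub> (path_elt ` S) \<subseteq> ?J"
    by (rule ring.genideal_minimal[OF ring_P])
  thus ?thesis using assms S(2) by blast
qed

lemma ideal_scaled:
  assumes "p \<in> paths Q" "vanishing_path p"
  shows "Poly_Mapping.single p c \<in> I"
proof -
  have "Poly_Mapping.single (stat (psource p)) c \<in> carrier P"
    using stat_paths paths_verts(1)[OF assms(1)] by simp
  hence "path_mult Q (Poly_Mapping.single (stat (psource p)) c) (path_elt p) \<in> I"
    using ideal.I_l_closed[OF ideal_I assms(2)] by (simp del: path_algebra_simps(1))
  thus ?thesis
    by (simp add: path_elt_def path_mult_single pconcat_stat_left)
qed

lemma I_iff: "f \<in> I \<longleftrightarrow> f \<in> carrier P \<and> (\<forall>p\<in>Poly_Mapping.keys f. vanishing_path p)"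
proof (intro iffI conjI ballI)
  assume "f \<in> I"
  thus "f \<in> carrier P" using ideal.Icarr[OF ideal_I] by blast
  show "vanishing_path p" if "p \<in> Poly_Mapping.keys f" for p
    using ideal_monomial \<open>f \<in> I\<close> that by blast
next
  assume f: "f \<in> carrier P \<and> (\<forall>p\<in>Poly_Mapping.keys f. vanishing_path p)"
  have add: "x + y \<in> I" if "x \<in> I" "y \<in> I" for x y
    using additive_subgroup.a_closed[OF ideal.axioms(1)[OF ideal_I] that] by simp
  have "0 \<in> I"
    using additive_subgroup.zero_closed[OF ideal.axioms(1)[OF ideal_I]] by simp
  hence "(\<Sum>p\<in>X. Poly_Mapping.single p (Poly_Mapping.lookup f p)) \<in> I" if "X \<subseteq> Poly_Mapping.keys f" for X
    using that
  proof (induction X rule: infinite_finite_induct)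
    case (insert p X)
    thus ?case using add[of "Poly_Mapping.single p _"] ideal_scaled[of p] f by auto
  qed auto
  from this[OF order_refl] show "f \<in> I" by (simp only: sum_singles)
qed

abbreviation long :: "nat \<Rightarrow> (('v, 'e) qpath \<Rightarrow>\<^sub>0 'k) set" where
  "long n \<equiv> {f \<in> carrier P. \<forall>p\<in>Poly_Mapping.keys f. n \<le> plength p}"

lemma long_mult:
  assumes "f \<in> long m" "g \<in> long n"
  shows "path_mult Q f g \<in> long (m + n)"
proof -
  have "r \<in> paths Q \<and> m + n \<le> plength r" if r: "r \<in> Poly_Mapping.keys (path_mult Q f g)" for r
  proof -
    obtain i where i: "i \<le> plength r" "path_take i r \<in> Poly_Mapping.keys f" "path_drop Q i r \<in> Poly_Mapping.keys g"
      using path_mult_keysD[OF r] by metis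
    have "m \<le> i" "n \<le> plength r - i"
      using i assms plength_path_take[OF i(1)] plength_path_drop[of Q i r] by auto
    moreover have "r \<in> paths Q"
      using i assms pconcat_paths_iff[of "path_take i r" "path_drop Q i r"]
      by (auto simp: ptarget_take pconcat_take_drop)
    ultimately show ?thesis using i(1) by simp
  qed
  thus ?thesis by auto
qed

lemma long_add: "f \<in> long n \<Longrightarrow> g \<in> long n \<Longrightarrow> f + g \<in> long n"
  using keys_add[of f g] by fastforce

lemma ideal_long: "ideal (long n) P"
proof (rule path_algebra_idealI)
  fix f x assume f: "f \<in> long n" and "x \<in> carrier P"
  hence x: "x \<in> long 0" by simp
  show "path_mult Q x f \<in> long n" using long_mult[OF x f] by (simp only: add_0_left)
  show "path_mult Q f x \<in> long n" using long_mult[OF f x] by (simp only: add_0_right)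
next
  show "f + g \<in> long n" if "f \<in> long n" "g \<in> long n" for f g
    using that by (rule long_add)
qed auto

lemma ideal_prod_long:
  assumes "X \<subseteq> long m" "Y \<subseteq> long n"
  shows "X \<cdot>\<^bsub>P\<^esub> Y \<subseteq> long (m + n)"
proof
  fix z assume "z \<in> X \<cdot>\<^bsub>P\<^esub> Y"
  thus "z \<in> long (m + n)"
  proof induction
    case (prod i j)
    have "path_mult Q i j \<in> long (m + n)"
      using prod assms by (intro long_mult) blast+
    thus ?case by (simp only: path_algebra_simps)
  next
    case (sum s t)
    show ?case using long_add[OF sum.IH] by (simp only: path_algebra_simps)
  qed
qed

lemma arrow_ideal_long: "arrow_ideal Q \<subseteq> (long 1 :: (_ \<Rightarrow>\<^sub>0 'k) set)"
  unfolding arrow_ideal_def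
  by (rule ring.genideal_minimal[OF ring_P ideal_long]) (auto intro: arrow_paths)

lemma pow_0: "arrow_ideal Q [^]\<^bsub>ideals_set P\<^esub> (0::nat) = carrier P"
  and pow_Suc: "arrow_ideal Q [^]\<^bsub>ideals_set P\<^esub> Suc n = (arrow_ideal Q [^]\<^bsub>ideals_set P\<^esub> n) \<cdot>\<^bsub>P\<^esub> arrow_ideal Q"
  by (simp_all add: nat_pow_def ideals_set_def)

text \<open>
  Elements of the square of the arrow ideal only involve paths of length at least two, so that
  arrows and stationary paths are not in \<open>I\<close>.
\<close>

lemma I_long: "I \<subseteq> long 2"
proof -
  have "arrow_ideal Q [^]\<^bsub>ideals_set P\<^esub> n \<subseteq> long n" for n :: nat
  proof (induction n)
    case 0
    show ?case unfolding pow_0 by auto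
  next
    case (Suc n)
    show ?case
      unfolding pow_Suc using ideal_prod_long[OF Suc arrow_ideal_long] by (simp only: Suc_eq_plus1)
  qed
  thus ?thesis using admissible unfolding admissible_def by blast
qed

lemma path_elt_power:
  assumes "p \<in> paths Q" "plength p = n"
  shows "path_elt p \<in> arrow_ideal Q [^]\<^bsub>ideals_set P\<^esub> n"
  using assms
proof (induction n arbitrary: p)
  case 0
  thus ?case unfolding pow_0 by simp
next
  case (Suc n)
  let ?x = "path_drop Q n p"
  have take: "path_take n p \<in> paths Q" "plength (path_take n p) = n"
    using Suc.prems path_take_paths by (simp_all add: plength_path_take)
  have x: "?x \<in> paths Q" "length (snd ?x) = 1"
    using Suc.prems path_drop_paths plength_path_drop[of Q n p] by (simp_all add: plength_def)
  then obtain a where "snd ?x = [a]" by (metis One_nat_def length_0_conv length_Suc_conv)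
  hence xa: "?x = arrow Q a" "a \<in> arcs Q"
    using paths_source[OF x(1)] paths_arcs[OF x(1)] by (simp_all add: prod_eq_iff)
  have "(\<lambda>a. path_elt (arrow Q a)) ` arcs Q \<subseteq> carrier P"
    using arrow_paths by auto
  from ring.genideal_self[OF ring_P this]
  have "path_elt (arrow Q a) \<in> (arrow_ideal Q :: (_ \<Rightarrow>\<^sub>0 'k) set)"
    unfolding arrow_ideal_def using xa(2) by blast
  hence "path_mult Q (path_elt (path_take n p)) (path_elt ?x) \<in>
      (arrow_ideal Q [^]\<^bsub>ideals_set P\<^esub> n) \<cdot>\<^bsub>P\<^esub> arrow_ideal Q"
    using ideal_prod.prod[of "path_elt (path_take n p)" _ "path_elt ?x" _ P] Suc.IH[OF take] xa by simp
  thus ?case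
    unfolding pow_Suc by (simp add: path_elt_mult ptarget_take pconcat_take_drop)
qed

abbreviation B :: "('v, 'e) qpath set" where "B \<equiv> basis_paths Q I"

lemma B_iff: "p \<in> B \<longleftrightarrow> p \<in> paths Q \<and> \<not> vanishing_path p"
  by (simp add: basis_paths_def)

text \<open>
  A path of length \<open>m\<close> is a product of \<open>m\<close> arrows and thus lies in the \<open>m\<close>-th power of the arrow
  ideal.
\<close>

lemma basis_length_bound: "\<exists>m. \<forall>p\<in>B. plength p < m"
proof -
  obtain m where m: "arrow_ideal Q [^]\<^bsub>ideals_set P\<^esub> (m::nat) \<subseteq> I"
    using admissible unfolding admissible_def by blast
  have "plength p < m" if p: "p \<in> B" for p
  proof (rule ccontr)
    assume "\<not> plength p < m"
    hence "plength (path_take m p) = m" by (simp add: plength_path_take)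
    hence "vanishing_path (path_take m p)"
      using path_elt_power[of "path_take m p"] path_take_paths p m by (auto simp: B_iff)
    hence "vanishing_path p"
      using vanishing_pconcat[of "path_take m p" "path_drop Q m p"] p path_take_paths path_drop_paths
      by (simp add: B_iff ptarget_take pconcat_take_drop)
    thus False using p by (simp add: B_iff)
  qed
  thus ?thesis by blast
qed

lemma finite_basis: "finite B"
proof -
  obtain m where m: "\<And>p. p \<in> B \<Longrightarrow> plength p < m"
    using basis_length_bound by blast
  have "B \<subseteq> verts Q \<times> {es. set es \<subseteq> arcs Q \<and> length es \<le> m}"
  proof
    fix p assume p: "p \<in> B"
    have "plength p < m" "set (snd p) \<subseteq> arcs Q" "psource p \<in> verts Q"
      using m[OF p] p paths_arcs paths_verts(1) by (simp_all add: B_iff)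
    thus "p \<in> verts Q \<times> {es. set es \<subseteq> arcs Q \<and> length es \<le> m}"
      by (cases p) (simp add: plength_def psource_def)
  qed
  thus ?thesis
    by (rule finite_subset) (intro finite_cartesian_product finite_lists_length_le finite_verts finite_arcs)
qed

lemma short_basis: "p \<in> paths Q \<Longrightarrow> plength p < 2 \<Longrightarrow> p \<in> B"
  using I_long by (auto simp: B_iff)

lemma basis_arrows:
  "pconcat (arrow Q a) (arrow Q b) \<in> B \<Longrightarrow> a \<in> arcs Q \<and> b \<in> arcs Q \<and> head Q a = tail Q b"
  by (auto simp: B_iff paths_iff awalk_def)

end

sublocale string_algebra \<subseteq> string_basis Q B
proof
  show "p \<in> paths Q" if "p \<in> B" for p
    using that by (simp add: B_iff)
  show "finite B" by (rule finite_basis)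
  fix p i assume p: "p \<in> B"
  have "path_take i p \<in> paths Q" "path_drop Q i p \<in> paths Q"
    using p path_take_paths path_drop_paths by (simp_all add: B_iff)
  thus "path_take i p \<in> B" "path_drop Q i p \<in> B"
    using p vanishing_pconcat[of "path_take i p" "path_drop Q i p"]
    by (auto simp: B_iff ptarget_take pconcat_take_drop)
next
  show "stat v \<in> B" if "v \<in> verts Q" for v
    using short_basis stat_paths that by simp
  show "arrow Q a \<in> B" if "a \<in> arcs Q" for a
    using short_basis arrow_paths that by simp
next
  fix c b b'
  assume "pconcat (arrow Q c) (arrow Q b) \<in> B" "pconcat (arrow Q c) (arrow Q b') \<in> B"
  note basis_arrows[OF this(1)] basis_arrows[OF this(2)]
    this[unfolded B_iff]
  thus "b = b'"
    using unique_succ[of c b b'] by metis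
next
  fix b b' c
  assume "pconcat (arrow Q b) (arrow Q c) \<in> B" "pconcat (arrow Q b') (arrow Q c) \<in> B"
  note basis_arrows[OF this(1)] basis_arrows[OF this(2)]
    this[unfolded B_iff]
  thus "b = b'"
    using unique_pred[of c b b'] by metis
qed

section \<open>The quotient algebra in coordinates\<close>

context string_algebra
begin

abbreviation A :: "('k, (('v, 'e) qpath \<Rightarrow>\<^sub>0 'k) set) module" where "A \<equiv> quotient_algebra Q I"

abbreviation conv_A (infixl "\<star>" 70) where "f \<star> g \<equiv> conv_on_basis Q B f g"

abbreviation coset :: "(('v, 'e) qpath \<Rightarrow>\<^sub>0 'k) \<Rightarrow> (('v, 'e) qpath \<Rightarrow>\<^sub>0 'k) set" where
  "coset f \<equiv> I +>\<^bsub>P\<^esub> f"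

lemma quotient_simps:
  "carrier A = carrier (P Quot I)" "monoid.mult A = monoid.mult (P Quot I)"
  "one A = one (P Quot I)" "zero A = zero (P Quot I)" "add A = add (P Quot I)"
  "smult A = (\<lambda>c X. \<Union>x\<in>X. coset (c \<odot>\<^bsub>P\<^esub> x))"
  by (simp_all add: quotient_algebra_def ring.defs module.defs)

lemma ring_A: "ring A"
proof -
  interpret R: ring "P Quot I"
    by (rule ideal.quotient_is_ring[OF ideal_I])
  show ?thesis
  proof (rule ringI)
    show "abelian_group A"
    proof (rule abelian_groupI)
      fix X assume "X \<in> carrier A"
      thus "\<exists>Y\<in>carrier A. Y \<oplus>\<^bsub>A\<^esub> X = \<zero>\<^bsub>A\<^esub>"
        unfolding quotient_simps using R.a_inv_closed R.l_neg by blast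
    qed (simp_all add: quotient_simps R.a_ac)
    show "Group.monoid A"
      by (rule monoidI) (simp_all add: quotient_simps R.m_assoc)
  qed (simp_all add: quotient_simps R.l_distr R.r_distr)
qed

sublocale A: ring A by (rule ring_A)

lemma carrier_A: "carrier A = coset ` carrier P"
  unfolding quotient_simps FactRing_def by (auto simp: A_RCOSETS_defs a_r_coset_def)

lemma coset_carrier: "f \<in> carrier P \<Longrightarrow> coset f \<in> carrier A"
  by (simp add: carrier_A del: path_algebra_simps(1))

lemma coset_cases:
  assumes "X \<in> carrier A"
  obtains f where "f \<in> carrier P" "X = coset f"
  using assms carrier_A by blast

lemma coset_mult: "f \<in> carrier P \<Longrightarrow> g \<in> carrier P \<Longrightarrow> coset f \<otimes>\<^bsub>A\<^esub> coset g = coset (path_mult Q f g)"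
  using ideal.rcoset_mult_add[OF ideal_I, of f g]
  by (simp add: quotient_simps FactRing_def del: path_algebra_simps(1))

lemma abelian_subgroup_I: "abelian_subgroup I P"
  using ideal_I by (simp add: abelian_subgroupI3 ideal.axioms(1) ring.is_abelian_group ring_P)

lemma coset_add: "f \<in> carrier P \<Longrightarrow> g \<in> carrier P \<Longrightarrow> coset f \<oplus>\<^bsub>A\<^esub> coset g = coset (f + g)"
  using abelian_subgroup.a_rcos_sum[OF abelian_subgroup_I, of f g]
  by (simp add: quotient_simps FactRing_def del: path_algebra_simps(1))

lemma mem_coset_iff: "x \<in> coset f \<longleftrightarrow> (\<exists>i\<in>I. x = i + f)"
  by (auto simp: a_r_coset_def')

lemma self_mem_coset: "f \<in> coset f"
  unfolding mem_coset_iff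
  using additive_subgroup.zero_closed[OF ideal.axioms(1)[OF ideal_I]] by force

definition reduce :: "(('v, 'e) qpath \<Rightarrow>\<^sub>0 'k) \<Rightarrow> ('v, 'e) qpath \<Rightarrow> 'k" where
  "reduce f p = (if p \<in> B then Poly_Mapping.lookup f p else 0)"

lemma reduce_I: "i \<in> I \<Longrightarrow> reduce i = 0"
  using ideal_monomial by (auto simp: reduce_def fun_eq_iff fun_apply in_keys_iff B_iff)

lemma reduce_add: "reduce (f + g) = reduce f + reduce g"
  and reduce_smult: "reduce (Poly_Mapping.map ((*) c) f) = scal c (reduce f)"
  by (simp_all add: reduce_def fun_eq_iff fun_apply lookup_add lookup_minus)

lemma reduce_mult: "reduce (path_mult Q f g) = reduce f \<star> reduce g"
  by (auto simp: reduce_def fun_eq_iff conv_on_basis_def lookup_path_mult B_take B_drop)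

lemma reduce_V: "reduce f \<in> V"
  by (rule spannedI) (simp add: reduce_def split: if_splits)

lemma reduce_single: "reduce (Poly_Mapping.single p 1) = (if p \<in> B then ind p else 0)"
  by (auto simp: reduce_def fun_eq_iff fun_apply lookup_single when_def ind_apply)

lemma coset_eq_iff:
  assumes "f \<in> carrier P" "g \<in> carrier P"
  shows "coset f = coset g \<longleftrightarrow> reduce f = reduce g"
proof
  assume "coset f = coset g"
  then obtain i where "i \<in> I" "f = i + g"
    using self_mem_coset[of f] mem_coset_iff[of f g] by blast
  thus "reduce f = reduce g" by (simp add: reduce_add reduce_I)
next
  assume eq: "reduce f = reduce g"
  have keys: "vanishing_path p" if p: "p \<in> Poly_Mapping.keys (f - g)" for p
  proof -
    have "p \<in> paths Q"
      using p assms keys_diff[of f g] by auto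
    moreover have "p \<notin> B"
      using p fun_cong[OF eq, of p] by (auto simp: in_keys_iff lookup_minus reduce_def)
    ultimately show ?thesis by (simp add: B_iff)
  qed
  have "Poly_Mapping.keys (f - g) \<subseteq> paths Q"
    using assms keys_diff[of f g] by auto
  hence "f - g \<in> I"
    using keys by (subst I_iff) (simp only: path_algebra_simps mem_Collect_eq, blast)
  hence "f \<in> coset g"
    unfolding mem_coset_iff by (intro bexI[of _ "f - g"]) auto
  thus "coset f = coset g"
    using abelian_group.a_repr_independence[OF ring.is_abelian_group[OF ring_P] _ assms(2)
        additive_subgroup.a_subgroup[OF ideal.axioms(1)[OF ideal_I]]] by simp
qed

text \<open>
  The coordinates of a coset; by \<open>reduce_I\<close> they do not depend on the chosen representative.
\<close>

definition coords :: "(('v, 'e) qpath \<Rightarrow>\<^sub>0 'k) set \<Rightarrow> ('v, 'e) qpath \<Rightarrow> 'k" where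
  "coords X = reduce (SOME f. f \<in> X)"

lemma coords_coset: "coords (coset f) = reduce f"
proof -
  have "(SOME x. x \<in> coset f) \<in> coset f"
    using self_mem_coset by (rule someI)
  then obtain i where "i \<in> I" "(SOME x. x \<in> coset f) = i + f"
    unfolding mem_coset_iff by blast
  thus ?thesis by (simp add: coords_def reduce_add reduce_I)
qed

definition combination :: "(('v, 'e) qpath \<Rightarrow> 'k) \<Rightarrow> ('v, 'e) qpath \<Rightarrow>\<^sub>0 'k" where
  "combination f = (\<Sum>p\<in>B. Poly_Mapping.single p (f p))"

definition elt :: "(('v, 'e) qpath \<Rightarrow> 'k) \<Rightarrow> (('v, 'e) qpath \<Rightarrow>\<^sub>0 'k) set" where
  "elt f = coset (combination f)"

lemma lookup_combination: "Poly_Mapping.lookup (combination f) p = (if p \<in> B then f p else 0)"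
  by (auto simp: combination_def lookup_sum lookup_single when_def finite_basis sum.delta)

lemma combination_carrier: "combination f \<in> carrier P"
  using B_iff by (auto simp: in_keys_iff lookup_combination split: if_splits)

lemma elt_carrier [simp]: "elt f \<in> carrier A"
  unfolding elt_def using combination_carrier by (rule coset_carrier)

lemma coords_elt [simp]: "f \<in> V \<Longrightarrow> coords (elt f) = f"
  using spanned_outside[of f "\<lambda>_. True"]
  by (auto simp: elt_def coords_coset reduce_def lookup_combination fun_eq_iff)

lemma coords_V [simp]: "X \<in> carrier A \<Longrightarrow> coords X \<in> V"
  by (erule coset_cases) (simp add: coords_coset reduce_V)

lemma coords_inject: "X \<in> carrier A \<Longrightarrow> Y \<in> carrier A \<Longrightarrow> coords X = coords Y \<longleftrightarrow> X = Y"
  by (elim coset_cases) (simp add: coords_coset coset_eq_iff del: path_algebra_simps(1))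

lemma elt_coords [simp]: "X \<in> carrier A \<Longrightarrow> elt (coords X) = X"
  using coords_inject[of "elt (coords X)" X] by simp

lemma coords_add [simp]: "X \<in> carrier A \<Longrightarrow> Y \<in> carrier A \<Longrightarrow> coords (X \<oplus>\<^bsub>A\<^esub> Y) = coords X + coords Y"
  by (elim coset_cases) (simp add: coords_coset coset_add reduce_add del: path_algebra_simps(1))

lemma coords_mult [simp]: "X \<in> carrier A \<Longrightarrow> Y \<in> carrier A \<Longrightarrow> coords (X \<otimes>\<^bsub>A\<^esub> Y) = coords X \<star> coords Y"
  by (elim coset_cases) (simp add: coords_coset coset_mult reduce_mult del: path_algebra_simps(1))

lemma smult_coset:
  assumes "f \<in> carrier P"
  shows "c \<odot>\<^bsub>A\<^esub> coset f = coset (Poly_Mapping.map ((*) c) f)"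
proof -
  have carr: "Poly_Mapping.map ((*) c) x \<in> carrier P" if "x \<in> carrier P" for x
    using that by (auto simp: in_keys_iff)
  have "coset (c \<odot>\<^bsub>P\<^esub> x) = coset (Poly_Mapping.map ((*) c) f)" if x: "x \<in> coset f" for x
  proof -
    obtain i where i: "i \<in> I" "x = i + f"
      using x unfolding mem_coset_iff by blast
    have "x \<in> carrier P"
      using abelian_subgroup.a_elemrcos_carrier[OF abelian_subgroup_I assms x] .
    thus ?thesis
      using coset_eq_iff[OF carr carr, of x f] assms i by (simp add: reduce_smult reduce_add reduce_I)
  qed
  thus ?thesis
    using self_mem_coset[of f] unfolding quotient_simps by blast
qed

lemma smult_carrier [simp]: "X \<in> carrier A \<Longrightarrow> c \<odot>\<^bsub>A\<^esub> X \<in> carrier A"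
proof (erule coset_cases)
  fix f assume "f \<in> carrier P" "X = coset f"
  moreover have "Poly_Mapping.map ((*) c) f \<in> carrier P"
    using \<open>f \<in> carrier P\<close> by (auto simp: in_keys_iff)
  ultimately show ?thesis
    by (simp add: smult_coset coset_carrier del: path_algebra_simps(1))
qed

lemma coords_smult [simp]: "X \<in> carrier A \<Longrightarrow> coords (c \<odot>\<^bsub>A\<^esub> X) = scal c (coords X)"
  by (erule coset_cases) (simp add: smult_coset coords_coset reduce_smult del: path_algebra_simps(1))

lemma coords_zero [simp]: "coords \<zero>\<^bsub>A\<^esub> = 0"
  using coords_add[of "\<zero>\<^bsub>A\<^esub>" "\<zero>\<^bsub>A\<^esub>"] by simp

lemma coords_one [simp]: "coords \<one>\<^bsub>A\<^esub> = unit"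
proof -
  have "coords \<one>\<^bsub>A\<^esub> = unit \<star> coords \<one>\<^bsub>A\<^esub>"
    by (simp add: conv_unit_left)
  also have "\<dots> = coords (elt unit \<otimes>\<^bsub>A\<^esub> \<one>\<^bsub>A\<^esub>)"
    unfolding coords_mult[OF elt_carrier A.one_closed] by (simp add: unit_V)
  finally show ?thesis by (simp add: unit_V)
qed

lemma path_class_carrier: "p \<in> paths Q \<Longrightarrow> path_class Q I p \<in> carrier A"
  unfolding path_class_def by (rule coset_carrier) simp

lemma coords_path_class: "coords (path_class Q I p) = (if p \<in> B then ind p else 0)"
  by (simp add: path_class_def coords_coset path_elt_def reduce_single)

lemma path_class_eq_elt: "p \<in> B \<Longrightarrow> path_class Q I p = elt (ind p)"
  using coords_inject[of "path_class Q I p" "elt (ind p)"] path_class_carrier[of p]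
  by (simp add: coords_path_class ind_V B_iff[of p])

lemma coords_finsum:
  "finite S \<Longrightarrow> (\<And>i. i \<in> S \<Longrightarrow> F i \<in> carrier A) \<Longrightarrow> coords (\<Oplus>\<^bsub>A\<^esub>i\<in>S. F i) = (\<Sum>i\<in>S. coords (F i))"
proof (induction S rule: finite_induct)
  case (insert i S)
  thus ?case by (simp add: A.finsum_insert Pi_iff)
qed simp

lemma eltI: "X \<in> carrier A \<Longrightarrow> coords X = f \<Longrightarrow> elt f = X"
  by auto

lemma elt_add: "f \<in> V \<Longrightarrow> g \<in> V \<Longrightarrow> elt (f + g) = elt f \<oplus>\<^bsub>A\<^esub> elt g"
  and elt_mult: "f \<in> V \<Longrightarrow> g \<in> V \<Longrightarrow> elt (f \<star> g) = elt f \<otimes>\<^bsub>A\<^esub> elt g"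
  and elt_smult: "f \<in> V \<Longrightarrow> elt (scal c f) = c \<odot>\<^bsub>A\<^esub> elt f"
  and elt_zero: "elt 0 = \<zero>\<^bsub>A\<^esub>"
  by (rule eltI; simp)+

section \<open>Spans and degrees\<close>

lemma span_paths_iff:
  assumes "S \<subseteq> B"
  shows "X \<in> span_paths Q I S \<longleftrightarrow> X \<in> carrier A \<and> coords X \<in> spanned (\<lambda>p. p \<in> S)"
proof
  assume "X \<in> span_paths Q I S"
  thus "X \<in> carrier A \<and> coords X \<in> spanned (\<lambda>p. p \<in> S)"
    unfolding span_paths_def
  proof induction
    case (add_smult z x c)
    then obtain p where p: "p \<in> S" "x = path_class Q I p" by blast
    hence "p \<in> B" using assms by blast
    thus ?case
      using add_smult p path_class_carrier[of p] B_iff[of p]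
      by (simp add: coords_path_class spanned_add spanned_scal ind_spanned)
  qed simp
next
  assume X: "X \<in> carrier A \<and> coords X \<in> spanned (\<lambda>p. p \<in> S)"
  have "elt f \<in> span_paths Q I S" if "f \<in> spanned (\<lambda>p. p \<in> S)" for f
    using that
  proof (induction rule: spanned_induct)
    case zero
    show "elt 0 \<in> span_paths Q I S"
      unfolding elt_zero span_paths_def by (rule lin_span.zero)
  next
    case (add g c w)
    have "elt g \<oplus>\<^bsub>A\<^esub> c \<odot>\<^bsub>A\<^esub> path_class Q I w \<in> span_paths Q I S"
      using add unfolding span_paths_def by (intro lin_span.add_smult) auto
    thus "elt (g + scal c (ind w)) \<in> span_paths Q I S"
      using add spanned_V[OF add(1)]
      by (simp add: elt_add elt_smult path_class_eq_elt spanned_scal ind_V)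
  qed
  thus "X \<in> span_paths Q I S" using X by (metis elt_coords)
qed

lemma degree_part_iff:
  "X \<in> degree_part Q I n \<longleftrightarrow> X \<in> carrier A \<and> coords X \<in> spanned (\<lambda>p. plength p = n)"
  unfolding degree_part_def by (subst span_paths_iff) (auto simp: spanned_def)

text \<open>
  The degree component, a definite description, exists and is the restriction of the coordinates to the paths of
  the given length.
\<close>

lemma degree_component_coords:
  assumes "X \<in> carrier A"
  shows "degree_component Q I n X = elt (\<lambda>p. if plength p = n then coords X p else 0)"
    (is "_ = elt ?c")
  unfolding degree_component_def
proof (rule the_equality)
  let ?S = "{p \<in> B. plength p \<noteq> n}"
  let ?d = "\<lambda>p. if plength p \<noteq> n then coords X p else 0"
  have V: "?c \<in> spanned (\<lambda>p. plength p = n)" "?d \<in> spanned (\<lambda>p. p \<in> ?S)"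
    using spannedD[OF coords_V[OF assms]] by (force intro!: spannedI split: if_splits)+
  note VV = spanned_V[OF V(1)] spanned_V[OF V(2)]
  have "coords X = ?c + ?d"
    by (simp add: fun_eq_iff fun_apply)
  hence "X = elt ?c \<oplus>\<^bsub>A\<^esub> elt ?d"
    using elt_add[OF VV] assms by (metis elt_coords)
  moreover have "elt ?d \<in> span_paths Q I ?S"
    using V(2) VV(2) by (subst span_paths_iff) auto
  moreover have "elt ?c \<in> degree_part Q I n"
    using V(1) VV(1) by (simp add: degree_part_iff)
  ultimately show "elt ?c \<in> degree_part Q I n \<and> (\<exists>y\<in>span_paths Q I ?S. X = elt ?c \<oplus>\<^bsub>A\<^esub> y)"
    by blast
  fix Y assume "Y \<in> degree_part Q I n \<and> (\<exists>y\<in>span_paths Q I ?S. X = Y \<oplus>\<^bsub>A\<^esub> y)"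
  then obtain y where Y: "Y \<in> carrier A" "coords Y \<in> spanned (\<lambda>p. plength p = n)"
      and y: "y \<in> carrier A" "coords y \<in> spanned (\<lambda>p. p \<in> ?S)" and X: "X = Y \<oplus>\<^bsub>A\<^esub> y"
    using span_paths_iff[of ?S] by (auto simp: degree_part_iff)
  have "coords Y p = ?c p" for p
    using X Y(1) y(1) spanned_zero_at[OF Y(2), of p] spanned_zero_at[OF y(2), of p]
    by (auto simp: fun_apply)
  thus "Y = elt ?c"
    using Y(1) by (intro eltI[symmetric]) auto
qed

end

context string_basis
begin

section \<open>Endomorphisms respect the path length\<close>

lemma conv_stat_apply: "v \<in> verts Q \<Longrightarrow> (f \<star> g) (stat v) = f (stat v) * g (stat v)"
  by (simp add: conv_on_basis_def B_stat)

text \<open>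
  The image of an arrow has no stationary part: an arrow is nilpotent, and taking the
  coefficient of a stationary path is multiplicative.
\<close>

lemma algebra_endo_arrow_deg:
  fixes T :: "(('a, 'b) qpath \<Rightarrow> 'k::field) \<Rightarrow> ('a, 'b) qpath \<Rightarrow> 'k"
  assumes "algebra_endo T" "a \<in> arcs Q"
  shows "T (ind (arrow Q a)) \<in> deg 1"
proof -
  let ?A = "ind (arrow Q a) :: ('a, 'b) qpath \<Rightarrow> 'k"
  define pw where "pw n = ((\<star>) ?A ^^ n) ?A" for n
  have AV: "?A \<in> V" using assms(2) by (simp add: ind_V B_arrow)
  have pw_Suc: "pw (Suc n) = ?A \<star> pw n" for n
    by (simp add: pw_def)
  have pw: "pw n \<in> deg (Suc n)" for n
  proof (induction n)
    case 0
    show ?case using arrow_deg[OF assms(2)] by (simp add: pw_def)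
  next
    case (Suc n)
    show ?case using deg_conv[OF arrow_deg[OF assms(2)] Suc] by (simp add: pw_Suc)
  qed
  have "T ?A (stat v) = 0" if v: "v \<in> verts Q" for v
  proof -
    have power: "T (pw n) (stat v) = T ?A (stat v) ^ Suc n" for n
    proof (induction n)
      case 0
      show ?case by (simp add: pw_def)
    next
      case (Suc n)
      show ?case
        using algebra_endoD(2)[OF assms(1) AV spanned_V[OF pw[of n]]] Suc
        by (simp add: pw_Suc conv_stat_apply[OF v])
    qed
    obtain N where N: "\<And>f. f \<in> deg N \<Longrightarrow> f = (0 :: ('a, 'b) qpath \<Rightarrow> 'k)"
      using deg_vanishes by blast
    have "pw N = 0"
      using N[OF deg_mono[OF pw[of N]]] by simp
    hence "T ?A (stat v) ^ Suc N = 0"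
      using power[of N] linear_map_0[OF algebra_endoD(1)[OF assms(1)]] by (simp add: zero_fun_apply)
    thus ?thesis by auto
  qed
  hence stat: "T ?A p = 0" if "p \<in> B" "plength p = 0" for p
    using psource_verts[OF that(1)] plength_0_iff[of p] that(2) by metis
  have TA: "T ?A \<in> V"
    using linear_mapD(1)[OF algebra_endoD(1)[OF assms(1)] AV] .
  show ?thesis
  proof (rule spannedI)
    fix p assume nz: "T ?A p \<noteq> 0"
    hence "p \<in> B" using spannedD[OF TA] by blast
    moreover from this have "plength p \<noteq> 0" using stat nz by blast
    ultimately show "p \<in> B \<and> 1 \<le> plength p" by simp
  qed
qed

text \<open>
  This supplies what membership in \<open>Aut\<^sub>0(A)\<close> leaves open, namely that the image of a path contains
  no shorter paths.
\<close>

lemma algebra_endo_deg: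
  assumes "algebra_endo T" "w \<in> B"
  shows "T (ind w) \<in> deg (plength w)"
  using assms(2)
proof (induction "plength w" arbitrary: w rule: less_induct)
  case less
  show ?case
  proof (cases "plength w = 0")
    case True
    thus ?thesis
      using deg_0[OF linear_mapD(1)[OF algebra_endoD(1)[OF assms(1)] ind_V[OF less.prems]]] by simp
  next
    case False
    hence "1 \<le> plength w" by simp
    then obtain a v where a: "a \<in> arcs Q" "v \<in> B" "w = pconcat (arrow Q a) v"
        "ptarget Q (arrow Q a) = psource v" "plength w = Suc (plength v)"
      by (rule basis_Cons[OF less.prems])
    have "T (ind w) = T (ind (arrow Q a)) \<star> T (ind v)"
      using algebra_endoD(2)[OF assms(1) ind_V[OF B_arrow[OF a(1)]] ind_V[OF a(2)]] a less.prems
      by (simp add: conv_ind)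
    thus ?thesis
      using deg_conv[OF algebra_endo_arrow_deg[OF assms(1) a(1)] less.hyps[OF _ a(2)]] a(5) by simp
  qed
qed

section \<open>Derivations of the model\<close>

definition model_derivation :: "((('a, 'b) qpath \<Rightarrow> 'k::field) \<Rightarrow> ('a, 'b) qpath \<Rightarrow> 'k) \<Rightarrow> bool" where
  "model_derivation D \<longleftrightarrow> linear_map D \<and> (\<forall>f\<in>V. \<forall>g\<in>V. D (f \<star> g) = D f \<star> g + f \<star> D g)"

lemma model_derivationI:
  fixes D :: "(('a, 'b) qpath \<Rightarrow> 'k::field) \<Rightarrow> ('a, 'b) qpath \<Rightarrow> 'k"
  assumes "linear_map D"
    and "\<And>u w. u \<in> B \<Longrightarrow> w \<in> B \<Longrightarrow> D (ind u \<star> ind w) = D (ind u) \<star> ind w + ind u \<star> D (ind w)"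
  shows "model_derivation D"
  unfolding model_derivation_def
proof (intro conjI ballI)
  fix f g :: "('a, 'b) qpath \<Rightarrow> 'k"
  assume f: "f \<in> V" and g: "g \<in> V"
  show "D (f \<star> g) = D f \<star> g + f \<star> D g"
  proof (rule linear_map_eqI[OF _ _ g])
    show "linear_map (\<lambda>g. D (f \<star> g))" "linear_map (\<lambda>g. D f \<star> g + f \<star> D g)"
      using assms(1) by (auto simp: linear_map_def conv_bilinear scal_add intro!: spanned_add)
    fix w assume w: "w \<in> B"
    show "D (f \<star> ind w) = D f \<star> ind w + f \<star> D (ind w)"
    proof (rule linear_map_eqI[OF _ _ f])
      show "linear_map (\<lambda>f. D (f \<star> ind w))" "linear_map (\<lambda>f. D f \<star> ind w + f \<star> D (ind w))"
        using assms(1) by (auto simp: linear_map_def conv_bilinear scal_add intro!: spanned_add)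
    qed (use assms(2) w in simp)
  qed
qed (rule assms(1))

lemma model_derivation_eqI:
  fixes D E :: "(('a, 'b) qpath \<Rightarrow> 'k::field) \<Rightarrow> ('a, 'b) qpath \<Rightarrow> 'k"
  assumes D: "model_derivation D" and E: "model_derivation E"
    and "\<And>v. v \<in> verts Q \<Longrightarrow> D (ind (stat v)) = E (ind (stat v))"
    and "\<And>a. a \<in> arcs Q \<Longrightarrow> D (ind (arrow Q a)) = E (ind (arrow Q a))"
    and "f \<in> V"
  shows "D f = E f"
proof (rule linear_map_eqI[OF _ _ assms(5)])
  show "linear_map D" "linear_map E"
    using D E by (simp_all add: model_derivation_def)
  fix w assume "w \<in> B"
  thus "D (ind w) = E (ind w)"
  proof (induction "plength w" arbitrary: w rule: less_induct)
    case less
    show ?case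
    proof (cases rule: basis_cases[OF less.prems])
      case (1 v)
      thus ?thesis using assms(3) by simp
    next
      case 2
      then obtain a v where a: "a \<in> arcs Q" "v \<in> B" "w = pconcat (arrow Q a) v"
          "ptarget Q (arrow Q a) = psource v" "plength w = Suc (plength v)"
        by (rule basis_Cons[OF less.prems])
      have w: "ind w = ind (arrow Q a) \<star> (ind v :: _ \<Rightarrow> 'k)"
        using a less.prems by (simp add: conv_ind)
      have V: "(ind (arrow Q a) :: _ \<Rightarrow> 'k) \<in> V" "(ind v :: _ \<Rightarrow> 'k) \<in> V"
        using a by (simp_all add: ind_V B_arrow)
      show ?thesis
        using D E V less.hyps[OF _ a(2)] a(5) assms(4)[OF a(1)]
        unfolding w model_derivation_def by simp
    qed
  qed
qed

lemma model_derivation_sum: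
  assumes "\<And>i. i \<in> S \<Longrightarrow> model_derivation (D i)"
  shows "model_derivation (\<lambda>f. \<Sum>i\<in>S. scal (c i) (D i f))"
  using assms
proof (induction S rule: infinite_finite_induct)
  case (insert i S)
  hence "model_derivation (D i)" "model_derivation (\<lambda>f. \<Sum>i\<in>S. scal (c i) (D i f))"
    by simp_all
  thus ?case
    using insert(1,2) unfolding model_derivation_def linear_map_def
    by (simp add: conv_bilinear scal_add spanned_add spanned_scal mult.commute)
qed (simp_all add: model_derivation_def linear_map_def)

definition linear_extension ::
    "(('a, 'b) qpath \<Rightarrow> ('a, 'b) qpath \<Rightarrow> 'k::field) \<Rightarrow> (('a, 'b) qpath \<Rightarrow> 'k) \<Rightarrow> ('a, 'b) qpath \<Rightarrow> 'k" where
  "linear_extension b f r = (\<Sum>w\<in>B. f w * b w r)"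

lemma linear_extension_ind: "w \<in> B \<Longrightarrow> linear_extension b (ind w) = b w"
  by (simp add: fun_eq_iff linear_extension_def ind_apply B_finite if_distrib[of "\<lambda>x. x * _"] cong: if_cong)

lemma linear_extension_linear:
  assumes "\<And>w. w \<in> B \<Longrightarrow> b w \<in> V"
  shows "linear_map (linear_extension b)"
  unfolding linear_map_def
proof (intro conjI ballI allI)
  fix f :: "('a, 'b) qpath \<Rightarrow> 'c"
  have "linear_extension b f = (\<Sum>w\<in>B. scal (f w) (b w))"
    by (simp add: fun_eq_iff linear_extension_def fun_sum_apply scal_apply)
  thus "linear_extension b f \<in> V"
    using assms by (simp add: spanned_sum spanned_scal)
qed (auto simp: linear_extension_def fun_eq_iff fun_apply algebra_simps sum.distrib sum_distrib_left)

text \<open>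
  The derivation \<open>\<delta>\<^bsub>(a,p)\<^esub>\<close> for \<open>p\<close> left maximal. By the product rule it replaces each
  occurrence of \<open>a\<close> by \<open>p\<close>, but unless the occurrence is the first arrow the result is zero.
\<close>

definition pair_derivation ::
    "'b \<Rightarrow> ('a, 'b) qpath \<Rightarrow> (('a, 'b) qpath \<Rightarrow> 'k::field) \<Rightarrow> ('a, 'b) qpath \<Rightarrow> 'k" where
  "pair_derivation a p =
    linear_extension (\<lambda>w. if first_arrow Q w = arrow Q a then ind p \<star> ind (path_drop Q 1 w) else 0)"

lemma first_arrow_split:
  assumes "w \<in> B" "first_arrow Q w = arrow Q a"
  shows "w = pconcat (arrow Q a) (path_drop Q 1 w)" "psource (path_drop Q 1 w) = head Q a"
proof -
  have "snd w \<noteq> []" and hd: "hd (snd w) = a"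
    using assms(2) by (auto simp: first_arrow_def split: if_splits)
  hence "snd (path_take 1 w) = [a]" by (cases "snd w") auto
  hence "path_take 1 w = arrow Q a"
    using word_of_basis[OF B_take[OF assms(1)], of 1] by (simp add: word_single)
  thus "w = pconcat (arrow Q a) (path_drop Q 1 w)" "psource (path_drop Q 1 w) = head Q a"
    using pconcat_take_drop[of 1 w Q] ptarget_take[of Q 1 w] by simp_all
qed

lemma pair_derivation_ind:
  "w \<in> B \<Longrightarrow> pair_derivation a p (ind w) =
    (if first_arrow Q w = arrow Q a then ind p \<star> ind (path_drop Q 1 w) else 0)"
  by (simp add: pair_derivation_def linear_extension_ind)

lemma first_arrow_stat: "first_arrow Q (stat v) \<noteq> arrow Q a"
  by (simp add: first_arrow_def stat_def arrow_def)

lemma pair_derivation_stat: "v \<in> verts Q \<Longrightarrow> pair_derivation a p (ind (stat v)) = 0"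
  by (simp add: pair_derivation_ind B_stat first_arrow_stat)

lemma pair_derivation_arrow:
  assumes "b \<in> arcs Q" "p \<in> B" "ptarget Q p = head Q a"
  shows "pair_derivation a p (ind (arrow Q b)) = (if b = a then ind p else 0)"
proof -
  have "first_arrow Q (arrow Q b) = arrow Q b" by (simp add: first_arrow_def)
  moreover have "path_drop Q 1 (arrow Q b) = stat (head Q b)"
    using drop_plength[of Q "arrow Q b"] by simp
  ultimately show ?thesis
    using assms by (cases "b = a") (simp_all add: pair_derivation_ind B_arrow conv_ind pconcat_stat_right)
qed

lemma stat_conv_spanned:
  assumes "f \<in> spanned (\<lambda>x. psource x = s)"
  shows "ind (stat v) \<star> f = (if s = v then f else 0)"
proof
  fix r show "(ind (stat v) \<star> f) r = (if s = v then f else 0) r"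
    using spannedD[OF assms, of r] conv_stat_left[OF spanned_V[OF assms], of v r]
    by (cases "f r = 0") (auto simp: fun_apply)
qed

text \<open>
  The point is that the zero products of paths are respected. If \<open>u = au'\<close> and \<open>uw = 0\<close>
  with \<open>w\<close> of positive length, then \<open>pu'w = 0\<close>: either \<open>p\<close> is right maximal, or \<open>p = qa\<close> and
  \<open>pu'w = quw\<close>.
\<close>

lemma pair_derivation_derivation:
  assumes a: "a \<in> arcs Q" and p: "p \<in> B" "type_II_support a p"
  shows "model_derivation (pair_derivation a p :: (('a, 'b) qpath \<Rightarrow> 'k::field) \<Rightarrow> _)"
proof (rule model_derivationI)
  let ?D = "pair_derivation a p :: (('a, 'b) qpath \<Rightarrow> 'k) \<Rightarrow> _"
  have lm: "lmax p" and len: "2 \<le> plength p" and src: "psource p = tail Q a" and tgt: "ptarget Q p = head Q a"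
    and rl: "rmax p \<or> last_arrow Q p = arrow Q a"
    using p(2) by (auto simp: type_II_support_def)
  show lin: "linear_map ?D"
    unfolding pair_derivation_def by (rule linear_extension_linear) simp
  fix u w assume u: "u \<in> B" and w: "w \<in> B"
  have ann: "?D (ind w) \<in> spanned (\<lambda>x. left_annihilated x \<and> psource x = psource w)" if w: "w \<in> B" for w
  proof (cases "first_arrow Q w = arrow Q a")
    case True
    have "psource w = tail Q a"
      using arg_cong[OF first_arrow_split(1)[OF w True], of psource] by simp
    have "ind p \<star> (ind (path_drop Q 1 w) :: _ \<Rightarrow> 'k) \<in> spanned (\<lambda>x. left_annihilated x \<and> psource x = psource w)"
      by (rule conv_spanned[OF ind_spanned[OF p(1), of "\<lambda>x. x = p"] ind_spanned[OF B_drop[OF w], of "\<lambda>_. True"]])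
        (use lmax_pconcat[OF lm] p(1) len src \<open>psource w = tail Q a\<close> in auto)
    thus ?thesis using True w by (simp add: pair_derivation_ind)
  qed (use w in \<open>simp add: pair_derivation_ind\<close>)
  show "?D (ind u \<star> ind w) = ?D (ind u) \<star> ind w + ind u \<star> ?D (ind w)"
  proof (cases rule: basis_cases[OF u])
    case (1 v)
    have "ind (stat v) \<star> ?D (ind w) = (if psource w = v then ?D (ind w) else 0)"
      by (rule stat_conv_spanned) (rule spanned_mono[OF ann[OF w]], simp)
    moreover have "ind u \<star> ind w = (if psource w = v then ind w else (0 :: _ \<Rightarrow> 'k))"
      using w 1 by (auto simp: conv_ind pconcat_stat_left)
    ultimately show ?thesis
      using 1 linear_map_0[OF lin] by (auto simp: pair_derivation_stat)
  next
    case 2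
    have ud: "(ind u :: _ \<Rightarrow> 'k) \<in> deg 1"
      using 2 by (rule ind_spanned[OF u])
    have "?D (ind w) \<in> spanned left_annihilated"
      using ann[OF w] by (rule spanned_mono) simp
    hence right: "ind u \<star> ?D (ind w) = 0"
      using deg1_conv_left_annihilated[OF ud] by blast
    have ne: "snd u \<noteq> []" using 2 by (auto simp: plength_def)
    show ?thesis
    proof (cases "first_arrow Q u = arrow Q a")
      case False
      hence "?D (ind u \<star> ind w) = 0"
        using linear_map_0[OF lin] first_arrow_pconcat[OF ne, of w]
        by (auto simp: conv_ind pair_derivation_ind)
      thus ?thesis using False u right by (simp add: pair_derivation_ind)
    next
      case True
      let ?u = "path_drop Q 1 u"
      note split = first_arrow_split[OF u True]
      have left: "?D (ind u) \<star> ind w = ind p \<star> (ind ?u \<star> ind w)"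
        using True u by (simp add: pair_derivation_ind conv_assoc)
      have "?D (ind u \<star> ind w) = ind p \<star> (ind ?u \<star> ind w)"
      proof (cases "ptarget Q u = psource w")
        case comp: True
        have uw: "pconcat u w = pconcat (arrow Q a) (pconcat ?u w)"
          using split(1) pconcat_assoc by metis
        have comp': "ptarget Q (arrow Q a) = psource (pconcat ?u w)"
          using split(2) by simp
        show ?thesis
        proof (cases "pconcat u w \<in> B")
          case True
          have "pconcat ?u w \<in> B"
            using pconcat_B(2)[OF _ comp'] uw True by simp
          moreover have "path_drop Q 1 (pconcat u w) = pconcat ?u w"
            using drop_pconcat[OF comp'] uw by simp
          ultimately show ?thesis
            using True comp \<open>first_arrow Q u = arrow Q a\<close> first_arrow_pconcat[OF ne, of w]
            by (simp add: conv_ind pair_derivation_ind)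
        next
          case False
          have w1: "1 \<le> plength w"
            using False u pconcat_length_0[of w u] by (cases "plength w") auto
          have "ind p \<star> ind (pconcat ?u w) = (0 :: _ \<Rightarrow> 'k)" if B: "pconcat ?u w \<in> B"
          proof -
            have "pconcat p (pconcat ?u w) \<notin> B" if pt: "ptarget Q p = psource (pconcat ?u w)"
            proof (cases "rmax p")
              case True
              show ?thesis
                by (rule right_maximal_no_extension[OF True B _ pt]) (use w1 in simp)
            next
              case False
              hence "last_arrow Q p = arrow Q a" using rl by blast
              then obtain q where q: "q \<in> B" "p = pconcat q (arrow Q a)" "ptarget Q q = tail Q a"
                  "plength p = Suc (plength q)"
                by (rule last_arrow_split[OF p(1)])
              have "pconcat p (pconcat ?u w) = pconcat q (pconcat u w)"
                using q(2) uw by (simp add: pconcat_assoc)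
              moreover have "ptarget Q q = psource (pconcat u w)"
                using q(3) arg_cong[OF split(1), of psource] by simp
              ultimately show ?thesis
                using pconcat_B(2) \<open>pconcat u w \<notin> B\<close> by metis
            qed
            thus ?thesis by (auto simp: conv_ind)
          qed
          hence "ind p \<star> (ind ?u \<star> ind w) = (0 :: _ \<Rightarrow> 'k)"
            by (auto simp: conv_ind[of _ w])
          moreover have "ind u \<star> ind w = (0 :: _ \<Rightarrow> 'k)"
            using False by (auto simp: conv_ind)
          ultimately show ?thesis using linear_map_0[OF lin] by simp
        qed
      next
        case False
        thus ?thesis using linear_map_0[OF lin] by (simp add: conv_ind)
      qed
      thus ?thesis using left right by simp
    qed
  qed
qed

end

context string_algebra
begin

section \<open>Transfer of automorphisms and derivations\<close>

lemma algebra_endo_of_aut: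
  assumes "f \<in> vertex_fixing_aut Q I"
  shows "algebra_endo (\<lambda>x. coords (f (elt x)))"
proof -
  have f: "f \<in> ring_hom A A" and sm: "\<And>c X. X \<in> carrier A \<Longrightarrow> f (c \<odot>\<^bsub>A\<^esub> X) = c \<odot>\<^bsub>A\<^esub> f X"
    and st: "\<And>v. v \<in> verts Q \<Longrightarrow> f (path_class Q I (stat v)) = path_class Q I (stat v)"
    using assms by (auto simp: vertex_fixing_aut_def algebra_aut_def ring_iso_def)
  note hom = ring_hom_closed[OF f] ring_hom_mult[OF f] ring_hom_add[OF f]
  show ?thesis
    unfolding algebra_endo_def linear_map_def
    using hom sm st
    by (auto simp: elt_add elt_mult elt_smult path_class_eq_elt B_stat stat_V dest: arg_cong[of _ _ coords])
qed

lemma ring_iso_of_endo: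
  assumes "algebra_endo T" "unipotent T"
  shows "(\<lambda>X. elt (T (coords X))) \<in> algebra_aut A"
proof -
  note T = algebra_endoD[OF assms(1)]
  note TV = linear_mapD[OF T(1)]
  obtain S where S: "algebra_endo S" "\<And>f. f \<in> V \<Longrightarrow> T (S f) = f" "\<And>f. f \<in> V \<Longrightarrow> S (T f) = f"
    using unipotent_inverse[OF assms] by blast
  note SV = linear_mapD(1)[OF algebra_endoD(1)[OF S(1)]]
  have "bij_betw (\<lambda>X. elt (T (coords X))) (carrier A) (carrier A)"
    by (rule bij_betwI[where g = "\<lambda>X. elt (S (coords X))"]) (simp_all add: TV SV S)
  moreover have "(\<lambda>X. elt (T (coords X))) \<in> ring_hom A A"
  proof (rule ring_hom_memI)
    show "elt (T (coords \<one>\<^bsub>A\<^esub>)) = \<one>\<^bsub>A\<^esub>"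
      by (rule eltI) (simp_all add: algebra_endo_unit[OF assms(1)])
  qed (simp_all add: T(2) TV elt_add elt_mult)
  moreover have "elt (T (coords (c \<odot>\<^bsub>A\<^esub> X))) = c \<odot>\<^bsub>A\<^esub> elt (T (coords X))" if "X \<in> carrier A" for c X
    using that by (simp add: TV elt_smult)
  ultimately show ?thesis
    by (simp add: algebra_aut_def ring_iso_def)
qed

lemma unipotent_of_graded:
  assumes "f \<in> vertex_fixing_aut Q I" "f \<in> graded_unipotent_aut Q I"
  shows "unipotent (\<lambda>x. coords (f (elt x)))"
  unfolding unipotent_def
proof
  fix w assume w: "w \<in> B"
  let ?T = "\<lambda>x. coords (f (elt x))"
  note endo = algebra_endo_of_aut[OF assms(1)]
  have deg: "?T (ind w) \<in> deg (plength w)"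
    using algebra_endo_deg[OF endo w] .
  have "f \<in> ring_hom A A"
    using assms(1) by (simp add: vertex_fixing_aut_def algebra_aut_def ring_iso_def)
  hence fw: "f (elt (ind w)) \<in> carrier A"
    by (simp add: ring_hom_closed)
  have "elt (ind w) \<in> degree_part Q I (plength w)"
    using w by (simp add: degree_part_iff ind_V ind_spanned)
  hence "degree_component Q I (plength w) (f (elt (ind w))) = elt (ind w)"
    using assms(2) by (simp add: graded_unipotent_aut_def)
  hence eq: "elt (\<lambda>p. if plength p = plength w then ?T (ind w) p else 0) = elt (ind w)"
    using degree_component_coords[OF fw] by simp
  have "(\<lambda>p. if plength p = plength w then ?T (ind w) p else 0) \<in> V"
    by (rule spannedI) (use spannedD[OF deg] in \<open>auto split: if_splits\<close>)
  hence eq': "(\<lambda>p. if plength p = plength w then ?T (ind w) p else 0) = ind w"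
    using arg_cong[OF eq, of coords] by (simp add: ind_V w)
  have same: "?T (ind w) p = ind w p" if "plength p = plength w" for p
    using fun_cong[OF eq', of p] that by simp
  show "?T (ind w) - ind w \<in> spanned (\<lambda>p. plength w < plength p)"
  proof (rule spannedI)
    fix p assume nz: "(?T (ind w) - ind w) p \<noteq> 0"
    have "?T (ind w) - ind w \<in> deg (plength w)"
      using deg w by (intro spanned_diff ind_spanned) auto
    hence "p \<in> B" "plength w \<le> plength p"
      using spannedD nz by blast+
    moreover have "plength p \<noteq> plength w"
      using nz same[of p] by (auto simp: fun_apply)
    ultimately show "p \<in> B \<and> plength w < plength p" by simp
  qed
qed

lemma graded_of_unipotent:
  assumes "algebra_endo T" "unipotent T"
  shows "(\<lambda>X. elt (T (coords X))) \<in> graded_unipotent_aut Q I"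
  unfolding graded_unipotent_aut_def
proof (intro CollectI conjI allI ballI ring_iso_of_endo assms)
  fix n X assume "X \<in> degree_part Q I n"
  hence X: "X \<in> carrier A" "coords X \<in> spanned (\<lambda>p. plength p = n)"
    by (simp_all add: degree_part_iff)
  note lin = algebra_endoD(1)[OF assms(1)]
  have "coords X \<in> deg n"
    using X(2) by (rule spanned_mono) simp
  hence R: "T (coords X) - coords X \<in> deg (Suc n)"
    using unipotent_raise[OF lin assms(2)] by blast
  have "(if plength p = n then T (coords X) p else 0) = coords X p" for p
    using spanned_zero_at[OF R, of p] spanned_zero_at[OF X(2), of p] by (auto simp: fun_apply)
  hence "(\<lambda>p. if plength p = n then T (coords X) p else 0) = coords X"
    by (rule ext)
  thus "degree_component Q I n (elt (T (coords X))) = X"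
    unfolding degree_component_coords[OF elt_carrier] coords_elt[OF linear_mapD(1)[OF lin coords_V[OF X(1)]]]
    using X(1) by simp
qed

lemma vertex_fixing_of_endo:
  assumes "algebra_endo T" "unipotent T"
  shows "(\<lambda>X. elt (T (coords X))) \<in> vertex_fixing_aut Q I"
  using ring_iso_of_endo[OF assms] algebra_endoD(3)[OF assms(1)]
  by (simp add: vertex_fixing_aut_def path_class_eq_elt B_stat stat_V)

lemma diagonal_of_endo:
  assumes "algebra_endo T" "unipotent T"
    and "\<And>w. w \<in> B \<Longrightarrow> T (ind w) \<in> spanned (\<lambda>p. same_ends p w)"
  shows "(\<lambda>X. elt (T (coords X))) \<in> diagonal_aut Q I"
proof -
  have "elt (T (coords (path_class Q I w))) \<in> span_paths Q I
      {w' \<in> B. first_arrow Q w' = first_arrow Q w \<and> last_arrow Q w' = last_arrow Q w}" if w: "w \<in> B" for w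
    using spanned_mono[OF assms(3)[OF w]] spanned_V[OF assms(3)[OF w]] w
    by (subst span_paths_iff) (auto simp: coords_path_class same_ends_def)
  thus ?thesis
    using vertex_fixing_of_endo[OF assms(1,2)] graded_of_unipotent[OF assms(1,2)]
    by (simp add: diagonal_aut_def)
qed

lemma model_derivation_of_derivation:
  assumes "derivation A d"
  shows "model_derivation (\<lambda>f. coords (d (elt f)))"
  using assms unfolding derivation_def model_derivation_def linear_map_def
  by (simp add: elt_add elt_mult elt_smult Pi_iff)

lemma derivation_of_model_derivation:
  assumes "model_derivation D" "\<And>X. X \<in> carrier A \<Longrightarrow> d X = elt (D (coords X))"
  shows "derivation A d"
proof -
  have D: "linear_map D" "\<And>f g. f \<in> V \<Longrightarrow> g \<in> V \<Longrightarrow> D (f \<star> g) = D f \<star> g + f \<star> D g"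
    using assms(1) by (auto simp: model_derivation_def)
  note lin = linear_mapD[OF D(1)]
  show ?thesis
    unfolding derivation_def
  proof (intro conjI ballI allI)
    fix X Y assume X: "X \<in> carrier A" "Y \<in> carrier A"
    show "d (X \<otimes>\<^bsub>A\<^esub> Y) = d X \<otimes>\<^bsub>A\<^esub> Y \<oplus>\<^bsub>A\<^esub> X \<otimes>\<^bsub>A\<^esub> d Y"
      using X by (subst coords_inject[symmetric]) (simp_all add: assms(2) D(2) lin spanned_add)
  qed (simp_all add: assms(2) lin elt_add elt_smult)
qed

text \<open>
  Both existence and uniqueness of the derivation in the description of \<open>\<delta>\<^bsub>(a,p)\<^esub>\<close> are needed:
  the first is \<open>pair_derivation_derivation\<close>, and a derivation is determined by its values at arrows and vertices.
\<close>

lemma delta_path_eq: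
  assumes a: "a \<in> arcs Q" and p: "p \<in> B" "type_II_support a p" and X: "X \<in> carrier A"
  shows "delta_path Q I a p X = elt (pair_derivation a p (coords X))"
proof -
  let ?D = "pair_derivation a p :: (('v, 'e) qpath \<Rightarrow> 'k) \<Rightarrow> _"
  let ?d = "restrict (\<lambda>X. elt (?D (coords X))) (carrier A)"
  note der = pair_derivation_derivation[OF a p]
  have tgt: "ptarget Q p = head Q a"
    using p(2) by (simp add: type_II_support_def)
  note pa = pair_derivation_arrow[OF _ p(1) tgt]
  have arr: "path_class Q I (arrow Q b) = elt (ind (arrow Q b))" "elt (ind (arrow Q b)) \<in> carrier A" if "b \<in> arcs Q" for b
    using that by (simp_all add: path_class_eq_elt B_arrow)
  have "delta_path Q I a p = ?d"
    unfolding delta_path_def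
  proof (rule the_equality, intro conjI ballI)
    show "derivation A ?d"
      by (rule derivation_of_model_derivation[OF der]) simp
    show "?d (path_class Q I (arrow Q a)) = path_class Q I p"
      using a by (simp add: arr ind_V B_arrow pa path_class_eq_elt p(1))
    show "?d (path_class Q I (arrow Q b)) = \<zero>\<^bsub>A\<^esub>" if "b \<in> arcs Q - {a}" for b
      using that by (simp add: arr ind_V B_arrow pa elt_zero)
    show "?d (path_class Q I (stat v)) = \<zero>\<^bsub>A\<^esub>" if "v \<in> verts Q" for v
      using that by (simp add: path_class_eq_elt B_stat stat_V pair_derivation_stat elt_zero)
  next
    fix d assume d: "d \<in> extensional (carrier A) \<and> derivation A d \<and>
       d (path_class Q I (arrow Q a)) = path_class Q I p \<and>
       (\<forall>b\<in>arcs Q - {a}. d (path_class Q I (arrow Q b)) = \<zero>\<^bsub>A\<^esub>) \<and>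
       (\<forall>v\<in>verts Q. d (path_class Q I (stat v)) = \<zero>\<^bsub>A\<^esub>)"
    have eq: "coords (d (elt f)) = ?D f" if f: "f \<in> V" for f
    proof (rule model_derivation_eqI[OF model_derivation_of_derivation der _ _ f])
      fix v assume "v \<in> verts Q"
      thus "coords (d (elt (ind (stat v)))) = ?D (ind (stat v))"
        using d by (simp add: path_class_eq_elt[symmetric] B_stat pair_derivation_stat)
    next
      fix b assume b: "b \<in> arcs Q"
      thus "coords (d (elt (ind (arrow Q b)))) = ?D (ind (arrow Q b))"
        using d by (cases "b = a")
          (simp_all add: path_class_eq_elt[symmetric] B_arrow pa, simp add: coords_path_class p(1))
    qed (use d in blast)
    have dc: "d Y \<in> carrier A" if "Y \<in> carrier A" for Y
      using d that by (auto simp: derivation_def)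
    show "d = ?d"
    proof (rule extensionalityI[of _ "carrier A"])
      fix Y assume Y: "Y \<in> carrier A"
      hence "coords (d Y) = ?D (coords Y)"
        using eq[OF coords_V[OF Y]] by simp
      thus "d Y = ?d Y"
        using Y eltI[OF dc[OF Y]] by simp
    qed (use d in auto)
  qed simp
  thus ?thesis using X by simp
qed

lemma ind_nonzero: "(ind p :: _ \<Rightarrow> 'k) \<noteq> 0"
  by (rule notI, drule fun_cong[of _ _ p]) (simp add: zero_fun_apply)

lemma left_maximal_iff:
  assumes "p \<in> B"
  shows "left_maximal Q I p \<longleftrightarrow> lmax p"
proof -
  have "path_class Q I (arrow Q a) \<otimes>\<^bsub>A\<^esub> path_class Q I p = \<zero>\<^bsub>A\<^esub> \<longleftrightarrow>
      (head Q a = psource p \<longrightarrow> pconcat (arrow Q a) p \<notin> B)" if "a \<in> arcs Q" for a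
    using assms that
    by (subst coords_inject[symmetric]) (simp_all add: path_class_eq_elt B_arrow ind_V conv_ind ind_nonzero)
  thus ?thesis by (simp add: left_maximal_def lmax_def)
qed

lemma right_maximal_iff:
  assumes "p \<in> B"
  shows "right_maximal Q I p \<longleftrightarrow> rmax p"
proof -
  have "path_class Q I p \<otimes>\<^bsub>A\<^esub> path_class Q I (arrow Q a) = \<zero>\<^bsub>A\<^esub> \<longleftrightarrow>
      (ptarget Q p = tail Q a \<longrightarrow> pconcat p (arrow Q a) \<notin> B)" if "a \<in> arcs Q" for a
    using assms that
    by (subst coords_inject[symmetric]) (simp_all add: path_class_eq_elt B_arrow ind_V conv_ind ind_nonzero)
  thus ?thesis by (simp add: right_maximal_def rmax_def)
qed

text \<open>
  A derivation that kills the vertices is the sum over the arrows \<open>a\<close> of the \<open>\<delta>\<^bsub>(a,y)\<^esub>\<close> with \<open>y\<close>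
  its value at \<open>a\<close>, as both sides agree on arrows and vertices.
\<close>

lemma type_II_of_model:
  assumes D: "model_derivation D"
    and stat: "\<And>v. v \<in> verts Q \<Longrightarrow> D (ind (stat v)) = 0"
    and arr: "\<And>a. a \<in> arcs Q \<Longrightarrow> D (ind (arrow Q a)) \<in> spanned (type_II_support a)"
  shows "type_II Q I (\<lambda>X. elt (D (coords X)))"
proof -
  define y where "y a = combination (D (ind (arrow Q a)))" for a
  let ?y = "\<lambda>a p. Poly_Mapping.lookup (y a) p"
  have y: "p \<in> B \<and> type_II_support a p" if "a \<in> arcs Q" "p \<in> Poly_Mapping.keys (y a)" for a p
    using that spannedD[OF arr[OF that(1)], of p]
    by (auto simp: y_def in_keys_iff lookup_combination split: if_splits)
  define E where "E f = (\<Sum>a\<in>arcs Q. scal 1 (\<Sum>p\<in>Poly_Mapping.keys (y a). scal (?y a p) (pair_derivation a p f)))" for f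
  have E: "model_derivation E"
    unfolding E_def by (intro model_derivation_sum pair_derivation_derivation) (use y in blast)+
  have "D f = E f" if f: "f \<in> V" for f
  proof (rule model_derivation_eqI[OF D E _ _ f])
    fix v assume "v \<in> verts Q"
    thus "D (ind (stat v)) = E (ind (stat v))"
      by (simp add: E_def stat pair_derivation_stat)
  next
    fix b assume b: "b \<in> arcs Q"
    have "(\<Sum>p\<in>Poly_Mapping.keys (y a). scal (?y a p) (pair_derivation a p (ind (arrow Q b)))) =
        (if a = b then D (ind (arrow Q b)) else 0)" if a: "a \<in> arcs Q" for a
    proof -
      have "pair_derivation a p (ind (arrow Q b)) = (if b = a then ind p else (0 :: _ \<Rightarrow> 'k))"
        if "p \<in> Poly_Mapping.keys (y a)" for p
        using pair_derivation_arrow[OF b, of p a] y[OF a that] by (simp add: type_II_support_def)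
      hence "(\<Sum>p\<in>Poly_Mapping.keys (y a). scal (?y a p) (pair_derivation a p (ind (arrow Q b)))) =
          (\<Sum>p\<in>Poly_Mapping.keys (y a). scal (?y a p) (if b = a then ind p else 0))"
        by (intro sum.cong) simp_all
      also have "\<dots> = (if a = b then (\<Sum>p\<in>Poly_Mapping.keys (y b). scal (?y b p) (ind p)) else 0)"
        by simp
      also have "(\<Sum>p\<in>Poly_Mapping.keys (y b). scal (?y b p) (ind p)) = D (ind (arrow Q b))"
      proof
        fix r
        have "(\<Sum>p\<in>Poly_Mapping.keys (y b). ?y b p * ind p r) = ?y b r"
          by (simp add: ind_apply in_keys_iff if_distrib[of "\<lambda>x. _ * x"] cong: if_cong)
        thus "(\<Sum>p\<in>Poly_Mapping.keys (y b). scal (?y b p) (ind p)) r = D (ind (arrow Q b)) r"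
          using spanned_outside[OF arr[OF b], of r]
          by (simp add: fun_sum_apply scal_apply) (simp add: y_def lookup_combination)
      qed
      finally show ?thesis .
    qed
    thus "D (ind (arrow Q b)) = E (ind (arrow Q b))"
      using b by (simp add: E_def)
  qed
  hence DE: "D (coords X) = E (coords X)" if "X \<in> carrier A" for X
    using that by simp
  have "elt (D (coords X)) = (\<Oplus>\<^bsub>A\<^esub>a\<in>arcs Q. delta Q I a (y a) X)" if X: "X \<in> carrier A" for X
  proof -
    have V: "pair_derivation a p (coords X) \<in> V" if "a \<in> arcs Q" "p \<in> Poly_Mapping.keys (y a)" for a p
      using pair_derivation_derivation[of a p] y[OF that] that(1) linear_mapD(1) coords_V[OF X]
      unfolding model_derivation_def by blast
    have dpath: "delta_path Q I a p X = elt (pair_derivation a p (coords X))"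
      if "a \<in> arcs Q" "p \<in> Poly_Mapping.keys (y a)" for a p
      using delta_path_eq[OF that(1) _ _ X] y[OF that] by blast
    have delta: "delta Q I a (y a) X \<in> carrier A \<and> coords (delta Q I a (y a) X) =
        (\<Sum>p\<in>Poly_Mapping.keys (y a). scal (?y a p) (pair_derivation a p (coords X)))" if a: "a \<in> arcs Q" for a
    proof
      show "delta Q I a (y a) X \<in> carrier A"
        unfolding delta_def by (rule A.finsum_closed) (use dpath[OF a] in auto)
      have "coords (delta Q I a (y a) X) =
          (\<Sum>p\<in>Poly_Mapping.keys (y a). coords (?y a p \<odot>\<^bsub>A\<^esub> delta_path Q I a p X))"
        unfolding delta_def by (rule coords_finsum) (use dpath[OF a] in auto)
      also have "\<dots> = (\<Sum>p\<in>Poly_Mapping.keys (y a). scal (?y a p) (pair_derivation a p (coords X)))"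
        by (rule sum.cong) (use dpath[OF a] V[OF a] in auto)
      finally show "coords (delta Q I a (y a) X) = \<dots>" .
    qed
    have "coords (\<Oplus>\<^bsub>A\<^esub>a\<in>arcs Q. delta Q I a (y a) X) = (\<Sum>a\<in>arcs Q. coords (delta Q I a (y a) X))"
      by (rule coords_finsum) (use delta in auto)
    also have "\<dots> = E (coords X)"
      unfolding E_def by (rule sum.cong) (use delta in auto)
    finally have "coords (\<Oplus>\<^bsub>A\<^esub>a\<in>arcs Q. delta Q I a (y a) X) = D (coords X)"
      using DE[OF X] by simp
    moreover have "(\<Oplus>\<^bsub>A\<^esub>a\<in>arcs Q. delta Q I a (y a) X) \<in> carrier A"
      by (rule A.finsum_closed) (use delta in auto)
    ultimately show ?thesis by (intro eltI)
  qed
  moreover have "delta_pair Q I a p \<and> left_maximal Q I p \<and> plength p > 1"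
    if "a \<in> arcs Q" "p \<in> Poly_Mapping.keys (y a)" for a p
    using y[OF that] that(1)
    by (auto simp: delta_pair_def left_maximal_iff right_maximal_iff type_II_support_def parallel_def)
  moreover have "derivation A (\<lambda>X. elt (D (coords X)))"
    by (rule derivation_of_model_derivation[OF D]) simp
  ultimately show ?thesis
    unfolding type_II_def by blast
qed

text \<open>
  Only the terms with \<open>n \<le> 1\<close> can occur in the exponential series, and their
  coefficients are \<open>1\<close> in every characteristic.
\<close>

lemma exp_square_zero:
  assumes "X \<in> carrier A" "d X \<in> carrier A" "d (d X) = \<zero>\<^bsub>A\<^esub>" "d \<zero>\<^bsub>A\<^esub> = \<zero>\<^bsub>A\<^esub>"
  shows "exp_derivation A d X = X \<oplus>\<^bsub>A\<^esub> d X"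
proof -
  have one: "inverse (of_nat (fact 0)) \<odot>\<^bsub>A\<^esub> Y = Y" "inverse (of_nat (fact 1)) \<odot>\<^bsub>A\<^esub> Y = Y"
    if "Y \<in> carrier A" for Y
    using that by (simp_all add: coords_inject[symmetric])
  have high: "(d ^^ Suc (Suc n)) X = \<zero>\<^bsub>A\<^esub>" for n
    by (induction n) (simp_all add: assms)
  have supp: "(d ^^ n) X \<noteq> \<zero>\<^bsub>A\<^esub> \<longleftrightarrow> n = 0 \<and> X \<noteq> \<zero>\<^bsub>A\<^esub> \<or> n = 1 \<and> d X \<noteq> \<zero>\<^bsub>A\<^esub>" for n
  proof (cases n)
    case (Suc m)
    thus ?thesis using high by (cases m) auto
  qed simp
  consider "X = \<zero>\<^bsub>A\<^esub>" | "X \<noteq> \<zero>\<^bsub>A\<^esub>" "d X = \<zero>\<^bsub>A\<^esub>" | "X \<noteq> \<zero>\<^bsub>A\<^esub>" "d X \<noteq> \<zero>\<^bsub>A\<^esub>" by blast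
  thus ?thesis
  proof cases
    case 1
    hence "{n. (d ^^ n) X \<noteq> \<zero>\<^bsub>A\<^esub>} = {}" using supp assms by auto
    thus ?thesis using 1 assms by (simp add: exp_derivation_def)
  next
    case 2
    hence "{n. (d ^^ n) X \<noteq> \<zero>\<^bsub>A\<^esub>} = {0}" using supp by auto
    thus ?thesis using 2 assms one by (simp add: exp_derivation_def)
  next
    case 3
    hence "{n. (d ^^ n) X \<noteq> \<zero>\<^bsub>A\<^esub>} = {0, 1}" using supp by auto
    thus ?thesis using assms one by (simp add: exp_derivation_def)
  qed
qed

section \<open>The factorization\<close>

text \<open>
  Let \<open>g\<close> and \<open>h = g\<^sup>-\<^sup>1\<close> be such that \<open>\<Psi>(x) = g \<phi>(x) h\<close> has no bad coefficients. With
  \<open>u = \<phi>\<^sup>-\<^sup>1(g)\<close> one gets \<open>\<Psi>(u\<^sup>-\<^sup>1 x u) = \<phi>(x)\<close>, that is \<open>\<phi> = \<Psi> \<circ> \<Delta>\<^sub>u\<close>, and \<open>\<Psi>\<close> is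
  \<open>exp(\<delta>) \<circ> \<rho>\<close>.
\<close>

theorem factorization:
  assumes "\<phi> \<in> graded_unipotent_aut Q I" "\<phi> \<in> vertex_fixing_aut Q I"
  shows "\<exists>y \<rho> \<delta>. y \<in> degree_above Q I 0 \<and> \<rho> \<in> diagonal_aut Q I \<and> type_II Q I \<delta> \<and>
    (\<forall>z\<in>carrier A. \<phi> z = (exp_derivation A \<delta> \<circ> \<rho> \<circ> inner_aut A (\<one>\<^bsub>A\<^esub> \<oplus>\<^bsub>A\<^esub> y)) z)"
proof -
  define \<Phi> where "\<Phi> x = coords (\<phi> (elt x))" for x
  have \<Phi>: "algebra_endo \<Phi>" "unipotent \<Phi>"
    unfolding \<Phi>_def using algebra_endo_of_aut unipotent_of_graded assms by blast+
  note \<Phi>D = algebra_endoD[OF \<Phi>(1)]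
  obtain g h where gh: "unit_pair g h"
    and elim: "\<forall>a es. a \<in> arcs Q \<longrightarrow> bad a es \<longrightarrow> (g \<star> \<Phi> (ind (arrow Q a)) \<star> h) (word es) = 0"
    using eliminate[OF \<Phi>] by blast
  define \<Psi> where "\<Psi> f = g \<star> \<Phi> f \<star> h" for f
  have \<Psi>: "algebra_endo \<Psi>" "unipotent \<Psi>" "no_bad_coefficients \<Psi>"
    unfolding \<Psi>_def using conj_algebra_endo[OF gh \<Phi>(1)] conj_unipotent[OF gh \<Phi>D(1) \<Phi>(2)] elim
    by (simp_all add: no_bad_coefficients_def)
  let ?\<rho> = "diagonal_part \<Psi>"
  note \<Psi>lin = algebra_endoD(1)[OF \<Psi>(1)]
  have \<rho>: "algebra_endo ?\<rho>" "unipotent ?\<rho>"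
    using diagonal_part_endo[OF \<Psi>] diagonal_part_unipotent[OF \<Psi>lin \<Psi>(2)] by blast+
  obtain D where D: "linear_map D" "\<And>f g. f \<in> V \<Longrightarrow> g \<in> V \<Longrightarrow> D (f \<star> g) = D f \<star> g + f \<star> D g"
      "\<And>v. v \<in> verts Q \<Longrightarrow> D (ind (stat v)) = 0"
      "\<And>a. a \<in> arcs Q \<Longrightarrow> D (ind (arrow Q a)) \<in> spanned (type_II_support a)"
      "\<And>f. f \<in> V \<Longrightarrow> D (D f) = 0" "\<And>f. f \<in> V \<Longrightarrow> \<Psi> f = ?\<rho> f + D (?\<rho> f)"
  proof (rule exponential_factor[OF \<Psi>], goal_cases)
    case (1 \<delta>)
    show ?case by (rule 1(1)[OF 1(2-7)])
  qed
  obtain S where S: "algebra_endo S" "\<And>f. f \<in> V \<Longrightarrow> \<Phi> (S f) = f" "\<And>f. f \<in> V \<Longrightarrow> S (\<Phi> f) = f"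
    using unipotent_inverse[OF \<Phi>] by blast
  note SD = algebra_endoD[OF S(1)]
  define u u' where "u = S g" and "u' = S h"
  have ghV: "g \<in> V" "h \<in> V"
    using gh spanned_V unfolding unit_pair_def by blast+
  have uV: "u \<in> V" "u' \<in> V"
    using linear_mapD(1)[OF SD(1)] ghV by (simp_all add: u_def u'_def)
  have uu: "u \<star> u' = unit" "u' \<star> u = unit"
    using SD(2) ghV gh algebra_endo_unit[OF S(1)] by (auto simp: u_def u'_def unit_pair_def simp flip: SD(2))
  have \<Phi>u: "\<Phi> u = g" "\<Phi> u' = h"
    using S(2) ghV by (simp_all add: u_def u'_def)
  let ?y = "elt (u - unit)" and ?R = "\<lambda>X. elt (?\<rho> (coords X))" and ?d = "\<lambda>X. elt (D (coords X))"
  have "u - unit = S (g - unit)"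
    using linear_map_diff[OF SD(1) ghV(1) unit_V] algebra_endo_unit[OF S(1)] by (simp add: u_def)
  moreover have "S (g - unit) \<in> deg 1"
  proof (rule linear_map_spanned[OF SD(1)])
    show "g - unit \<in> deg 1" using gh by (simp add: unit_pair_def)
    show "S (ind w) \<in> deg 1" if "w \<in> B" "1 \<le> plength w" for w
      using deg_mono[OF algebra_endo_deg[OF S(1) that(1)] that(2)] .
  qed
  ultimately have yd: "u - unit \<in> deg 1" by simp
  have y: "?y \<in> degree_above Q I 0"
    unfolding degree_above_def using spanned_V[OF yd] spanned_mono[OF yd]
    by (subst span_paths_iff) auto
  have one_y: "\<one>\<^bsub>A\<^esub> \<oplus>\<^bsub>A\<^esub> ?y = elt u"
    using spanned_V[OF yd] by (intro eltI[symmetric]) auto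
  have inv: "inv\<^bsub>A\<^esub> (elt u) = elt u'"
    using uV uu by (intro A.inv_unique'[symmetric] eltI) (auto simp flip: elt_mult intro!: eltI)
  have "\<phi> z = (exp_derivation A ?d \<circ> ?R \<circ> inner_aut A (\<one>\<^bsub>A\<^esub> \<oplus>\<^bsub>A\<^esub> ?y)) z" if z: "z \<in> carrier A" for z
  proof -
    let ?f = "coords z"
    let ?c = "u' \<star> ?f \<star> u"
    have fV: "?f \<in> V" using z by simp
    have "inner_aut A (\<one>\<^bsub>A\<^esub> \<oplus>\<^bsub>A\<^esub> ?y) z = elt ?c"
      unfolding one_y inner_aut_def inv using z uV by (intro eltI[symmetric]) auto
    moreover have "\<Psi> ?c = \<Phi> ?f"
    proof -
      have "\<Phi> ?c = h \<star> \<Phi> ?f \<star> g"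
        using \<Phi>D(2) fV uV \<Phi>u by simp
      hence "\<Psi> ?c = (g \<star> h) \<star> \<Phi> ?f \<star> (g \<star> h)"
        by (simp add: \<Psi>_def conv_assoc)
      thus ?thesis
        using gh linear_mapD(1)[OF \<Phi>D(1) fV] by (simp add: unit_pair_def conv_unit_left conv_unit_right)
    qed
    moreover have "exp_derivation A ?d (elt (?\<rho> ?c)) = elt (\<Psi> ?c)"
    proof -
      have V: "?\<rho> ?c \<in> V" "D (?\<rho> ?c) \<in> V"
        using linear_mapD(1)[OF algebra_endoD(1)[OF \<rho>(1)]] linear_mapD(1)[OF D(1)] by simp_all
      have "exp_derivation A ?d (elt (?\<rho> ?c)) = elt (?\<rho> ?c) \<oplus>\<^bsub>A\<^esub> ?d (elt (?\<rho> ?c))"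
        using V D(5)[OF V(1)] by (intro exp_square_zero) (simp_all add: linear_map_0[OF D(1)] elt_zero)
      also have "\<dots> = elt (?\<rho> ?c + D (?\<rho> ?c))"
        using V by (simp add: elt_add)
      finally show ?thesis using D(6)[of ?c] by simp
    qed
    moreover have "\<phi> z \<in> carrier A"
      using assms(2) z by (auto simp: vertex_fixing_aut_def algebra_aut_def ring_iso_def intro: ring_hom_closed)
    ultimately show ?thesis
      using z by (simp add: \<Phi>_def)
  qed
  moreover have "?R \<in> diagonal_aut Q I"
    using diagonal_of_endo[OF \<rho>] diagonal_part_spanned[OF \<Psi>lin] by blast
  moreover have "type_II Q I ?d"
    using type_II_of_model[of D] D(1-4) by (simp add: model_derivation_def)
  ultimately show ?thesis using y by blast
qed

end

theorem proposition1p2: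
  fixes Q :: "('v, 'e) pre_digraph"
    and I :: "(('v, 'e) qpath \<Rightarrow>\<^sub>0 'k::field) set"
    and \<phi> :: "(('v, 'e) qpath \<Rightarrow>\<^sub>0 'k) set \<Rightarrow> (('v, 'e) qpath \<Rightarrow>\<^sub>0 'k) set"
  assumes "string_algebra Q I"
    and "\<phi> \<in> graded_unipotent_aut Q I \<inter> vertex_fixing_aut Q I"
  shows "\<exists>y \<rho> \<delta>.
    y \<in> degree_above Q I 0 \<and> \<rho> \<in> diagonal_aut Q I \<and> type_II Q I \<delta> \<and>
    (\<forall>z\<in>carrier (quotient_algebra Q I).
       \<phi> z = (exp_derivation (quotient_algebra Q I) \<delta> \<circ> \<rho> \<circ>
         inner_aut (quotient_algebra Q I)
           (\<one>\<^bsub>quotient_algebra Q I\<^esub> \<oplus>\<^bsub>quotient_algebra Q I\<^esub> y)) z)"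
  using string_algebra.factorization[OF assms(1)] assms(2) by blast

end
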